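(* Let $X$ be a Peano continuum and $p$ a prime. Then the set $\mathrm{Hom}(\pi_1(X),\mathbb{Z}/p)$ of group homomorphisms is either finite or of cardinality $2^{2^{\aleph_0}}$, and $\mathrm{Hom}(\pi_1(X),\mathbb{Q})$ is either countable or of cardinality $2^{2^{\aleph_0}}$.
   Context: A Peano continuum is a path connected, locally path connected, compact metrizable space. *)

theory Defs
  imports "HOL-Analysis.Analysis" "HOL-Algebra.Elementary_Groups" "HOL-Library.Equipollence"
begin

definition peano_continuum :: "'a topology \<Rightarrow> bool" where
  "peano_continuum X \<longleftrightarrow> path_connected_space X \<and> locally_path_connected_space X \<and>
     compact_space X \<and> metrizable_space X"

definition loops_at :: "'a topology \<Rightarrow> 'a \<Rightarrow> (real \<Rightarrow> 'a) set" where
  "loops_at X x = {g. pathin X g \<and> g 0 = x \<and> g 1 = x}"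

definition loop_homotopy_rel :: "'a topology \<Rightarrow> 'a \<Rightarrow> ((real \<Rightarrow> 'a) \<times> (real \<Rightarrow> 'a)) set" where
  "loop_homotopy_rel X x =
     {(f, g). f \<in> loops_at X x \<and> g \<in> loops_at X x \<and>
        homotopic_with (\<lambda>h. h 0 = x \<and> h 1 = x) (subtopology euclideanreal {0..1}) X f g}"

text \<open>Concatenation of paths (as joinpaths, but for arbitrary carrier types).\<close>
definition loop_concat :: "(real \<Rightarrow> 'a) \<Rightarrow> (real \<Rightarrow> 'a) \<Rightarrow> real \<Rightarrow> 'a" where
  "loop_concat g1 g2 = (\<lambda>t. if t \<le> 1/2 then g1 (2 * t) else g2 (2 * t - 1))"

definition fundamental_group :: "'a topology \<Rightarrow> 'a \<Rightarrow> (real \<Rightarrow> 'a) set monoid" where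
  "fundamental_group X x =
     \<lparr>carrier = loops_at X x // loop_homotopy_rel X x,
      monoid.mult = (\<lambda>A B. \<Union>a\<in>A. \<Union>b\<in>B. loop_homotopy_rel X x `` {loop_concat a b}),
      one = loop_homotopy_rel X x `` {\<lambda>t. x}\<rparr>"

definition rat_add_group :: "rat monoid" where
  "rat_add_group = \<lparr>carrier = UNIV, monoid.mult = (+), one = 0\<rparr>"

definition Hom_set :: "('a, 'c) monoid_scheme \<Rightarrow> ('b, 'd) monoid_scheme \<Rightarrow> ('a \<Rightarrow> 'b) set" where
  "Hom_set G H = hom G H \<inter> extensional (carrier G)"

end

theory Submission
  imports Defs
begin

text \<open>
  Let \<open>q\<close> be \<open>p\<close> or \<open>0\<close> and let \<open>R\<close> be the radical of the fundamental group \<open>G\<close>, the elements \<open>g\<close> such that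
  \<open>g^k c^q\<close> lies in the commutator subgroup for some \<open>c\<close> and some \<open>k\<close> not divisible by \<open>q\<close>. Every
  homomorphism from \<open>G\<close> to the prime field of characteristic \<open>q\<close> kills \<open>R\<close>, and \<open>G / R\<close> is a vector space over it.

  If each point has a neighbourhood all of whose loops lie in \<open>R\<close>, then by compactness a homomorphism is
  determined by its values on finitely many elements. Otherwise there are loops \<open>l 0, l 1, \<dots>\<close> outside \<open>R\<close>
  that shrink to a point. For a set \<open>s\<close> of natural numbers let \<open>L s\<close> be the infinite concatenation of the \<open>l n\<close>
  with \<open>n \<in> s\<close>. The relation \<open>L s = L t\<close> modulo \<open>R\<close> is analytic, because \<open>R\<close> is defined by
  equations and null homotopies, so it has the Baire property; and it is
  destroyed by changing a single membership of \<open>s\<close>. Hence it is meager, and \<open>G / R\<close> has the cardinality of the continuum. It then has a basis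
  of that cardinality, on which homomorphisms can be prescribed freely.
\<close>

section \<open>Meager sets of sequences\<close>

text \<open>The parameter \<open>q\<close> treats both coefficient groups at once. For
  \<open>q = 0\<close> the condition \<open>q dvd k\<close> means \<open>k = 0\<close> and
  \<open>c^q\<close> is trivial, so \<open>R\<close> consists of the elements with a nonzero power
  in the commutator subgroup; for \<open>q = p\<close> the exponent \<open>k\<close> is invertible
  modulo \<open>p\<close>, and \<open>R\<close> consists of \<open>p\<close>-th powers times
  commutators modulo commutators.

  The delicate point is that the relation on sets \<open>s\<close>, \<open>t\<close> is analytic.
  Null homotopies do not form a compact space, so a limit of solutions may fail to be continuous.
  Prescribing a modulus of continuity for every tolerance cuts them into pieces closed under
  pointwise limits, indexed by sequences of naturals. This is the Souslin scheme, and the category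
  argument uses only that it splits and that limits stay inside.

  At a fixed time \<open>L s\<close> depends on finitely many memberships, so along a converging
  sequence of sets its value there is eventually constant. Limits therefore only have to preserve
  equations between values at single times. This is why products of loops are described by cutting
  one path into halves and comparing the pieces pointwise.\<close>

definition cyl :: "'b list \<Rightarrow> (nat \<Rightarrow> 'b) set" where
  "cyl w = {s. \<forall>i<length w. s i = w ! i}"

text \<open>Nowhere density for the product of discrete copies of the alphabet, with finite words in
  place of basic open sets.\<close>

definition nwd :: "(nat \<Rightarrow> 'b) set \<Rightarrow> bool" where
  "nwd A \<longleftrightarrow> (\<forall>w. \<exists>v. cyl (w @ v) \<inter> A = {})"

definition meager :: "(nat \<Rightarrow> 'b) set \<Rightarrow> bool" where
  "meager A \<longleftrightarrow> (\<exists>F::nat \<Rightarrow> _. (\<forall>n. nwd (F n)) \<and> A \<subseteq> (\<Union>n. F n))"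

definition init :: "(nat \<Rightarrow> 'b) \<Rightarrow> nat \<Rightarrow> 'b list" where
  "init s n = map s [0..<n]"

lemma length_init [simp]: "length (init s n) = n"
  by (simp add: init_def)

lemma nth_init [simp]: "i < n \<Longrightarrow> init s n ! i = s i"
  by (simp add: init_def)

lemma init_Suc: "init s (Suc n) = init s n @ [s n]"
  by (simp add: init_def)

lemma mem_cyl_init [simp]: "s \<in> cyl (init s n)"
  by (simp add: cyl_def)

lemma cyl_Nil [simp]: "cyl [] = UNIV"
  by (simp add: cyl_def)

lemma cyl_append_subset: "cyl (w @ v) \<subseteq> cyl w"
  by (auto simp: cyl_def nth_append)

lemma mem_cylD: "s \<in> cyl w \<Longrightarrow> init s (length w) = w"
  by (auto simp: cyl_def intro: nth_equalityI)

lemma init_le_append: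
  assumes "m \<le> n" shows "\<exists>v. init s n = init s m @ v"
  using assms by (metis init_def le_add_diff_inverse map_append upt_add_eq_append zero_le)

lemma cyl_init_antimono: "m \<le> n \<Longrightarrow> cyl (init s n) \<subseteq> cyl (init s m)"
  by (metis cyl_append_subset init_le_append)

lemma mem_cyl_appendE:
  assumes "s \<in> cyl w" "length w \<le> n"
  obtains v where "init s n = w @ v"
  using assms init_le_append mem_cylD by metis

lemma nwd_imp_meager: "nwd A \<Longrightarrow> meager A"
  unfolding meager_def by (rule exI[of _ "\<lambda>_. A"]) auto

lemma nwd_empty: "nwd {}" by (simp add: nwd_def)

lemma meager_subset: "meager B \<Longrightarrow> A \<subseteq> B \<Longrightarrow> meager A"
  unfolding meager_def by blast

lemma meager_UN_countable:
  fixes A :: "'i::countable \<Rightarrow> (nat \<Rightarrow> 'b) set"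
  assumes "\<And>i. meager (A i)"
  shows "meager (\<Union>i. A i)"
proof -
  obtain F where F: "\<And>i n. nwd (F i (n::nat))" "\<And>i. A i \<subseteq> (\<Union>n. F i n)"
    using assms unfolding meager_def by metis
  define G where "G k = (let (i, n) = from_nat k :: 'i \<times> nat in F i n)" for k
  have "nwd (G k)" for k by (simp add: G_def F(1) split: prod.split)
  moreover have "(\<Union>i. A i) \<subseteq> (\<Union>k. G k)"
  proof
    fix x assume "x \<in> (\<Union>i. A i)"
    then obtain i n where "x \<in> F i n" using F(2) by blast
    then have "x \<in> G (to_nat (i, n))" by (simp add: G_def)
    then show "x \<in> (\<Union>k. G k)" by blast
  qed
  ultimately show ?thesis unfolding meager_def by blast
qed

lemma meager_Un: assumes "meager A" "meager B" shows "meager (A \<union> B)"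
proof -
  have "meager (\<Union>b::bool. if b then A else B)"
    by (rule meager_UN_countable) (simp add: assms)
  then show ?thesis by (rule meager_subset) (auto split: if_splits)
qed

text \<open>The Baire category theorem: a growing sequence of words avoids the sets
  \<open>F n\<close> one after the other.\<close>

lemma not_meager_cyl: "\<not> meager (cyl w)"
proof
  assume "meager (cyl w)"
  then obtain F where F: "\<And>n::nat. nwd (F n)" "cyl w \<subseteq> (\<Union>n. F n)"
    unfolding meager_def by blast
  obtain e where e: "cyl (v @ e n v) \<inter> F n = {}" for n v
    using F(1) unfolding nwd_def by metis
  \<comment> \<open>The extension \<open>e n v\<close> may be empty; the padding letter makes the
    lengths grow, so that \<open>W i\<close> has an entry at index \<open>i\<close>.\<close>
  define W where "W = rec_nat (w @ [undefined]) (\<lambda>n v. v @ e n v @ [undefined])"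
  have W0: "W 0 = w @ [undefined]" and WS: "W (Suc n) = W n @ e n (W n) @ [undefined]" for n
    by (simp_all add: W_def)
  have len: "n < length (W n)" for n
    by (induction n) (auto simp: W0 WS)
  have ext: "\<exists>u. W (n + k) = W n @ u" for n k
    by (induction k) (auto simp: WS)
  have pre: "W m ! i = W n ! i" if "i < length (W m)" "i < length (W n)" for i m n
  proof (cases "m \<le> n")
    case True then show ?thesis using ext[of m "n - m"] that by (auto simp: nth_append)
  next
    case False then show ?thesis using ext[of n "m - n"] that by (auto simp: nth_append)
  qed
  define s where "s i = W i ! i" for i
  have sW: "s \<in> cyl (W n)" for n
    unfolding cyl_def s_def by (blast intro: pre len)
  have "s \<notin> F n" for n
  proof -
    have "s \<in> cyl (W n @ e n (W n))"
      using sW[of "Suc n"] cyl_append_subset[of "W n @ e n (W n)" "[undefined]"] by (auto simp: WS)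
    then show ?thesis using e by blast
  qed
  moreover have "s \<in> cyl w" using sW[of 0] cyl_append_subset by (auto simp: W0)
  ultimately show False using F(2) by blast
qed

section \<open>Category and the Souslin operation\<close>

text \<open>Otherwise the cylinders in which \<open>A\<close> is meager are dense in
  \<open>cyl w\<close>. Words over a countable alphabet are countable, so the union of these
  cylinders meets \<open>A\<close> in a meager set, and the rest of \<open>cyl w\<close> is nowhere
  dense.\<close>

lemma nonmeager_everywhere:
  fixes A :: "(nat \<Rightarrow> 'b::countable) set"
  assumes "\<not> meager (cyl w \<inter> A)"
  shows "\<exists>v. \<forall>u. \<not> meager (cyl (w @ v @ u) \<inter> A)"
proof (rule ccontr)
  assume "\<not> ?thesis"
  then have H: "\<forall>v. \<exists>u. meager (cyl (w @ v @ u) \<inter> A)" by blast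
  define Q where "Q v = (if meager (cyl v \<inter> A) then cyl v else {})" for v
  have "meager (\<Union>v. Q v \<inter> A)"
    by (rule meager_UN_countable) (auto simp: Q_def nwd_imp_meager nwd_empty)
  moreover have "nwd (cyl w - (\<Union>v. Q v))"
    unfolding nwd_def
  proof
    fix x
    show "\<exists>v. cyl (x @ v) \<inter> (cyl w - (\<Union>v. Q v)) = {}"
    proof (cases "\<exists>v. cyl (x @ v) \<inter> cyl w = {}")
      case True then show ?thesis by blast
    next
      case False
      then have "cyl (x @ []) \<inter> cyl w \<noteq> {}" by blast
      then obtain s where s: "s \<in> cyl x" "s \<in> cyl w" by auto
      define n where "n = max (length x) (length w)"
      obtain v1 where v1: "init s n = x @ v1" using s(1) mem_cyl_appendE n_def by (metis max.cobounded1)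
      obtain v2 where v2: "init s n = w @ v2" using s(2) mem_cyl_appendE n_def by (metis max.cobounded2)
      obtain u where u: "meager (cyl (w @ v2 @ u) \<inter> A)" using H by blast
      have eq: "w @ v2 @ u = x @ (v1 @ u)" using v1 v2 by (metis append_assoc)
      then have "cyl (x @ (v1 @ u)) \<subseteq> Q (x @ (v1 @ u))" using u unfolding Q_def by (metis order_refl)
      then show ?thesis by blast
    qed
  qed
  ultimately have "meager ((\<Union>v. Q v \<inter> A) \<union> (cyl w - (\<Union>v. Q v)))"
    using meager_Un nwd_imp_meager by blast
  then have "meager (cyl w \<inter> A)" by (rule meager_subset) blast
  with assms show False ..
qed

text \<open>The classical argument that the Souslin operation preserves the Baire property; the family
  \<open>A\<close> is a scheme whose limit condition replaces closedness.\<close>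

lemma souslin_comeager:
  fixes A :: "nat list \<Rightarrow> (nat \<Rightarrow> 'b::countable) set"
  assumes split: "\<And>\<sigma>. A \<sigma> \<subseteq> (\<Union>n. A (\<sigma> @ [n]))"
    and lim: "\<And>s b. (\<And>k n. cyl (init s n) \<inter> A (init b k) \<noteq> {}) \<Longrightarrow> s \<in> A []"
    and "\<not> meager (A [])"
  shows "\<exists>w. meager (cyl w - A [])"
proof -
  \<comment> \<open>Nonmeagerness in every subcylinder, not only in \<open>cyl w\<close>, is the
    form that survives shrinking the cylinder.\<close>
  define full where "full w \<sigma> \<longleftrightarrow> (\<forall>u. \<not> meager (cyl (w @ u) \<inter> A \<sigma>))" for w \<sigma>
  have full1: "\<exists>v. full (w @ v) \<sigma>" if "\<not> meager (cyl w \<inter> A \<sigma>)" for w \<sigma>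
    using nonmeager_everywhere[OF that] by (simp add: full_def)
  have full2: "\<exists>v' n. full (w @ v @ v') (\<sigma> @ [n])" if "full w \<sigma>" for w v \<sigma>
  proof -
    have "\<not> meager (\<Union>n. cyl (w @ v) \<inter> A (\<sigma> @ [n]))"
    proof
      assume "meager (\<Union>n. cyl (w @ v) \<inter> A (\<sigma> @ [n]))"
      then have "meager (cyl (w @ v) \<inter> A \<sigma>)"
        by (rule meager_subset) (use split[of \<sigma>] in blast)
      then show False using that by (auto simp: full_def)
    qed
    then obtain n where "\<not> meager (cyl (w @ v) \<inter> A (\<sigma> @ [n]))"
      using meager_UN_countable[of "\<lambda>n. cyl (w @ v) \<inter> A (\<sigma> @ [n])"] by blast
    from full1[OF this] show ?thesis by auto
  qed
  \<comment> \<open>The points of \<open>cyl w\<close> along which fullness for the node is never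
    handed on to a child. By \<open>full2\<close> children become full densely, so this set is
    nowhere dense; there are countably many of them.\<close>
  define Z where "Z w \<sigma> = {s \<in> cyl w. full w \<sigma> \<and>
      \<not> (\<exists>n m. length w \<le> m \<and> full (init s m) (\<sigma> @ [n]))}" for w \<sigma>
  have nwdZ: "nwd (Z w \<sigma>)" for w \<sigma>
    unfolding nwd_def
  proof
    fix x
    show "\<exists>v. cyl (x @ v) \<inter> Z w \<sigma> = {}"
    proof (cases "full w \<sigma> \<and> cyl x \<inter> cyl w \<noteq> {}")
      case False
      then have "cyl (x @ []) \<inter> Z w \<sigma> = {}" by (auto simp: Z_def)
      then show ?thesis by blast
    next
      case True
      then obtain s where s: "s \<in> cyl x" "s \<in> cyl w" by auto
      define N where "N = max (length x) (length w)"
      obtain v1 where v1: "init s N = x @ v1" using s(1) mem_cyl_appendE N_def by (metis max.cobounded1)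
      obtain v2 where v2: "init s N = w @ v2" using s(2) mem_cyl_appendE N_def by (metis max.cobounded2)
      obtain u n where u: "full (w @ v2 @ u) (\<sigma> @ [n])" using full2 True by blast
      have eq: "w @ v2 @ u = x @ (v1 @ u)" using v1 v2 by (metis append_assoc)
      have "t \<notin> Z w \<sigma>" if "t \<in> cyl (x @ (v1 @ u))" for t
      proof -
        have "init t (length (w @ v2 @ u)) = w @ v2 @ u" using that eq mem_cylD by metis
        then have "full (init t (length (w @ v2 @ u))) (\<sigma> @ [n])" using u by simp
        moreover have "length w \<le> length (w @ v2 @ u)" by simp
        ultimately show ?thesis unfolding Z_def by blast
      qed
      then show ?thesis by blast
    qed
  qed
  have "meager (\<Union>p. case p of (w, \<sigma>) \<Rightarrow> Z w \<sigma>)"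
    by (rule meager_UN_countable) (auto simp: nwdZ nwd_imp_meager split: prod.split)
  moreover obtain w0 where w0: "full w0 []" 
    using full1[of "[]" "[]"] assms(3) by auto
  \<comment> \<open>Outside the exceptional sets a branch can be followed for ever along
    \<open>s\<close>. Its sets are nonmeager near \<open>s\<close>, hence meet every cylinder around
    \<open>s\<close>, and \<open>lim\<close> puts \<open>s\<close> into \<open>A []\<close>.\<close>
  have "cyl w0 - A [] \<subseteq> (\<Union>p. case p of (w, \<sigma>) \<Rightarrow> Z w \<sigma>)"
  proof
    fix s assume s: "s \<in> cyl w0 - A []"
    show "s \<in> (\<Union>p. case p of (w, \<sigma>) \<Rightarrow> Z w \<sigma>)"
    proof (rule ccontr)
      assume "\<not> ?thesis"
      then have nZ: "s \<notin> Z w \<sigma>" for w \<sigma> by auto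
      have step: "\<exists>n m'. m \<le> m' \<and> full (init s m') (\<sigma> @ [n])" if "full (init s m) \<sigma>" for m \<sigma>
        using nZ[of "init s m" \<sigma>] that by (auto simp: Z_def)
      obtain nn mm where nm: "full (init s m) \<sigma> \<Longrightarrow>
          m \<le> mm m \<sigma> \<and> full (init s (mm m \<sigma>)) (\<sigma> @ [nn m \<sigma>])" for m \<sigma>
        using step by metis
      \<comment> \<open>\<open>P k\<close> holds the length of the initial segment of
        \<open>s\<close> in use and the first \<open>k\<close> entries of the branch.\<close>
      define P where "P = rec_nat (length w0, []) (\<lambda>_ (m, \<sigma>). (mm m \<sigma>, \<sigma> @ [nn m \<sigma>]))"
      have P0: "P 0 = (length w0, [])"
        and PS: "P (Suc k) = (mm (fst (P k)) (snd (P k)), snd (P k) @ [nn (fst (P k)) (snd (P k))])" for k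
        by (simp_all add: P_def split: prod.split)
      have fP: "full (init s (fst (P k))) (snd (P k))" for k
      proof (induction k)
        case 0
        have "init s (length w0) = w0" using s mem_cylD by blast
        then show ?case using w0 by (simp add: P0)
      next
        case (Suc k) then show ?case using nm by (simp add: PS)
      qed
      define b where "b k = nn (fst (P k)) (snd (P k))" for k
      have bP: "init b k = snd (P k)" for k
        by (induction k) (auto simp: P0 PS init_Suc b_def, simp add: init_def)
      have "cyl (init s n) \<inter> A (init b k) \<noteq> {}" for k n
      proof -
        define m where "m = fst (P k)"
        obtain u where u: "init s (max m n) = init s m @ u" using init_le_append by (metis max.cobounded1)
        have "\<not> meager (cyl (init s m @ u) \<inter> A (init b k))"
          using fP[of k] by (simp add: full_def m_def bP)
        then have "\<not> meager (cyl (init s (max m n)) \<inter> A (init b k))" by (simp add: u)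
        then have "cyl (init s (max m n)) \<inter> A (init b k) \<noteq> {}" using nwd_imp_meager nwd_empty by metis
        moreover have "cyl (init s (max m n)) \<subseteq> cyl (init s n)" by (rule cyl_init_antimono) simp
        ultimately show ?thesis by blast
      qed
      then have "s \<in> A []" by (rule lim)
      with s show False by blast
    qed
  qed
  ultimately show ?thesis using meager_subset by blast
qed

text \<open>Extensions for the single words are appended one after the other; a longer extension
  stays good for the words already treated. Applied to all words of one length, this gives a block
  that works whatever precedes it.\<close>

lemma nwd_uniform:
  assumes "nwd F" "finite W"
  shows "\<exists>v. \<forall>w\<in>W. cyl (w @ v) \<inter> F = {}"
  using assms(2)
proof (induction W)
  case empty then show ?case by simp
next
  case (insert w W)
  then obtain v where v: "\<forall>w\<in>W. cyl (w @ v) \<inter> F = {}" by blast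
  obtain v' where v': "cyl ((w @ v) @ v') \<inter> F = {}" using assms(1) unfolding nwd_def by blast
  have "cyl (x @ v @ v') \<inter> F = {}" if "x \<in> insert w W" for x
    using v v' that cyl_append_subset[of "x @ v" v'] by (auto simp del: append_assoc simp: append_assoc[symmetric])
  then show ?case by blast
qed

text \<open>A form of Mycielski's theorem. The coordinates are cut into blocks, and the block coded
  by \<open>(n, j, b)\<close> carries a word \<open>v k\<close> that forces a pair of sequences out
  of \<open>F n\<close>. The sequence of \<open>x\<close> copies the first components of
  \<open>v k\<close> if \<open>(j \<in> x) = b\<close>, and the second ones otherwise. If
  \<open>x\<close> and \<open>y\<close> differ at \<open>j\<close>, then for
  \<open>b = (j \<in> x)\<close> the pair reads exactly \<open>v k\<close> there.\<close>

lemma meager_relation_family: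
  fixes E :: "(nat \<Rightarrow> bool \<times> bool) set"
  assumes "meager E"
  shows "\<exists>\<phi>::nat set \<Rightarrow> nat \<Rightarrow> bool. \<forall>x y. x \<noteq> y \<longrightarrow> (\<lambda>i. (\<phi> x i, \<phi> y i)) \<notin> E"
proof -
  obtain F where F: "\<And>n::nat. nwd (F n)" "E \<subseteq> (\<Union>n. F n)"
    using assms unfolding meager_def by blast
  define dec where "dec k = (from_nat k :: nat \<times> nat \<times> bool)" for k
  have fin: "finite {w :: (bool \<times> bool) list. length w = m}" for m
    using finite_lists_length_eq[of "UNIV :: (bool \<times> bool) set" m] by simp
  have "\<forall>n m. \<exists>v. \<forall>w. length w = m \<longrightarrow> cyl (w @ v) \<inter> F n = {}"
    using nwd_uniform[OF F(1) fin] by simp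
  then obtain e where "\<forall>n m w. length w = m \<longrightarrow> cyl (w @ e n m) \<inter> F n = {}" by metis
  then have e: "length w = m \<Longrightarrow> cyl (w @ e n m) \<inter> F n = {}" for w m n by blast
  \<comment> \<open>\<open>M k\<close> is where block \<open>k\<close> starts; the word of the block
    is chosen for all prefixes of that length.\<close>
  define M where "M = rec_nat 0 (\<lambda>k m. m + length (e (fst (dec k)) m))"
  define v where "v k = e (fst (dec k)) (M k)" for k
  have MS: "M (Suc k) = M k + length (v k)" for k by (simp add: M_def v_def)
  have monoM: "i \<le> j \<Longrightarrow> M i \<le> M j" for i j
    by (rule lift_Suc_mono_le[of M]) (auto simp: MS)
  define blk where "blk i = (THE k. M k \<le> i \<and> i < M (Suc k))" for i
  have blk: "blk i = k" if "M k \<le> i" "i < M (Suc k)" for i k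
    unfolding blk_def
  proof (rule the_equality)
    fix k' assume k': "M k' \<le> i \<and> i < M (Suc k')"
    show "k' = k"
    proof (rule ccontr)
      assume "k' \<noteq> k"
      then consider "Suc k' \<le> k" | "Suc k \<le> k'" by linarith
      then show False
      proof cases
        case 1 then show False using monoM[OF 1] that k' by linarith
      next
        case 2 then show False using monoM[OF 2] that k' by linarith
      qed
    qed
  qed (use that in auto)
  \<comment> \<open>The boolean in the code decides which of two differing sets writes the first
    components, since \<open>E\<close> need not be symmetric.\<close>
  define bit where "bit x k = ((fst (snd (dec k)) \<in> x) = snd (snd (dec k)))" for x k
  define \<phi> where "\<phi> x i = (let k = blk i; c = v k ! (i - M k) in if bit x k then fst c else snd c)" for x i
  have "(\<lambda>i. (\<phi> x i, \<phi> y i)) \<notin> E" if xy: "x \<noteq> y" for x y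
  proof
    assume "(\<lambda>i. (\<phi> x i, \<phi> y i)) \<in> E"
    then obtain n where n: "(\<lambda>i. (\<phi> x i, \<phi> y i)) \<in> F n" using F(2) by blast
    obtain j where j: "(j \<in> x) \<noteq> (j \<in> y)" using xy by blast
    define k where "k = to_nat (n, j, j \<in> x)"
    have dk: "dec k = (n, j, j \<in> x)" by (simp add: dec_def k_def)
    have bits: "bit x k" "\<not> bit y k" using j by (auto simp: bit_def dk)
    let ?z = "\<lambda>i. (\<phi> x i, \<phi> y i)"
    have "?z (M k + i) = v k ! i" if "i < length (v k)" for i
      using blk[of k "M k + i"] that bits by (simp add: \<phi>_def MS)
    then have zi: "?z (M k + i) = v k ! i" if "i < length (v k)" for i using that by blast
    have "?z \<in> cyl (init ?z (M k) @ v k)"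
      unfolding cyl_def
    proof (intro CollectI allI impI)
      fix i assume i: "i < length (init ?z (M k) @ v k)"
      show "?z i = (init ?z (M k) @ v k) ! i"
        using zi[of "i - M k"] i by (cases "i < M k") (simp_all add: nth_append)
    qed
    moreover have "cyl (init ?z (M k) @ v k) \<inter> F n = {}"
      using e[of "init ?z (M k)" "M k" n] by (simp add: v_def dk)
    ultimately show False using n by blast
  qed
  then show ?thesis by blast
qed

text \<open>A comeager part of a cylinder meets its own image under the flip of a coordinate beyond the
  cylinder, so a relation that never survives such a flip is meager as soon as it has the Baire property.\<close>

lemma souslin_flip_family:
  fixes A :: "nat list \<Rightarrow> (nat \<Rightarrow> bool \<times> bool) set"
  assumes split: "\<And>\<sigma>. A \<sigma> \<subseteq> (\<Union>n. A (\<sigma> @ [n]))"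
    and lim: "\<And>s b. (\<And>k n. cyl (init s n) \<inter> A (init b k) \<noteq> {}) \<Longrightarrow> s \<in> A []"
    and flip: "\<And>s m. s \<in> A [] \<Longrightarrow> s(m := (\<not> fst (s m), snd (s m))) \<notin> A []"
  shows "\<exists>\<phi>::nat set \<Rightarrow> nat \<Rightarrow> bool. \<forall>x y. x \<noteq> y \<longrightarrow> (\<lambda>i. (\<phi> x i, \<phi> y i)) \<notin> A []"
proof (rule meager_relation_family, rule ccontr)
  assume "\<not> meager (A [])"
  then obtain w where w: "meager (cyl w - A [])"
    using souslin_comeager[of A] split lim by meson
  define m where "m = length w"
  define f where "f s = s(m := (\<not> fst (s m), snd (s m)))" for s :: "nat \<Rightarrow> bool \<times> bool"
  have ff: "f (f s) = s" for s by (simp add: f_def)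
  have fcyl: "f s \<in> cyl w \<longleftrightarrow> s \<in> cyl w" for s by (auto simp: f_def cyl_def m_def)
  have nwdf: "nwd (f -` B)" if "nwd B" for B
    unfolding nwd_def
  proof
    fix x :: "(bool \<times> bool) list"
    \<comment> \<open>Lengthened so that coordinate \<open>m\<close> belongs to the word and its
      flip is again a word.\<close>
    define x' where "x' = x @ replicate (Suc m) undefined"
    have lx: "m < length x'" by (simp add: x'_def)
    define fl where "fl u = u[m := (\<not> fst (u ! m), snd (u ! m))]" for u :: "(bool \<times> bool) list"
    obtain v where v: "cyl (fl x' @ v) \<inter> B = {}" using \<open>nwd B\<close> unfolding nwd_def by blast
    have "f s \<in> cyl (fl x' @ v)" if "s \<in> cyl (x' @ v)" for s
      unfolding cyl_def
    proof (intro CollectI allI impI)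
      fix i assume i: "i < length (fl x' @ v)"
      have si: "s j = (x' @ v) ! j" if "j < length (x' @ v)" for j
        using \<open>s \<in> cyl (x' @ v)\<close> that by (simp add: cyl_def)
      show "f s i = (fl x' @ v) ! i"
        using si[of i] si[of m] i lx by (auto simp: f_def fl_def nth_append)
    qed
    then have "cyl (x' @ v) \<inter> f -` B = {}" using v by blast
    then show "\<exists>v. cyl (x @ v) \<inter> f -` B = {}" by (auto simp: x'_def)
  qed
  have mf: "meager (f -` B)" if B: "meager B" for B
  proof -
    obtain F where F: "\<And>n::nat. nwd (F n)" "B \<subseteq> (\<Union>n. F n)"
      using B unfolding meager_def by blast
    have "\<forall>n. nwd (f -` F n)" using nwdf F(1) by blast
    moreover have "f -` B \<subseteq> (\<Union>n. f -` F n)" using F(2) by blast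
    ultimately show ?thesis unfolding meager_def by (intro exI[of _ "\<lambda>n. f -` F n"]) simp
  qed
  have "cyl w \<subseteq> (cyl w - A []) \<union> f -` (cyl w - A [])"
    using flip[of _ m] fcyl unfolding f_def by blast
  then show False
    using meager_Un[OF w mf[OF w]] not_meager_cyl meager_subset by blast
qed

section \<open>Homomorphisms from abelian groups of prime exponent or without torsion\<close>

lemma infinite_times_lepoll:
  assumes "infinite A" shows "A \<times> A \<lesssim> A"
  using card_of_Times_same_infinite[OF assms] eqpoll_iff_card_of_ordIso eqpoll_imp_lepoll by blast

text \<open>A list of length \<open>n + 1\<close> is coded by its head and the code of its tail.
  Codes of lists of different lengths may collide, so the length is kept as a further
  coordinate.\<close>

lemma infinite_lists_lepoll:
  assumes "infinite Z" shows "lists Z \<lesssim> Z"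
proof -
  have "\<exists>f. inj_on f {l \<in> lists Z. length l = n} \<and> f ` {l \<in> lists Z. length l = n} \<subseteq> Z" for n
  proof (induction n)
    case 0
    obtain z where "z \<in> Z" using assms by fastforce
    then show ?case by (intro exI[of _ "\<lambda>_. z"]) (auto simp: inj_on_def)
  next
    case (Suc n)
    then obtain f where f: "inj_on f {l \<in> lists Z. length l = n}" "f ` {l \<in> lists Z. length l = n} \<subseteq> Z" by blast
    obtain g where g: "inj_on g (Z \<times> Z)" "g ` (Z \<times> Z) \<subseteq> Z"
      using infinite_times_lepoll[OF assms] unfolding lepoll_def by blast
    let ?L = "{l \<in> lists Z. length l = Suc n}"
    have "inj_on (\<lambda>l. g (hd l, f (tl l))) ?L"
    proof (rule inj_onI)
      fix l l' assume l: "l \<in> ?L" "l' \<in> ?L" and eq: "g (hd l, f (tl l)) = g (hd l', f (tl l'))"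
      obtain a m where lm: "l = a # m" using l(1) by (cases l) auto
      obtain b m' where lm': "l' = b # m'" using l(2) by (cases l') auto
      have "m \<in> {l \<in> lists Z. length l = n}" "m' \<in> {l \<in> lists Z. length l = n}" "a \<in> Z" "b \<in> Z"
        using l lm lm' by auto
      moreover have "(a, f m) = (b, f m')"
        using eq lm lm' calculation f(2) by (intro inj_onD[OF g(1)]) auto
      ultimately show "l = l'" using inj_onD[OF f(1)] lm lm' by blast
    qed
    moreover have "(\<lambda>l. g (hd l, f (tl l))) ` ?L \<subseteq> Z"
    proof (rule image_subsetI)
      fix l assume l: "l \<in> ?L"
      obtain a m where lm: "l = a # m" using l by (cases l) auto
      then have "f m \<in> Z" "a \<in> Z" using l f(2) by auto
      then show "g (hd l, f (tl l)) \<in> Z" using g(2) lm by auto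
    qed
    ultimately show ?case by blast
  qed
  then have "\<forall>n. \<exists>f. inj_on f {l \<in> lists Z. length l = n} \<and> f ` {l \<in> lists Z. length l = n} \<subseteq> Z" ..
  from choice[OF this] obtain f where f: "\<And>n. inj_on (f n) {l \<in> lists Z. length l = n}"
      "\<And>n. f n ` {l \<in> lists Z. length l = n} \<subseteq> Z" by blast
  have "lists Z \<lesssim> (UNIV :: nat set) \<times> Z"
    unfolding lepoll_def
  proof (intro exI conjI)
    show "inj_on (\<lambda>l. (length l, f (length l) l)) (lists Z)"
    proof (rule inj_onI)
      fix l l' assume l: "l \<in> lists Z" "l' \<in> lists Z"
        and eq: "(length l, f (length l) l) = (length l', f (length l') l')"
      then have "length l = length l'" "f (length l) l = f (length l) l'" by (metis prod.inject)+
      then show "l = l'" using l by (intro inj_onD[OF f(1)[of "length l"]]) simp_all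
    qed
    show "(\<lambda>l. (length l, f (length l) l)) ` lists Z \<subseteq> UNIV \<times> Z" using f(2) by auto
  qed
  also have "(UNIV :: nat set) \<times> Z \<lesssim> Z \<times> Z"
    using assms infinite_le_lepoll by (intro times_lepoll_mono) auto
  also have "Z \<times> Z \<lesssim> Z" using assms by (rule infinite_times_lepoll)
  finally show ?thesis .
qed

text \<open>For \<open>q\<close> prime these are the vector spaces over the field with
  \<open>q\<close> elements. For \<open>q = 0\<close> the law \<open>pow_char\<close> is trivial and
  \<open>pow_eq_one\<close> says torsion free; divisibility is not demanded, so division by
  \<open>k\<close> may be impossible inside \<open>A\<close>.\<close>

locale char_group = comm_group A for A (structure) +
  fixes q :: nat
  assumes q_neq_1: "q \<noteq> 1"
    and pow_char: "a \<in> carrier A \<Longrightarrow> a [^] q = \<one>"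
    and pow_eq_one: "a \<in> carrier A \<Longrightarrow> \<not> q dvd k \<Longrightarrow> a [^] (k::nat) = \<one> \<Longrightarrow> a = \<one>"
begin

lemma int_pow_dvd:
  assumes "a \<in> carrier A" "int q dvd n" shows "a [^] n = \<one>"
proof -
  obtain m where "n = int q * m" using assms(2) by auto
  then show ?thesis using assms(1) int_pow_pow[of a "int q" m] by (simp add: int_pow_int pow_char)
qed

end

text \<open>The target does have roots of every order not divisible by \<open>q\<close>, and this is
  what lets homomorphisms extend from subgroups.\<close>

locale char_groups = A: char_group A q + T: char_group T q
  for A :: "('a, 'm) monoid_scheme" (structure) and T :: "('b, 'n) monoid_scheme" and q :: nat +
  assumes T_root: "t \<in> carrier T \<Longrightarrow> \<not> q dvd k \<Longrightarrow> \<exists>u\<in>carrier T. u [^]\<^bsub>T\<^esub> (k::nat) = t"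
begin

section \<open>Partial homomorphisms as subgroups of the product\<close>

abbreviation "P \<equiv> A \<times>\<times> T"

sublocale P: group P
  by (rule DirProd_group) (rule A.group_axioms T.group_axioms)+

text \<open>For a subgroup of the product this characterises graphs of partial homomorphisms.
  Working with graphs makes extension an inclusion and the limit of a chain a union.\<close>

definition functional :: "('a \<times> 'b) set \<Rightarrow> bool" where
  "functional \<Gamma> \<longleftrightarrow> (\<forall>t. (\<one>, t) \<in> \<Gamma> \<longrightarrow> t = \<one>\<^bsub>T\<^esub>)"

definition adjoin :: "('a \<times> 'b) set \<Rightarrow> 'a \<Rightarrow> 'b \<Rightarrow> ('a \<times> 'b) set" where
  "adjoin \<Gamma> b u = {(a \<otimes> b [^] n, t \<otimes>\<^bsub>T\<^esub> u [^]\<^bsub>T\<^esub> n) | a t n::int. (a, t) \<in> \<Gamma>}"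

lemma subgroup_carrierD:
  assumes "subgroup \<Gamma> P" "(a, t) \<in> \<Gamma>" shows "a \<in> carrier A" "t \<in> carrier T"
  using subgroup.mem_carrier[OF assms] by auto

lemma subgroup_multD:
  assumes "subgroup \<Gamma> P" "(a, t) \<in> \<Gamma>" "(a', t') \<in> \<Gamma>" shows "(a \<otimes> a', t \<otimes>\<^bsub>T\<^esub> t') \<in> \<Gamma>"
  using subgroup.m_closed[OF assms] by simp

lemma subgroup_invD:
  assumes "subgroup \<Gamma> P" "(a, t) \<in> \<Gamma>" shows "(inv a, inv\<^bsub>T\<^esub> t) \<in> \<Gamma>"
  using subgroup.m_inv_closed[OF assms] subgroup_carrierD[OF assms]
  by (simp add: inv_DirProd A.group_axioms T.group_axioms)

lemma subgroup_oneD: "subgroup \<Gamma> P \<Longrightarrow> (\<one>, \<one>\<^bsub>T\<^esub>) \<in> \<Gamma>"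
  using subgroup.one_closed by fastforce

lemma subgroup_powD:
  assumes "subgroup \<Gamma> P" "(a, t) \<in> \<Gamma>" shows "(a [^] (k::nat), t [^]\<^bsub>T\<^esub> k) \<in> \<Gamma>"
  by (induction k) (use assms subgroup_oneD subgroup_multD in auto)

lemma subgroup_int_powD:
  assumes "subgroup \<Gamma> P" "(a, t) \<in> \<Gamma>" shows "(a [^] (k::int), t [^]\<^bsub>T\<^esub> k) \<in> \<Gamma>"
  using subgroup_powD[OF assms] subgroup_invD[OF assms(1) subgroup_powD[OF assms]]
    subgroup_carrierD[OF assms]
  by (cases k rule: int_cases2) (auto simp: int_pow_int A.int_pow_neg T.int_pow_neg)

lemma functionalD:
  assumes "subgroup \<Gamma> P" "functional \<Gamma>" "(a, t) \<in> \<Gamma>" "(a, t') \<in> \<Gamma>"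
  shows "t = t'"
proof -
  have c: "a \<in> carrier A" "t \<in> carrier T" "t' \<in> carrier T"
    using assms subgroup_carrierD by blast+
  have "(a \<otimes> inv a, t \<otimes>\<^bsub>T\<^esub> inv\<^bsub>T\<^esub> t') \<in> \<Gamma>"
    using subgroup_multD[OF assms(1,3) subgroup_invD[OF assms(1,4)]] .
  then have "t \<otimes>\<^bsub>T\<^esub> inv\<^bsub>T\<^esub> t' = \<one>\<^bsub>T\<^esub>"
    using assms(2) c by (simp add: functional_def)
  then show ?thesis using c T.inv_solve_right' T.inv_equality by (metis T.inv_closed T.inv_inv T.l_inv T.inv_equality)
qed

lemma subgroup_adjoin:
  assumes \<Gamma>: "subgroup \<Gamma> P" and b: "b \<in> carrier A" and u: "u \<in> carrier T"
  shows "subgroup (adjoin \<Gamma> b u) P"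
proof (rule P.subgroupI)
  show "adjoin \<Gamma> b u \<subseteq> carrier P"
    using subgroup_carrierD[OF \<Gamma>] b u by (auto simp: adjoin_def)
  show "adjoin \<Gamma> b u \<noteq> {}"
    using subgroup_oneD[OF \<Gamma>] unfolding adjoin_def by blast
next
  fix x assume "x \<in> adjoin \<Gamma> b u"
  then obtain a t n where x: "x = (a \<otimes> b [^] (n::int), t \<otimes>\<^bsub>T\<^esub> u [^]\<^bsub>T\<^esub> n)" "(a, t) \<in> \<Gamma>"
    by (auto simp: adjoin_def)
  have c: "a \<in> carrier A" "t \<in> carrier T" using subgroup_carrierD[OF \<Gamma> x(2)] .
  have "inv\<^bsub>P\<^esub> x = (inv a \<otimes> b [^] (- n), inv\<^bsub>T\<^esub> t \<otimes>\<^bsub>T\<^esub> u [^]\<^bsub>T\<^esub> (- n))"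
    using c b u by (simp add: x(1) inv_DirProd A.group_axioms T.group_axioms A.inv_mult T.inv_mult
        A.int_pow_neg T.int_pow_neg)
  then show "inv\<^bsub>P\<^esub> x \<in> adjoin \<Gamma> b u"
    using subgroup_invD[OF \<Gamma> x(2)] unfolding adjoin_def by blast
next
  fix x y assume "x \<in> adjoin \<Gamma> b u" "y \<in> adjoin \<Gamma> b u"
  then obtain a t n a' t' n' where x: "x = (a \<otimes> b [^] (n::int), t \<otimes>\<^bsub>T\<^esub> u [^]\<^bsub>T\<^esub> n)" "(a, t) \<in> \<Gamma>"
    and y: "y = (a' \<otimes> b [^] (n'::int), t' \<otimes>\<^bsub>T\<^esub> u [^]\<^bsub>T\<^esub> n')" "(a', t') \<in> \<Gamma>"
    by (auto simp: adjoin_def)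
  have c: "a \<in> carrier A" "t \<in> carrier T" "a' \<in> carrier A" "t' \<in> carrier T"
    using subgroup_carrierD[OF \<Gamma>] x(2) y(2) by blast+
  have "x \<otimes>\<^bsub>P\<^esub> y = ((a \<otimes> a') \<otimes> b [^] (n + n'), (t \<otimes>\<^bsub>T\<^esub> t') \<otimes>\<^bsub>T\<^esub> u [^]\<^bsub>T\<^esub> (n + n'))"
    using c b u by (simp add: x(1) y(1) A.int_pow_mult T.int_pow_mult A.m_ac T.m_ac)
  then show "x \<otimes>\<^bsub>P\<^esub> y \<in> adjoin \<Gamma> b u"
    using subgroup_multD[OF \<Gamma> x(2) y(2)] unfolding adjoin_def by blast
qed

lemma subset_adjoin:
  assumes \<Gamma>: "subgroup \<Gamma> P" shows "\<Gamma> \<subseteq> adjoin \<Gamma> b u"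
proof
  fix x assume x: "x \<in> \<Gamma>"
  obtain a t where at: "x = (a, t)" by (cases x)
  have "(a \<otimes> b [^] (0::int), t \<otimes>\<^bsub>T\<^esub> u [^]\<^bsub>T\<^esub> (0::int)) \<in> adjoin \<Gamma> b u"
    using x at unfolding adjoin_def by blast
  then show "x \<in> adjoin \<Gamma> b u" using subgroup_carrierD[OF \<Gamma>] x at by simp
qed

lemma mem_adjoin:
  assumes \<Gamma>: "subgroup \<Gamma> P" and b: "b \<in> carrier A" and u: "u \<in> carrier T"
  shows "(b, u) \<in> adjoin \<Gamma> b u"
proof -
  have "(\<one> \<otimes> b [^] (1::int), \<one>\<^bsub>T\<^esub> \<otimes>\<^bsub>T\<^esub> u [^]\<^bsub>T\<^esub> (1::int)) \<in> adjoin \<Gamma> b u"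
    using subgroup_oneD[OF \<Gamma>] unfolding adjoin_def by blast
  then show ?thesis using b u by simp
qed

text \<open>For a subgroup \<open>D\<close>, this is linear dependence on \<open>D\<close> over the
  prime field, expressed without dividing by \<open>k\<close>.\<close>

definition pure_closure :: "'a set \<Rightarrow> 'a set" where
  "pure_closure D = {b \<in> carrier A. \<exists>k::nat. \<not> q dvd k \<and> b [^] k \<in> D}"

text \<open>A pair over the identity arises from a relation
  \<open>a \<otimes> b [^] n = \<one>\<close>. As \<open>b\<close> is independent of the domain,
  \<open>q\<close> divides \<open>n\<close>; then \<open>b [^] n\<close> and \<open>u [^] n\<close>
  are both trivial, and the relation was already one in the old graph. Hence \<open>u\<close> is
  arbitrary.\<close>

lemma functional_adjoin_free:
  assumes \<Gamma>: "subgroup \<Gamma> P" "functional \<Gamma>" and b: "b \<in> carrier A" "b \<notin> pure_closure (fst ` \<Gamma>)"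
    and u: "u \<in> carrier T"
  shows "functional (adjoin \<Gamma> b u)"
  unfolding functional_def
proof (intro allI impI)
  fix t' assume "(\<one>, t') \<in> adjoin \<Gamma> b u"
  then obtain a t n where x: "\<one> = a \<otimes> b [^] (n::int)" "t' = t \<otimes>\<^bsub>T\<^esub> u [^]\<^bsub>T\<^esub> n" "(a, t) \<in> \<Gamma>"
    by (auto simp: adjoin_def)
  have c: "a \<in> carrier A" "t \<in> carrier T" using subgroup_carrierD[OF \<Gamma>(1) x(3)] .
  have bn: "b [^] n = inv a" using x(1) c b by (metis A.int_pow_closed A.inv_equality A.m_comm)
  have "int q dvd n"
  proof (rule ccontr)
    assume nd: "\<not> int q dvd n"
    show False
    proof (cases n rule: int_cases2)
      case (nonneg k)
      then have "b [^] k \<in> fst ` \<Gamma>" using bn subgroup_invD[OF \<Gamma>(1) x(3)] by (force simp: int_pow_int)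
      moreover have "\<not> q dvd k" using nd nonneg by simp
      ultimately show False using b unfolding pure_closure_def by blast
    next
      case (nonpos k)
      then have "inv (b [^] k) = inv a" using bn c b by (simp add: A.int_pow_neg int_pow_int)
      then have "b [^] k = a" using c b by (metis A.inv_inv A.nat_pow_closed)
      then have "b [^] k \<in> fst ` \<Gamma>" using x(3) by force
      moreover have "\<not> q dvd k" using nd nonpos by simp
      ultimately show False using b unfolding pure_closure_def by blast
    qed
  qed
  then have pw: "b [^] n = \<one>" "u [^]\<^bsub>T\<^esub> n = \<one>\<^bsub>T\<^esub>"
    using A.int_pow_dvd T.int_pow_dvd b u by auto
  have "\<one> = a" using x(1) c unfolding pw by (simp only: A.r_one)
  moreover have "t' = t" using x(2) c unfolding pw by (simp only: T.r_one)
  ultimately show "t' = \<one>\<^bsub>T\<^esub>" using x(3) \<Gamma>(2) by (simp add: functional_def)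
qed

text \<open>Here the value of \<open>b\<close> is forced: if \<open>b [^] k\<close> has the value
  \<open>v\<close>, then \<open>u\<close> must be a \<open>k\<close>-th root of \<open>v\<close>.
  The \<open>k\<close>-th power of any relation lies in the old graph, and \<open>T\<close> has no
  \<open>k\<close>-torsion, so the root causes no conflict.\<close>

lemma functional_adjoin_closure:
  assumes \<Gamma>: "subgroup \<Gamma> P" "functional \<Gamma>" and b: "b \<in> pure_closure (fst ` \<Gamma>)"
  shows "\<exists>u\<in>carrier T. functional (adjoin \<Gamma> b u)"
proof -
  obtain k v where k: "\<not> q dvd k" "(b [^] (k::nat), v) \<in> \<Gamma>" and bA: "b \<in> carrier A"
    using b by (auto simp: pure_closure_def)
  have v: "v \<in> carrier T" using subgroup_carrierD[OF \<Gamma>(1) k(2)] by blast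
  obtain u where u: "u \<in> carrier T" "u [^]\<^bsub>T\<^esub> k = v" using T_root[OF v k(1)] by blast
  have "functional (adjoin \<Gamma> b u)"
    unfolding functional_def
  proof (intro allI impI)
    fix t' assume "(\<one>, t') \<in> adjoin \<Gamma> b u"
    then obtain a t n where x: "\<one> = a \<otimes> b [^] (n::int)" "t' = t \<otimes>\<^bsub>T\<^esub> u [^]\<^bsub>T\<^esub> n" "(a, t) \<in> \<Gamma>"
      by (auto simp: adjoin_def)
    have c: "a \<in> carrier A" "t \<in> carrier T" using subgroup_carrierD[OF \<Gamma>(1) x(3)] .
    have "(a [^] int k \<otimes> (b [^] k) [^] n, t [^]\<^bsub>T\<^esub> int k \<otimes>\<^bsub>T\<^esub> v [^]\<^bsub>T\<^esub> n) \<in> \<Gamma>"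
      by (intro subgroup_multD[OF \<Gamma>(1)] subgroup_int_powD[OF \<Gamma>(1)] x k)
    moreover have "a [^] int k \<otimes> (b [^] k) [^] n = (a \<otimes> b [^] n) [^] int k"
      using c bA by (simp add: A.int_pow_distrib A.int_pow_pow mult.commute flip: int_pow_int)
    moreover have "t [^]\<^bsub>T\<^esub> int k \<otimes>\<^bsub>T\<^esub> v [^]\<^bsub>T\<^esub> n = t' [^]\<^bsub>T\<^esub> int k"
      using c u by (simp add: x(2) T.int_pow_distrib T.int_pow_pow mult.commute flip: int_pow_int u(2))
    ultimately have "((a \<otimes> b [^] n) [^] int k, t' [^]\<^bsub>T\<^esub> int k) \<in> \<Gamma>" by simp
    then have "(\<one> [^] int k, t' [^]\<^bsub>T\<^esub> int k) \<in> \<Gamma>" unfolding x(1)[symmetric] .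
    then have "(\<one>, t' [^]\<^bsub>T\<^esub> k) \<in> \<Gamma>" by (simp add: int_pow_int)
    then have "t' [^]\<^bsub>T\<^esub> k = \<one>\<^bsub>T\<^esub>" using \<Gamma>(2) by (simp add: functional_def)
    then show "t' = \<one>\<^bsub>T\<^esub>" using T.pow_eq_one[of t' k] k(1) x(2) c u by auto
  qed
  then show ?thesis using u by blast
qed

lemma subgroup_Union_chain:
  assumes "C \<noteq> {}" "subset.chain {\<Gamma>. subgroup \<Gamma> P} C"
  shows "subgroup (\<Union>C) P"
proof (rule P.subgroupI)
  have C: "\<And>\<Gamma>. \<Gamma> \<in> C \<Longrightarrow> subgroup \<Gamma> P" using assms(2) by (auto simp: subset_chain_def)
  show "\<Union>C \<subseteq> carrier P" using C subgroup.subset by blast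
  obtain \<Gamma>0 where "\<Gamma>0 \<in> C" using assms(1) by blast
  then show "\<Union>C \<noteq> {}" using subgroup.one_closed[OF C] by blast
  fix x assume x: "x \<in> \<Union>C"
  then show "inv\<^bsub>P\<^esub> x \<in> \<Union>C" using subgroup.m_inv_closed[OF C] by blast
  fix y assume "y \<in> \<Union>C"
  then obtain \<Gamma> where "\<Gamma> \<in> C" "x \<in> \<Gamma>" "y \<in> \<Gamma>"
    using x assms(2) unfolding subset_chain_def by blast
  then show "x \<otimes>\<^bsub>P\<^esub> y \<in> \<Union>C" using subgroup.m_closed[OF C] by blast
qed

text \<open>A maximal functional graph is total, because a missing element can be adjoined whether
  or not it depends on the domain.\<close>

lemma functional_extends_to_hom:
  assumes "subgroup \<Gamma> P" "functional \<Gamma>"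
  shows "\<exists>f\<in>hom A T. \<forall>(a, t)\<in>\<Gamma>. f a = t"
proof -
  let ?F = "{\<Delta>. subgroup \<Delta> P \<and> functional \<Delta> \<and> \<Gamma> \<subseteq> \<Delta>}"
  have "\<exists>M\<in>?F. \<forall>X\<in>?F. M \<subseteq> X \<longrightarrow> X = M"
  proof (rule subset_Zorn_nonempty)
    show "?F \<noteq> {}" using assms by blast
    fix C assume C: "C \<noteq> {}" "subset.chain ?F C"
    have "subgroup (\<Union>C) P"
      using C by (intro subgroup_Union_chain) (auto simp: subset_chain_def)
    moreover have CF: "C \<subseteq> ?F" using C by (simp add: subset_chain_def)
    moreover have "functional (\<Union>C)" using CF unfolding functional_def by blast
    moreover have "\<Gamma> \<subseteq> \<Union>C" using C(1) CF by blast
    ultimately show "\<Union>C \<in> ?F" by blast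
  qed
  then obtain M where M: "subgroup M P" "functional M" "\<Gamma> \<subseteq> M"
    and max: "\<And>X. subgroup X P \<Longrightarrow> functional X \<Longrightarrow> M \<subseteq> X \<Longrightarrow> X = M" by auto
  have total: "\<exists>t. (b, t) \<in> M" if b: "b \<in> carrier A" for b
  proof -
    obtain u where "u \<in> carrier T" "functional (adjoin M b u)"
      using functional_adjoin_free[OF M(1,2) b] functional_adjoin_closure[OF M(1,2), of b] T.one_closed
      by blast
    moreover from this have "adjoin M b u = M"
      using max subgroup_adjoin[OF M(1) b] subset_adjoin[OF M(1)] by blast
    ultimately show ?thesis using mem_adjoin[OF M(1) b] by blast
  qed
  define f where "f a = (THE t. (a, t) \<in> M)" for a
  have f: "f a = t" if "(a, t) \<in> M" for a t
    unfolding f_def using that functionalD[OF M(1,2)] by blast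
  have fM: "(a, f a) \<in> M" if "a \<in> carrier A" for a
    using total[OF that] f by blast
  have "f \<in> hom A T"
  proof (rule homI)
    fix a assume "a \<in> carrier A" then show "f a \<in> carrier T" using fM subgroup_carrierD[OF M(1)] by blast
  next
    fix a b assume "a \<in> carrier A" "b \<in> carrier A"
    then show "f (a \<otimes> b) = f a \<otimes>\<^bsub>T\<^esub> f b" using f subgroup_multD[OF M(1)] fM by blast
  qed
  then show ?thesis using f M(3) by blast
qed

section \<open>Independent sets and bases\<close>

definition graph_gen :: "('a \<Rightarrow> 'b) \<Rightarrow> 'a set \<Rightarrow> ('a \<times> 'b) set" where
  "graph_gen u S = generate P ((\<lambda>s. (s, u s)) ` S)"

text \<open>Independence as the freedom to prescribe values in \<open>T\<close>, which is the
  property the counting needs, rather than through vanishing linear combinations.\<close>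

definition indep :: "'a set \<Rightarrow> bool" where
  "indep S \<longleftrightarrow> S \<subseteq> carrier A \<and> (\<forall>u. u ` S \<subseteq> carrier T \<longrightarrow> functional (graph_gen u S))"

lemma subgroup_graph_gen:
  "S \<subseteq> carrier A \<Longrightarrow> u ` S \<subseteq> carrier T \<Longrightarrow> subgroup (graph_gen u S) P"
  unfolding graph_gen_def by (rule P.generate_is_subgroup) auto

lemma fst_graph_gen:
  assumes "S \<subseteq> carrier A" "u ` S \<subseteq> carrier T"
  shows "fst ` graph_gen u S \<subseteq> generate A S"
proof (rule image_subsetI)
  fix x assume "x \<in> graph_gen u S"
  then show "fst x \<in> generate A S"
    unfolding graph_gen_def
  proof (induction rule: generate.induct)
    case one then show ?case by (simp add: generate.one)
  next
    case (incl h) then show ?case by (auto intro: generate.incl)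
  next
    case (inv h)
    then obtain s where s: "h = (s, u s)" "s \<in> S" by blast
    then have "inv\<^bsub>P\<^esub> h = (inv s, inv\<^bsub>T\<^esub> u s)"
      using assms by (auto intro!: inv_DirProd A.group_axioms T.group_axioms)
    then show ?case using s by (auto intro: generate.inv)
  next
    case (eng h1 h2) then show ?case by (auto simp: mult_DirProd' intro: generate.eng)
  qed
qed

text \<open>A generated element involves finitely many generators, and these lie in a single member
  of the chain.\<close>

lemma graph_gen_Union_chain:
  assumes "C \<noteq> {}" and chain: "\<And>X Y. X \<in> C \<Longrightarrow> Y \<in> C \<Longrightarrow> X \<subseteq> Y \<or> Y \<subseteq> X"
  shows "graph_gen u (\<Union>C) \<subseteq> (\<Union>S\<in>C. graph_gen u S)"
proof
  fix x assume "x \<in> graph_gen u (\<Union>C)"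
  then show "x \<in> (\<Union>S\<in>C. graph_gen u S)"
    unfolding graph_gen_def
  proof (induction rule: generate.induct)
    case one then show ?case using assms(1) generate.one by blast
  next
    case (incl h)
    then obtain S where "S \<in> C" "h \<in> (\<lambda>s. (s, u s)) ` S" by blast
    then show ?case using generate.incl by (intro UN_I)
  next
    case (inv h)
    then obtain S where "S \<in> C" "h \<in> (\<lambda>s. (s, u s)) ` S" by blast
    then show ?case using generate.inv by (intro UN_I)
  next
    case (eng h1 h2)
    then obtain X Y where XY: "X \<in> C" "Y \<in> C" "h1 \<in> generate P ((\<lambda>s. (s, u s)) ` X)"
      "h2 \<in> generate P ((\<lambda>s. (s, u s)) ` Y)" by blast
    define Z where "Z = X \<union> Y"
    have "Z \<in> C" using chain[OF XY(1,2)] XY(1,2) by (auto simp: Z_def Un_absorb1 Un_absorb2)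
    moreover have "h1 \<in> generate P ((\<lambda>s. (s, u s)) ` Z)" "h2 \<in> generate P ((\<lambda>s. (s, u s)) ` Z)"
      using XY(3,4) P.mono_generate[of "(\<lambda>s. (s, u s)) ` X" "(\<lambda>s. (s, u s)) ` Z"]
        P.mono_generate[of "(\<lambda>s. (s, u s)) ` Y" "(\<lambda>s. (s, u s)) ` Z"] by (auto simp: Z_def)
    ultimately show ?case using generate.eng by (intro UN_I)
  qed
qed

text \<open>An element outside the pure closure of what a maximal independent set generates could be
  added to it by \<open>functional_adjoin_free\<close>.\<close>

lemma exists_basis: "\<exists>S. indep S \<and> carrier A \<subseteq> pure_closure (generate A S)"
proof -
  have "\<exists>M\<in>Collect indep. \<forall>X\<in>Collect indep. M \<subseteq> X \<longrightarrow> X = M"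
  proof (rule subset_Zorn_nonempty)
    have "functional (graph_gen u {})" for u
      by (auto simp: functional_def graph_gen_def P.generate_empty)
    then have "indep {}" by (simp add: indep_def)
    then show "Collect indep \<noteq> {}" by blast
    fix C assume C: "C \<noteq> {}" "subset.chain (Collect indep) C"
    have "functional (graph_gen u (\<Union>C))" if u: "u ` \<Union>C \<subseteq> carrier T" for u
    proof -
      have "functional (graph_gen u S)" if "S \<in> C" for S
      proof -
        have "u ` S \<subseteq> carrier T" using u that by blast
        moreover have "indep S" using that C(2) by (auto simp: subset_chain_def)
        ultimately show ?thesis by (simp add: indep_def)
      qed
      moreover have "graph_gen u (\<Union>C) \<subseteq> (\<Union>S\<in>C. graph_gen u S)"
        using C by (intro graph_gen_Union_chain) (auto simp: subset_chain_def)
      ultimately show ?thesis unfolding functional_def by blast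
    qed
    moreover have "\<Union>C \<subseteq> carrier A" using C(2) unfolding indep_def subset_chain_def by blast
    ultimately show "\<Union>C \<in> Collect indep" by (simp add: indep_def)
  qed
  then obtain S where S: "indep S" and max: "\<And>X. indep X \<Longrightarrow> S \<subseteq> X \<Longrightarrow> X = S" by auto
  have SA: "S \<subseteq> carrier A" using S by (simp add: indep_def)
  have "b \<in> pure_closure (generate A S)" if b: "b \<in> carrier A" for b
  proof (rule ccontr)
    assume nb: "b \<notin> pure_closure (generate A S)"
    have "functional (graph_gen u (insert b S))" if u: "u ` insert b S \<subseteq> carrier T" for u
    proof -
      have sg: "subgroup (graph_gen u S) P" using u SA by (intro subgroup_graph_gen) auto
      have "fst ` graph_gen u S \<subseteq> generate A S" using u SA by (intro fst_graph_gen) auto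
      then have "b \<notin> pure_closure (fst ` graph_gen u S)" using nb unfolding pure_closure_def by blast
      moreover have "functional (graph_gen u S)" using S u by (auto simp: indep_def)
      ultimately have "functional (adjoin (graph_gen u S) b (u b))"
        using functional_adjoin_free[OF sg] b u by auto
      moreover have "graph_gen u (insert b S) \<subseteq> adjoin (graph_gen u S) b (u b)"
        unfolding graph_gen_def[of u "insert b S"]
      proof (rule P.generate_subgroup_incl)
        show "subgroup (adjoin (graph_gen u S) b (u b)) P" using u by (intro subgroup_adjoin[OF sg b]) auto
        have "(\<lambda>s. (s, u s)) ` S \<subseteq> graph_gen u S" by (auto simp: graph_gen_def intro: generate.incl)
        then show "(\<lambda>s. (s, u s)) ` insert b S \<subseteq> adjoin (graph_gen u S) b (u b)"
          using mem_adjoin[OF sg b, of "u b"] subset_adjoin[OF sg, of b "u b"] u by blast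
      qed
      ultimately show ?thesis unfolding functional_def by blast
    qed
    then have "indep (insert b S)" using SA b by (simp add: indep_def)
    then have "b \<in> S" using max by blast
    \<comment> \<open>The exponent 1 is admissible for the pure closure because \<open>q\<close> is
      not 1.\<close>
    then have "b [^] (1::nat) \<in> generate A S" using b by (auto intro: generate.incl)
    moreover have "\<not> q dvd 1" using A.q_neq_1 by simp
    ultimately show False using nb b unfolding pure_closure_def by blast
  qed
  then show ?thesis using S by blast
qed

section \<open>Cardinality of a basis and of the set of homomorphisms\<close>

lemma generate_lepoll_lists:
  assumes S: "S \<subseteq> carrier A"
  shows "generate A S \<lesssim> lists (S \<times> (UNIV :: bool set))"
proof -
  define ev where "ev = (\<lambda>l. foldr (\<lambda>(s, e) a. (if e then s else inv s) \<otimes> a) l \<one>)"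
  let ?L = "lists (S \<times> (UNIV :: bool set))"
  have ev_closed: "ev l \<in> carrier A" if "l \<in> ?L" for l
    using that by (induction l) (use S in \<open>auto simp: ev_def\<close>)
  have ev_append: "ev (l @ l') = ev l \<otimes> ev l'" if "l \<in> ?L" "l' \<in> ?L" for l l'
    using that(1)
  proof (induction l)
    case Nil then show ?case using ev_closed[OF that(2)] by (simp add: ev_def)
  next
    case (Cons x l)
    obtain s e where x: "x = (s, e)" by (cases x)
    have s: "s \<in> carrier A" using Cons x S by auto
    have "ev ((x # l) @ l') = (if e then s else inv s) \<otimes> ev (l @ l')" by (simp add: ev_def x)
    also have "\<dots> = (if e then s else inv s) \<otimes> (ev l \<otimes> ev l')" using Cons by simp
    also have "\<dots> = ((if e then s else inv s) \<otimes> ev l) \<otimes> ev l'"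
      using s ev_closed[OF that(2)] ev_closed[of l] Cons by (simp add: A.m_assoc)
    finally show ?case by (simp add: ev_def x)
  qed
  have "generate A S \<subseteq> ev ` ?L"
  proof
    fix x assume "x \<in> generate A S"
    then show "x \<in> ev ` ?L"
    proof (induction rule: generate.induct)
      case one show ?case by (rule image_eqI[of _ _ "[]"]) (auto simp: ev_def)
    next
      case (incl h) then show ?case
        using S by (intro image_eqI[of _ _ "[(h, True)]"]) (auto simp: ev_def)
    next
      case (inv h) then show ?case
        using S by (intro image_eqI[of _ _ "[(h, False)]"]) (auto simp: ev_def)
    next
      case (eng h1 h2)
      then obtain l l' where "h1 = ev l" "h2 = ev l'" "l \<in> ?L" "l' \<in> ?L" by blast
      then show ?case by (intro image_eqI[of _ _ "l @ l'"]) (auto simp: ev_append)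
    qed
  qed
  then show ?thesis using subset_image_lepoll by blast
qed

text \<open>Each element is coded by an exponent \<open>k\<close> and its \<open>k\<close>-th power
  in \<open>D\<close>; taking \<open>k\<close>-th powers is injective because there is no
  \<open>k\<close>-torsion.\<close>

lemma carrier_lepoll:
  assumes "carrier A \<subseteq> pure_closure D"
  shows "carrier A \<lesssim> (UNIV :: nat set) \<times> D"
proof -
  obtain k where k: "\<And>b. b \<in> carrier A \<Longrightarrow> \<not> q dvd k b \<and> b [^] (k b :: nat) \<in> D"
    using assms unfolding pure_closure_def by (simp add: subset_iff) metis
  have "inj_on (\<lambda>b. (k b, b [^] k b)) (carrier A)"
  proof (rule inj_onI)
    fix a b assume ab: "a \<in> carrier A" "b \<in> carrier A" and eq: "(k a, a [^] k a) = (k b, b [^] k b)"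
    have pows: "a [^] k a = b [^] k a" using eq by (metis prod.inject)
    have "(a \<otimes> inv b) [^] k a = b [^] k a \<otimes> inv (b [^] k a)"
      using ab by (simp only: A.nat_pow_distrib A.nat_pow_inv A.inv_closed pows)
    then have "(a \<otimes> inv b) [^] k a = \<one>" using ab by simp
    then have "a \<otimes> inv b = \<one>" using A.pow_eq_one[of "a \<otimes> inv b" "k a"] k ab by auto
    then show "a = b" using ab by (metis A.inv_closed A.inv_equality A.inv_inv)
  qed
  then show ?thesis unfolding lepoll_def using k by blast
qed

text \<open>Every element is determined by a natural number and a finite word over a basis
  \<open>S\<close>. Hence \<open>S\<close> is infinite and at least as large as the carrier, so it
  contains a copy of the continuum. A set \<open>Y\<close> of points of this copy gives the
  homomorphism with value \<open>t\<close> on \<open>Y\<close> and the identity on the rest of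
  \<open>S\<close>.\<close>

lemma many_homs:
  assumes big: "(UNIV :: nat set set) \<lesssim> carrier A" and "\<exists>t\<in>carrier T. t \<noteq> \<one>\<^bsub>T\<^esub>"
  shows "\<exists>F :: nat set set \<Rightarrow> 'a \<Rightarrow> 'b. (\<forall>Y. F Y \<in> hom A T) \<and>
    (\<forall>Y Y'. Y \<noteq> Y' \<longrightarrow> (\<exists>a\<in>carrier A. F Y a \<noteq> F Y' a))"
proof -
  obtain S where S: "indep S" "carrier A \<subseteq> pure_closure (generate A S)" using exists_basis by blast
  have SA: "S \<subseteq> carrier A" using S(1) by (simp add: indep_def)
  let ?Z = "S \<times> (UNIV :: bool set)"
  have A1: "carrier A \<lesssim> (UNIV :: nat set) \<times> lists ?Z"
    by (rule lepoll_trans[OF carrier_lepoll[OF S(2)] times_lepoll_mono])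
      (rule lepoll_refl, rule generate_lepoll_lists[OF SA])
  have unc: "uncountable (UNIV :: nat set set)"
    using Cantors_theorem[of "UNIV :: nat set"] by (auto simp: uncountable_def)
  have infS: "infinite S"
  proof
    assume "finite S"
    then have "countable ?Z" by (simp add: countable_finite)
    then have "countable ((UNIV :: nat set) \<times> lists ?Z)"
      using countable_SIGMA[OF countableI_type countable_lists] by simp
    from countable_lepoll[OF this lepoll_trans[OF big A1]] show False using unc by simp
  qed
  have "S \<times> (UNIV :: bool set) \<lesssim> S \<times> S"
    using infS by (intro times_lepoll_mono) (auto intro: finite_lepoll_infinite[OF infS])
  from lepoll_trans[OF this infinite_times_lepoll[OF infS]] have Z: "?Z \<lesssim> S" .
  have "infinite ?Z" using infS by (auto simp: finite_cartesian_product_iff)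
  from lepoll_trans[OF infinite_lists_lepoll[OF this] Z] have LZ: "lists ?Z \<lesssim> S" .
  have "carrier A \<lesssim> S \<times> S"
    by (rule lepoll_trans[OF A1 times_lepoll_mono]) (use LZ infS infinite_le_lepoll in blast)+
  from lepoll_trans[OF lepoll_trans[OF big this] infinite_times_lepoll[OF infS]]
  have "(UNIV :: nat set set) \<lesssim> S" .
  then obtain e :: "nat set \<Rightarrow> 'a" where e: "inj e" "range e \<subseteq> S" unfolding lepoll_def by blast
  obtain t where t: "t \<in> carrier T" "t \<noteq> \<one>\<^bsub>T\<^esub>" using assms(2) by blast
  define u where "u Y s = (if s \<in> e ` Y then t else \<one>\<^bsub>T\<^esub>)" for Y s
  have "\<exists>f\<in>hom A T. \<forall>(a, t)\<in>graph_gen (u Y) S. f a = t" for Y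
  proof (rule functional_extends_to_hom)
    have "u Y ` S \<subseteq> carrier T" using t by (auto simp: u_def)
    then show "subgroup (graph_gen (u Y) S) P" "functional (graph_gen (u Y) S)"
      using S(1) SA subgroup_graph_gen by (auto simp: indep_def)
  qed
  then have "\<forall>Y. \<exists>f. f \<in> hom A T \<and> (\<forall>(a, t)\<in>graph_gen (u Y) S. f a = t)" by blast
  from choice[OF this] obtain F where
    F0: "\<forall>Y. F Y \<in> hom A T \<and> (\<forall>(a, t)\<in>graph_gen (u Y) S. F Y a = t)" ..
  have F: "F Y \<in> hom A T" "(a, t) \<in> graph_gen (u Y) S \<Longrightarrow> F Y a = t" for Y a t
    using spec[OF F0, of Y] by auto
  have Fu: "F Y s = u Y s" if "s \<in> S" for Y s
    using that by (intro F(2)) (auto simp: graph_gen_def intro: generate.incl)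
  have "\<exists>a\<in>carrier A. F Y a \<noteq> F Y' a" if ne: "Y \<noteq> Y'" for Y Y'
  proof -
    obtain y where y: "(y \<in> Y) \<noteq> (y \<in> Y')" using ne by blast
    have "e y \<in> S" using e(2) by blast
    moreover have "u Y (e y) \<noteq> u Y' (e y)"
      using y t unfolding u_def inj_image_mem_iff[OF e(1)] by presburger
    ultimately show ?thesis using Fu[of "e y"] SA by (intro bexI[of _ "e y"]) auto
  qed
  then show ?thesis using F(1) by blast
qed

end

section \<open>Paths and the fundamental group\<close>

text \<open>The fixed ends are those of \<open>f\<close>, so that arbitrary paths are compared and
  not only loops at a base point.\<close>

definition pathhom :: "'a topology \<Rightarrow> (real \<Rightarrow> 'a) \<Rightarrow> (real \<Rightarrow> 'a) \<Rightarrow> bool" where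
  "pathhom X f g \<longleftrightarrow> homotopic_with (\<lambda>h. h 0 = f 0 \<and> h 1 = f 1) (top_of_set {0..1}) X f g"

definition rev_path :: "(real \<Rightarrow> 'a) \<Rightarrow> real \<Rightarrow> 'a" where
  "rev_path f = (\<lambda>t. f (1 - t))"

lemma rev_path_0 [simp]: "rev_path f 0 = f 1" and rev_path_1 [simp]: "rev_path f 1 = f 0"
  by (simp_all add: rev_path_def)

lemma rev_path_rev_path [simp]: "rev_path (rev_path f) = f"
  by (simp add: rev_path_def)

lemma loop_concat_0 [simp]: "loop_concat f g 0 = f 0" and loop_concat_1 [simp]: "loop_concat f g 1 = g 1"
  by (simp_all add: loop_concat_def)

lemma pathin_cong:
  assumes "pathin X f" "\<And>t. t \<in> {0..1} \<Longrightarrow> f t = g t" shows "pathin X g"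
  using assms unfolding pathin_def by (auto intro: continuous_map_eq)

lemma pathin_mem: "pathin X f \<Longrightarrow> 0 \<le> t \<Longrightarrow> t \<le> 1 \<Longrightarrow> f t \<in> topspace X"
  using path_image_subset_topspace by fastforce

lemma pathin_reparam:
  assumes "pathin X f" "continuous_on {0..1} \<alpha>" "\<alpha> \<in> {0..1} \<rightarrow> {0..1}"
  shows "pathin X (\<lambda>t. f (\<alpha> t))"
proof -
  have "continuous_map (top_of_set {0..1}) (top_of_set {0..1}) \<alpha>"
    using assms(2,3) by simp
  from continuous_map_compose[OF this assms(1)[unfolded pathin_def]]
  show ?thesis by (simp add: pathin_def o_def)
qed

lemma pathin_rev [simp]: assumes "pathin X f" shows "pathin X (rev_path f)"
  unfolding rev_path_def by (rule pathin_reparam[OF assms]) (auto intro!: continuous_intros)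

lemma continuous_map_top_of_set_compose:
  assumes "continuous_map (top_of_set T) X f" "continuous_on S \<alpha>" "\<alpha> \<in> S \<rightarrow> T"
  shows "continuous_map (top_of_set S) X (\<lambda>t. f (\<alpha> t))"
  using continuous_map_compose[of "top_of_set S" "top_of_set T" \<alpha> X f] assms by (simp add: o_def)

text \<open>The pasting lemma, stated on the square so that it serves homotopies as well as paths,
  which by \<open>pathin_eq_square\<close> are maps constant in the first variable.\<close>

lemma continuous_map_concat:
  fixes F G :: "real \<times> real \<Rightarrow> 'a"
  assumes F: "continuous_map (top_of_set ({0..1} \<times> {0..1})) X F"
    and G: "continuous_map (top_of_set ({0..1} \<times> {0..1})) X G"
    and FG: "\<And>s. s \<in> {0..1} \<Longrightarrow> F (s, 1) = G (s, 0)"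
  shows "continuous_map (top_of_set ({0..1} \<times> {0..1})) X
    (\<lambda>x. if snd x \<le> 1/2 then F (fst x, 2 * snd x) else G (fst x, 2 * snd x - 1))"
proof (rule continuous_map_cases_le)
  let ?S = "{0..1} \<times> {0..1} :: (real \<times> real) set"
  let ?S1 = "{x \<in> ?S. snd x \<le> 1/2}" and ?S2 = "{x \<in> ?S. 1/2 \<le> snd x}"
  have S1: "subtopology (top_of_set ?S) {x \<in> topspace (top_of_set ?S). snd x \<le> 1/2} = top_of_set ?S1"
    and S2: "subtopology (top_of_set ?S) {x \<in> topspace (top_of_set ?S). 1/2 \<le> snd x} = top_of_set ?S2"
    by (auto simp: subtopology_subtopology intro: arg_cong[where f = top_of_set])
  show "continuous_map (subtopology (top_of_set ?S) {x \<in> topspace (top_of_set ?S). snd x \<le> 1/2}) X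
      (\<lambda>x. F (fst x, 2 * snd x))"
    unfolding S1
    by (rule continuous_map_top_of_set_compose[OF F]) (auto intro!: continuous_intros)
  show "continuous_map (subtopology (top_of_set ?S) {x \<in> topspace (top_of_set ?S). 1/2 \<le> snd x}) X
      (\<lambda>x. G (fst x, 2 * snd x - 1))"
    unfolding S2
    by (rule continuous_map_top_of_set_compose[OF G]) (auto intro!: continuous_intros)
  show "continuous_map (top_of_set ?S) euclideanreal snd"
    by (simp add: continuous_on_snd)
  show "continuous_map (top_of_set ?S) euclideanreal (\<lambda>x. 1/2)" by simp
next
  fix x :: "real \<times> real" assume "x \<in> topspace (top_of_set ({0..1} \<times> {0..1}))" "snd x = 1/2"
  then have "fst x \<in> {0..1}" "2 * snd x = 1" "2 * snd x - 1 = 0" by auto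
  then show "F (fst x, 2 * snd x) = G (fst x, 2 * snd x - 1)" using FG[of "fst x"] by (simp only:)
qed

lemma pathin_eq_square:
  "pathin X f \<longleftrightarrow> continuous_map (top_of_set ({0..1} \<times> {0..1})) X (\<lambda>x::real \<times> real. f (snd x))" (is "_ \<longleftrightarrow> ?R")
proof
  assume "pathin X f"
  then show ?R unfolding pathin_def
    by (rule continuous_map_top_of_set_compose) (auto intro!: continuous_intros)
next
  assume ?R
  then have "continuous_map (top_of_set {0..1}) X (\<lambda>t. (\<lambda>x::real \<times> real. f (snd x)) (0, t))"
    by (rule continuous_map_top_of_set_compose) (auto intro!: continuous_intros)
  then show "pathin X f" by (simp add: pathin_def)
qed

lemma pathin_concat [simp]:
  assumes "pathin X f" "pathin X g" "f 1 = g 0" shows "pathin X (loop_concat f g)"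
proof -
  have "continuous_map (top_of_set ({0..1} \<times> {0..1})) X
      (\<lambda>x::real \<times> real. if snd x \<le> 1/2 then (\<lambda>x. f (snd x)) (fst x, 2 * snd x) else (\<lambda>x. g (snd x)) (fst x, 2 * snd x - 1))"
    using assms by (intro continuous_map_concat) (auto simp: pathin_eq_square)
  then show ?thesis by (simp add: pathin_eq_square loop_concat_def cong: if_cong)
qed

lemma pathhomI:
  fixes H :: "real \<times> real \<Rightarrow> 'a"
  assumes "continuous_map (top_of_set ({0..1} \<times> {0..1})) X H"
    and "\<And>t. t \<in> {0..1} \<Longrightarrow> H (0, t) = f t" "\<And>t. t \<in> {0..1} \<Longrightarrow> H (1, t) = g t"
    and "\<And>s. s \<in> {0..1} \<Longrightarrow> H (s, 0) = f 0" "\<And>s. s \<in> {0..1} \<Longrightarrow> H (s, 1) = f 1"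
  shows "pathhom X f g"
proof -
  have "\<exists>h. continuous_map (prod_topology (top_of_set {0..1::real}) (top_of_set {0..1})) X h \<and>
      (\<forall>t\<in>topspace (top_of_set {0..1}). h (0, t) = f t) \<and> (\<forall>t\<in>topspace (top_of_set {0..1}). h (1, t) = g t) \<and>
      (\<forall>s\<in>{0..1}. h (s, 0) = f 0 \<and> h (s, 1) = f 1)"
    by (rule exI[of _ H]) (simp add: assms)
  then show ?thesis
    unfolding pathhom_def by (subst homotopic_with) simp_all
qed

lemma pathhomE:
  assumes "pathhom X f g"
  obtains H :: "real \<times> real \<Rightarrow> 'a" where "continuous_map (top_of_set ({0..1} \<times> {0..1})) X H"
    "\<And>t. H (0, t) = f t" "\<And>t. H (1, t) = g t"
    "\<And>s. s \<in> {0..1} \<Longrightarrow> H (s, 0) = f 0" "\<And>s. s \<in> {0..1} \<Longrightarrow> H (s, 1) = f 1"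
proof -
  obtain h where h: "continuous_map (prod_topology (top_of_set {0..1::real}) (top_of_set {0..1})) X h"
      "\<forall>x. h (0, x) = f x" "\<forall>x. h (1, x) = g x" "\<forall>t\<in>{0..1}. h (t, 0) = f 0 \<and> h (t, 1) = f 1"
    using assms unfolding pathhom_def homotopic_with_def by blast
  show thesis
    by (rule that[of h]) (use h in \<open>auto simp: prod_topology_subtopology_eu\<close>)
qed

lemma pathhom_ends: assumes "pathhom X f g" shows "f 0 = g 0" "f 1 = g 1"
  using homotopic_with_imp_property[OF assms[unfolded pathhom_def]] by auto

lemma pathhom_pathin: assumes "pathhom X f g" shows "pathin X f" "pathin X g"
  using homotopic_with_imp_continuous_maps[OF assms[unfolded pathhom_def]] by (auto simp: pathin_def)

lemma pathhom_refl: "pathin X f \<Longrightarrow> pathhom X f f"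
  by (simp add: pathhom_def pathin_def)

lemma pathhom_sym: assumes "pathhom X f g" shows "pathhom X g f"
  using homotopic_with_symD[OF assms[unfolded pathhom_def]] pathhom_ends[OF assms] by (simp add: pathhom_def)

lemma pathhom_trans [trans]: assumes "pathhom X f g" "pathhom X g h" shows "pathhom X f h"
  using homotopic_with_trans[of "\<lambda>h. h 0 = f 0 \<and> h 1 = f 1" "top_of_set {0..1}" X f g h]
    assms pathhom_ends[OF assms(1)] by (simp add: pathhom_def)

text \<open>The straight line from one parameter change to the other stays in the unit interval.
  Associativity and the unit and inverse laws up to homotopy all come from this.\<close>

lemma pathhom_reparam:
  assumes f: "pathin X f" and \<alpha>: "continuous_on {0..1} \<alpha>" "\<alpha> \<in> {0..1} \<rightarrow> {0..1}"
    and \<beta>: "continuous_on {0..1} \<beta>" "\<beta> \<in> {0..1} \<rightarrow> {0..1}" and eq: "\<alpha> 0 = \<beta> 0" "\<alpha> 1 = \<beta> 1"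
  shows "pathhom X (\<lambda>t. f (\<alpha> t)) (\<lambda>t. f (\<beta> t))"
proof (rule pathhomI)
  let ?h = "\<lambda>x::real\<times>real. (1 - fst x) * \<alpha> (snd x) + fst x * \<beta> (snd x)"
  show "continuous_map (top_of_set ({0..1} \<times> {0..1})) X (\<lambda>x. f (?h x))"
  proof (rule continuous_map_top_of_set_compose)
    show "continuous_map (top_of_set {0..1}) X f" using f by (simp add: pathin_def)
    have "continuous_on ({0..1} \<times> {0..1}) (\<lambda>x::real\<times>real. \<alpha> (snd x))"
      "continuous_on ({0..1} \<times> {0..1}) (\<lambda>x::real\<times>real. \<beta> (snd x))"
      by (rule continuous_on_compose2[OF \<alpha>(1)] continuous_on_compose2[OF \<beta>(1)];
          auto intro!: continuous_intros)+
    then show "continuous_on ({0..1} \<times> {0..1}) ?h" by (intro continuous_intros)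
    have conv: "(1 - s) * a + s * b \<in> {0..1}" if "s \<in> {0..1}" "a \<in> {0..1}" "b \<in> {0..1}" for s a b :: real
    proof -
      have "(1 - s) * a \<le> (1 - s) * 1" "s * b \<le> s * 1"
        using that by (intro mult_left_mono; simp)+
      then show ?thesis using that by auto
    qed
    show "?h \<in> {0..1} \<times> {0..1} \<rightarrow> {0..1}"
      using \<alpha>(2) \<beta>(2) by (intro Pi_I conv) auto
  qed
  show "f ((1 - fst (s, 0)) * \<alpha> (snd (s, 0)) + fst (s, 0) * \<beta> (snd (s, 0))) = f (\<alpha> 0)" for s :: real
    using eq(1) by (simp add: algebra_simps)
  show "f ((1 - fst (s, 1)) * \<alpha> (snd (s, 1)) + fst (s, 1) * \<beta> (snd (s, 1))) = f (\<alpha> 1)" for s :: real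
    using eq(2) by (simp add: algebra_simps)
qed auto

lemma pathhom_eq:
  assumes "pathin X f" "\<And>t. t \<in> {0..1} \<Longrightarrow> f t = g t" shows "pathhom X f g"
  unfolding pathhom_def using assms by (intro homotopic_with_equal) (auto simp: pathin_def)

lemma pathhom_reparam':
  assumes "pathin X f" "continuous_on {0..1} \<alpha>" "\<alpha> \<in> {0..1} \<rightarrow> {0..1}"
    and "continuous_on {0..1} \<beta>" "\<beta> \<in> {0..1} \<rightarrow> {0..1}" and "\<alpha> 0 = \<beta> 0" "\<alpha> 1 = \<beta> 1"
    and "\<And>t. t \<in> {0..1} \<Longrightarrow> f (\<alpha> t) = g t" "\<And>t. t \<in> {0..1} \<Longrightarrow> f (\<beta> t) = h t"
  shows "pathhom X g h"
proof -
  have "pathhom X g (\<lambda>t. f (\<alpha> t))"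
    by (rule pathhom_sym[OF pathhom_eq[OF pathin_reparam[OF assms(1-3)]]]) (rule assms(8))
  also have "pathhom X \<dots> (\<lambda>t. f (\<beta> t))" by (rule pathhom_reparam[OF assms(1-7)])
  also have "pathhom X \<dots> h" by (rule pathhom_eq[OF pathin_reparam[OF assms(1,4,5)]]) (rule assms(9))
  finally show ?thesis .
qed

lemma pathhom_concat:
  assumes "pathhom X f f'" "pathhom X g g'" "f 1 = g 0"
  shows "pathhom X (loop_concat f g) (loop_concat f' g')"
proof -
  obtain H :: "real \<times> real \<Rightarrow> 'a" where H: "continuous_map (top_of_set ({0..1} \<times> {0..1})) X H"
    "\<And>t. H (0, t) = f t" "\<And>t. H (1, t) = f' t"
    "\<And>s. s \<in> {0..1} \<Longrightarrow> H (s, 0) = f 0" "\<And>s. s \<in> {0..1} \<Longrightarrow> H (s, 1) = f 1"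
    by (rule pathhomE[OF assms(1)]) (rule that)
  obtain K :: "real \<times> real \<Rightarrow> 'a" where K: "continuous_map (top_of_set ({0..1} \<times> {0..1})) X K"
    "\<And>t. K (0, t) = g t" "\<And>t. K (1, t) = g' t"
    "\<And>s. s \<in> {0..1} \<Longrightarrow> K (s, 0) = g 0" "\<And>s. s \<in> {0..1} \<Longrightarrow> K (s, 1) = g 1"
    by (rule pathhomE[OF assms(2)]) (rule that)
  show ?thesis
  proof (rule pathhomI)
    show "continuous_map (top_of_set ({0..1} \<times> {0..1})) X
      (\<lambda>x. if snd x \<le> 1/2 then H (fst x, 2 * snd x) else K (fst x, 2 * snd x - 1))"
      using H K assms(3) by (intro continuous_map_concat) auto
  qed (use H K in \<open>auto simp: loop_concat_def\<close>)
qed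

lemma concat_assoc:
  assumes "pathin X f" "pathin X g" "pathin X h" "f 1 = g 0" "g 1 = h 0"
  shows "pathhom X (loop_concat (loop_concat f g) h) (loop_concat f (loop_concat g h))"
proof (rule pathhom_reparam')
  \<comment> \<open>The piecewise linear parameter change has decreasing slopes 2, 1 and 1/2, with
    breaks at 1/4 and 1/2, and so is a minimum of three affine functions.\<close>
  let ?\<alpha> = "\<lambda>t::real. min (2 * t) (min (t + 1/4) ((t + 1) / 2))"
  show "pathin X (loop_concat f (loop_concat g h))" using assms by simp
  show "continuous_on {0..1} ?\<alpha>" by (intro continuous_intros) auto
  show "?\<alpha> \<in> {0..1} \<rightarrow> {0..1}" by (auto simp: min_def)
  show "continuous_on {0..1} (\<lambda>t::real. t)" by (intro continuous_intros)
  fix t :: real assume t: "t \<in> {0..1}"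
  consider "t \<le> 1/4" | "1/4 < t" "t \<le> 1/2" | "1/2 < t" by linarith
  then show "loop_concat f (loop_concat g h) (?\<alpha> t) = loop_concat (loop_concat f g) h t"
  proof cases
    case 1
    then have "?\<alpha> t = 2 * t" by auto
    then show ?thesis using 1 by (simp add: loop_concat_def)
  next
    case 2
    then have a: "?\<alpha> t = t + 1/4" by auto
    show ?thesis unfolding a using 2 by (auto simp: loop_concat_def algebra_simps)
  next
    case 3
    then have a: "?\<alpha> t = (t + 1) / 2" by auto
    show ?thesis unfolding a using 3 by (auto simp: loop_concat_def add_divide_distrib)
  qed
qed auto

lemma concat_const_left:
  assumes "pathin X f" "f 0 = x" shows "pathhom X (loop_concat (\<lambda>_. x) f) f"
proof (rule pathhom_reparam'[where f = f and \<alpha> = "\<lambda>t. max 0 (2 * t - 1)" and \<beta> = "\<lambda>t. t"])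
  show "continuous_on {0..1} (\<lambda>t::real. max 0 (2 * t - 1))" by (intro continuous_intros)
  show "f (max 0 (2 * t - 1)) = loop_concat (\<lambda>_. x) f t" for t
  proof (cases "t \<le> 1/2")
    case True
    then have "max 0 (2 * t - 1) = 0" by simp
    then show ?thesis using True assms(2) by (simp add: loop_concat_def)
  qed (simp add: loop_concat_def)
qed (use assms in auto)

lemma concat_const_right:
  assumes "pathin X f" "f 1 = x" shows "pathhom X (loop_concat f (\<lambda>_. x)) f"
proof (rule pathhom_reparam'[where f = f and \<alpha> = "\<lambda>t. min (2 * t) 1" and \<beta> = "\<lambda>t. t"])
  show "continuous_on {0..1} (\<lambda>t::real. min (2 * t) 1)" by (intro continuous_intros)
  show "f (min (2 * t) 1) = loop_concat f (\<lambda>_. x) t" for t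
  proof (cases "t \<le> 1/2")
    case False
    then have "min (2 * t) 1 = 1" by simp
    then show ?thesis using False assms(2) by (simp add: loop_concat_def)
  qed (simp add: loop_concat_def)
qed (use assms in auto)

text \<open>There and back is the parameter change \<open>min (2 * t) (2 - 2 * t)\<close>, which has
  the same ends as the constant 0.\<close>

lemma concat_rev_right:
  assumes "pathin X f" shows "pathhom X (loop_concat f (rev_path f)) (\<lambda>_. f 0)"
proof (rule pathhom_reparam'[where f = f and \<alpha> = "\<lambda>t. min (2 * t) (2 - 2 * t)" and \<beta> = "\<lambda>t. 0"])
  show "continuous_on {0..1} (\<lambda>t::real. min (2 * t) (2 - 2 * t))" by (intro continuous_intros)
  show "f (min (2 * t) (2 - 2 * t)) = loop_concat f (rev_path f) t" for t
    by (cases "t \<le> 1/2") (simp_all add: loop_concat_def rev_path_def min_def algebra_simps)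
qed (use assms in auto)

lemma concat_rev_left:
  assumes "pathin X f" shows "pathhom X (loop_concat (rev_path f) f) (\<lambda>_. f 1)"
  using concat_rev_right[of X "rev_path f"] assms by simp

lemma concat_cancel:
  assumes "pathin X f" "pathin X g" "f 1 = g 0"
  shows "pathhom X (loop_concat (rev_path f) (loop_concat f g)) g"
proof -
  have "pathhom X (loop_concat (rev_path f) (loop_concat f g)) (loop_concat (loop_concat (rev_path f) f) g)"
    using assms by (intro pathhom_sym[OF concat_assoc]) auto
  also have "pathhom X \<dots> (loop_concat (\<lambda>_. f 1) g)"
    using assms by (intro pathhom_concat concat_rev_left pathhom_refl) auto
  also have "pathhom X \<dots> g" using assms by (intro concat_const_left) auto
  finally show ?thesis .
qed

section \<open>The group of loop classes\<close>

lemma loop_homotopy_rel_iff: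
  "(f, g) \<in> loop_homotopy_rel X x \<longleftrightarrow> f \<in> loops_at X x \<and> g \<in> loops_at X x \<and> pathhom X f g"
  by (auto simp: loop_homotopy_rel_def pathhom_def loops_at_def)

lemma equiv_loop_homotopy: "equiv (loops_at X x) (loop_homotopy_rel X x)"
  by (rule equivI)
    (auto simp: refl_on_def sym_def trans_def loop_homotopy_rel_iff loops_at_def
      intro: pathhom_refl pathhom_sym pathhom_trans)

definition loop_class :: "'a topology \<Rightarrow> 'a \<Rightarrow> (real \<Rightarrow> 'a) \<Rightarrow> (real \<Rightarrow> 'a) set" where
  "loop_class X x f = loop_homotopy_rel X x `` {f}"

lemma loop_class_eq_iff:
  assumes "f \<in> loops_at X x" "g \<in> loops_at X x"
  shows "loop_class X x f = loop_class X x g \<longleftrightarrow> pathhom X f g"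
  using eq_equiv_class_iff[OF equiv_loop_homotopy assms] assms
  by (simp add: loop_class_def loop_homotopy_rel_iff)

lemma loop_class_in_carrier: "f \<in> loops_at X x \<Longrightarrow> loop_class X x f \<in> carrier (fundamental_group X x)"
  by (auto simp: fundamental_group_def loop_class_def intro: quotientI)

lemma carrier_fundamental_groupE:
  assumes "a \<in> carrier (fundamental_group X x)"
  obtains f where "f \<in> loops_at X x" "a = loop_class X x f"
  using assms by (auto simp: fundamental_group_def loop_class_def elim: quotientE)

lemma loops_at_concat: "f \<in> loops_at X x \<Longrightarrow> g \<in> loops_at X x \<Longrightarrow> loop_concat f g \<in> loops_at X x"
  by (simp add: loops_at_def)

lemma loops_at_rev: "f \<in> loops_at X x \<Longrightarrow> rev_path f \<in> loops_at X x"
  by (simp add: loops_at_def)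

lemma loops_at_const: "x \<in> topspace X \<Longrightarrow> (\<lambda>_. x) \<in> loops_at X x"
  by (simp add: loops_at_def)

lemma loop_class_concat:
  assumes f: "f \<in> loops_at X x" and g: "g \<in> loops_at X x"
  shows "loop_class X x f \<otimes>\<^bsub>fundamental_group X x\<^esub> loop_class X x g = loop_class X x (loop_concat f g)"
proof -
  have "(\<Union>a\<in>loop_class X x f. \<Union>b\<in>loop_class X x g. loop_class X x (loop_concat a b))
      = loop_class X x (loop_concat f g)"
    unfolding loop_class_def
  proof (rule UN_equiv_class2[OF equiv_loop_homotopy equiv_loop_homotopy])
    show "congruent2 (loop_homotopy_rel X x) (loop_homotopy_rel X x)
        (\<lambda>a b. loop_homotopy_rel X x `` {loop_concat a b})"
    proof (rule congruent2I'[unfolded loop_class_def[symmetric]])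
      fix a a' b b'
      assume "(a, a') \<in> loop_homotopy_rel X x" "(b, b') \<in> loop_homotopy_rel X x"
      then have "loop_class X x (loop_concat a b) = loop_class X x (loop_concat a' b')"
        by (subst loop_class_eq_iff) (auto simp: loop_homotopy_rel_iff loops_at_concat loops_at_def intro!: pathhom_concat)
      then show "loop_homotopy_rel X x `` {loop_concat a b} = loop_homotopy_rel X x `` {loop_concat a' b'}"
        by (simp add: loop_class_def)
    qed
  qed (use f g in auto)
  then show ?thesis by (simp add: fundamental_group_def loop_class_def)
qed

lemma one_fundamental_group: "\<one>\<^bsub>fundamental_group X x\<^esub> = loop_class X x (\<lambda>_. x)"
  by (simp add: fundamental_group_def loop_class_def)

lemma group_fundamental_group:
  assumes x: "x \<in> topspace X" shows "group (fundamental_group X x)"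
proof (rule groupI)
  let ?G = "fundamental_group X x"
  note const = loops_at_const[OF x]
  show "\<one>\<^bsub>?G\<^esub> \<in> carrier ?G" by (simp add: one_fundamental_group loop_class_in_carrier const)
  fix a assume "a \<in> carrier ?G"
  then obtain f where f: "f \<in> loops_at X x" "a = loop_class X x f" by (rule carrier_fundamental_groupE)
  have fp: "pathin X f" "f 0 = x" "f 1 = x" using f by (auto simp: loops_at_def)
  show "\<one>\<^bsub>?G\<^esub> \<otimes>\<^bsub>?G\<^esub> a = a"
    using f const fp by (simp add: one_fundamental_group loop_class_concat loop_class_eq_iff loops_at_concat
        concat_const_left)
  have "loop_class X x (rev_path f) \<otimes>\<^bsub>?G\<^esub> a = \<one>\<^bsub>?G\<^esub>"
    using f const fp concat_rev_left[OF fp(1)]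
    by (simp add: one_fundamental_group loop_class_concat loop_class_eq_iff loops_at_concat loops_at_rev)
  then show "\<exists>y\<in>carrier ?G. y \<otimes>\<^bsub>?G\<^esub> a = \<one>\<^bsub>?G\<^esub>"
    using loop_class_in_carrier[OF loops_at_rev[OF f(1)]] by blast
  fix b assume "b \<in> carrier ?G"
  then obtain g where g: "g \<in> loops_at X x" "b = loop_class X x g" by (rule carrier_fundamental_groupE)
  show "a \<otimes>\<^bsub>?G\<^esub> b \<in> carrier ?G"
    using f g by (simp add: loop_class_concat loop_class_in_carrier loops_at_concat)
  fix c assume "c \<in> carrier ?G"
  then obtain h where h: "h \<in> loops_at X x" "c = loop_class X x h" by (rule carrier_fundamental_groupE)
  show "a \<otimes>\<^bsub>?G\<^esub> b \<otimes>\<^bsub>?G\<^esub> c = a \<otimes>\<^bsub>?G\<^esub> (b \<otimes>\<^bsub>?G\<^esub> c)"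
    using f g h by (simp add: loop_class_concat loops_at_concat loop_class_eq_iff)
      (auto intro!: concat_assoc simp: loops_at_def)
qed

lemma inv_loop_class:
  assumes "f \<in> loops_at X x" and x: "x \<in> topspace X"
  shows "inv\<^bsub>fundamental_group X x\<^esub> loop_class X x f = loop_class X x (rev_path f)"
proof (rule group.inv_equality[OF group_fundamental_group[OF x]])
  have fp: "pathin X f" "f 0 = x" "f 1 = x" using assms by (auto simp: loops_at_def)
  show "loop_class X x (rev_path f) \<otimes>\<^bsub>fundamental_group X x\<^esub> loop_class X x f = \<one>\<^bsub>fundamental_group X x\<^esub>"
    using assms concat_rev_left[OF fp(1)] fp
    by (simp add: one_fundamental_group loop_class_concat loop_class_eq_iff loops_at_concat loops_at_rev loops_at_const)
qed (use assms in \<open>auto intro: loop_class_in_carrier loops_at_rev\<close>)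

text \<open>A choice of paths from the base point extends the class map from loops to a functor on all paths.\<close>

lemma path_class_exists:
  assumes X: "path_connected_space X" and x: "x \<in> topspace X"
  shows "\<exists>P. (\<forall>u\<in>topspace X. pathin X (P u) \<and> P u 0 = x \<and> P u 1 = u) \<and> P x = (\<lambda>_. x)"
proof -
  have "\<forall>u\<in>topspace X. \<exists>p. pathin X p \<and> p 0 = x \<and> p 1 = u"
    using X x unfolding path_connected_space_def by blast
  from bchoice[OF this] obtain P where P: "\<forall>u\<in>topspace X. pathin X (P u) \<and> P u 0 = x \<and> P u 1 = u" by blast
  then show ?thesis using x by (intro exI[of _ "P(x := (\<lambda>_. x))"]) auto
qed

locale based_space =
  fixes X :: "'a topology" and x0 :: 'a and P :: "'a \<Rightarrow> real \<Rightarrow> 'a"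
  assumes x0: "x0 \<in> topspace X"
    and P: "u \<in> topspace X \<Longrightarrow> pathin X (P u)" "u \<in> topspace X \<Longrightarrow> P u 0 = x0"
      "u \<in> topspace X \<Longrightarrow> P u 1 = u" and P_x0: "P x0 = (\<lambda>_. x0)"
begin

abbreviation "\<pi> \<equiv> fundamental_group X x0"

sublocale pi1: group \<pi>
  by (rule group_fundamental_group[OF x0])

definition lasso :: "(real \<Rightarrow> 'a) \<Rightarrow> real \<Rightarrow> 'a" where
  "lasso c = loop_concat (P (c 0)) (loop_concat c (rev_path (P (c 1))))"

definition path_class :: "(real \<Rightarrow> 'a) \<Rightarrow> (real \<Rightarrow> 'a) set" where
  "path_class c = loop_class X x0 (lasso c)"

lemma ends_in: "pathin X c \<Longrightarrow> c 0 \<in> topspace X" "pathin X c \<Longrightarrow> c 1 \<in> topspace X"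
  by (auto intro: path_start_in_topspace path_finish_in_topspace)

lemma lasso_in: "pathin X c \<Longrightarrow> lasso c \<in> loops_at X x0"
  using ends_in[of c] P by (auto simp: lasso_def loops_at_def)

lemma path_class_closed [simp]: "pathin X c \<Longrightarrow> path_class c \<in> carrier \<pi>"
  by (simp add: path_class_def lasso_in loop_class_in_carrier)

lemma path_class_cong:
  assumes "pathhom X c d" shows "path_class c = path_class d"
proof -
  note cd = pathhom_pathin[OF assms] and ends = pathhom_ends[OF assms]
  have "pathhom X (lasso c) (lasso d)"
    unfolding lasso_def ends
    using cd ends ends_in[OF cd(2)] P assms by (intro pathhom_concat pathhom_refl) auto
  then show ?thesis using cd by (simp add: path_class_def loop_class_eq_iff lasso_in)
qed

text \<open>This is where the constant choice of \<open>P x0\<close> enters: a loop at the base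
  point is conjugated only by constant paths.\<close>

lemma path_class_loop:
  assumes "c \<in> loops_at X x0" shows "path_class c = loop_class X x0 c"
proof -
  have c: "pathin X c" "c 0 = x0" "c 1 = x0" using assms by (auto simp: loops_at_def)
  have "rev_path (\<lambda>_. x0) = (\<lambda>_. x0)" by (simp add: rev_path_def)
  then have l: "lasso c = loop_concat (\<lambda>_. x0) (loop_concat c (\<lambda>_. x0))"
    by (simp add: lasso_def c P_x0)
  have "pathhom X (lasso c) (loop_concat c (\<lambda>_. x0))"
    unfolding l using c x0 by (intro concat_const_left) auto
  also have "pathhom X \<dots> c" using c by (intro concat_const_right) auto
  finally show ?thesis using assms c by (simp add: path_class_def loop_class_eq_iff lasso_in)
qed

lemma path_class_concat:
  assumes c: "pathin X c" and d: "pathin X d" and cd: "c 1 = d 0"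
  shows "path_class (loop_concat c d) = path_class c \<otimes>\<^bsub>\<pi>\<^esub> path_class d"
proof -
  define p q r where "p = P (c 0)" and "q = P (c 1)" and "r = P (d 1)"
  have p: "pathin X p" "p 0 = x0" "p 1 = c 0" and q: "pathin X q" "q 0 = x0" "q 1 = c 1"
    and r: "pathin X r" "r 0 = x0" "r 1 = d 1"
    using ends_in[OF c] ends_in[OF d] P by (auto simp: p_def q_def r_def)
  note pqr = p q r c d cd
  define b where "b = loop_concat q (loop_concat d (rev_path r))"
  have b: "pathin X b" "b 0 = x0" "b 1 = x0" using pqr by (auto simp: b_def)
  have "pathhom X (loop_concat (loop_concat p (loop_concat c (rev_path q))) b)
      (loop_concat p (loop_concat (loop_concat c (rev_path q)) b))"
    using pqr b by (intro concat_assoc) auto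
  also have "pathhom X \<dots> (loop_concat p (loop_concat c (loop_concat (rev_path q) b)))"
    using pqr b by (intro pathhom_concat pathhom_refl concat_assoc) auto
  also have "pathhom X \<dots> (loop_concat p (loop_concat c (loop_concat d (rev_path r))))"
    using pqr unfolding b_def by (intro pathhom_concat pathhom_refl concat_cancel) auto
  also have "pathhom X \<dots> (loop_concat p (loop_concat (loop_concat c d) (rev_path r)))"
    using pqr by (intro pathhom_concat pathhom_refl pathhom_sym[OF concat_assoc]) auto
  finally have "pathhom X (loop_concat (lasso c) (lasso d)) (lasso (loop_concat c d))"
    by (simp add: lasso_def p_def q_def r_def b_def cd)
  then have "path_class (loop_concat c d) = loop_class X x0 (loop_concat (lasso c) (lasso d))"
    using c d cd by (simp add: path_class_def loop_class_eq_iff lasso_in loops_at_concat pathhom_sym)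
  then show ?thesis using c d by (simp add: path_class_def loop_class_concat lasso_in)
qed

lemma path_class_const: assumes "u \<in> topspace X" shows "path_class (\<lambda>_. u) = \<one>\<^bsub>\<pi>\<^esub>"
proof -
  have u: "pathin X (\<lambda>_. u)" using assms by simp
  have "path_class (loop_concat (\<lambda>_. u) (\<lambda>_. u)) = path_class (\<lambda>_. u)"
    by (rule path_class_cong, rule concat_const_left) (use u in auto)
  then have "path_class (\<lambda>_. u) \<otimes>\<^bsub>\<pi>\<^esub> path_class (\<lambda>_. u) = path_class (\<lambda>_. u)"
    using path_class_concat[OF u u] by simp
  then show ?thesis using path_class_closed[OF u] pi1.r_cancel_one' by metis
qed

lemma path_class_rev:
  assumes c: "pathin X c" shows "path_class (rev_path c) = inv\<^bsub>\<pi>\<^esub> path_class c"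
proof -
  have "path_class (rev_path c) \<otimes>\<^bsub>\<pi>\<^esub> path_class c = path_class (loop_concat (rev_path c) c)"
    using c by (simp add: path_class_concat)
  also have "\<dots> = path_class (\<lambda>_. c 1)" using c by (intro path_class_cong concat_rev_left)
  also have "\<dots> = \<one>\<^bsub>\<pi>\<^esub>" using ends_in[OF c] by (simp add: path_class_const)
  finally show ?thesis using c by (simp add: pi1.inv_equality)
qed

end

section \<open>The radical of a group\<close>

text \<open>Bracketed to the right, the shape in which \<open>commutator_word\<close> cuts a path by
  repeatedly passing to the second half.\<close>

definition (in monoid) commutator_prod :: "('a \<times> 'a) list \<Rightarrow> 'a" where
  "commutator_prod ps = foldr (\<lambda>(a, b) y. a \<otimes> (b \<otimes> (inv a \<otimes> (inv b \<otimes> y)))) ps \<one>"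

context group
begin

lemma commutator_prod_Nil [simp]: "commutator_prod [] = \<one>"
  and commutator_prod_Cons [simp]: "commutator_prod ((a, b) # ps) =
    a \<otimes> (b \<otimes> (inv a \<otimes> (inv b \<otimes> commutator_prod ps)))"
  by (simp_all add: commutator_prod_def)

lemma commutator_prod_closed:
  "ps \<in> lists (carrier G \<times> carrier G) \<Longrightarrow> commutator_prod ps \<in> carrier G"
  by (induction ps) auto

lemma commutator_prod_append:
  assumes "ps \<in> lists (carrier G \<times> carrier G)" "rs \<in> lists (carrier G \<times> carrier G)"
  shows "commutator_prod (ps @ rs) = commutator_prod ps \<otimes> commutator_prod rs"
  using assms(1)
proof (induction ps)
  case Nil then show ?case using commutator_prod_closed[OF assms(2)] by simp
next
  case (Cons p ps)
  obtain a b where "p = (a, b)" "a \<in> carrier G" "b \<in> carrier G" using Cons by auto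
  then show ?case
    using Cons commutator_prod_closed[OF assms(2)] commutator_prod_closed[of ps] by (simp add: m_assoc)
qed

lemma derived_eq_commutator_prods:
  "derived G (carrier G) = commutator_prod ` lists (carrier G \<times> carrier G)"
proof
  show "derived G (carrier G) \<subseteq> commutator_prod ` lists (carrier G \<times> carrier G)"
  proof
    fix x assume "x \<in> derived G (carrier G)"
    then have "x \<in> generate G (derived_set G (carrier G))" by (simp add: derived_def)
    then show "x \<in> commutator_prod ` lists (carrier G \<times> carrier G)"
    proof (induction rule: generate.induct)
      case one show ?case by (rule image_eqI[of _ _ "[]"]) auto
    next
      case (incl h)
      then obtain a b where "a \<in> carrier G" "b \<in> carrier G" "h = a \<otimes> b \<otimes> inv a \<otimes> inv b" by auto
      then show ?case by (intro image_eqI[of _ _ "[(a, b)]"]) (auto simp: m_assoc)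
    next
      case (inv h)
      then obtain a b where "a \<in> carrier G" "b \<in> carrier G" "h = a \<otimes> b \<otimes> inv a \<otimes> inv b" by auto
      then show ?case by (intro image_eqI[of _ _ "[(b, a)]"]) (auto simp: m_assoc inv_mult_group)
    next
      case (eng h1 h2)
      then obtain ps rs where "h1 = commutator_prod ps" "h2 = commutator_prod rs"
        "ps \<in> lists (carrier G \<times> carrier G)" "rs \<in> lists (carrier G \<times> carrier G)" by blast
      then show ?case by (intro image_eqI[of _ _ "ps @ rs"]) (auto simp: commutator_prod_append)
    qed
  qed
  have sg: "subgroup (derived G (carrier G)) G" by (rule derived_is_subgroup) simp
  have "commutator_prod ps \<in> derived G (carrier G)" if "ps \<in> lists (carrier G \<times> carrier G)" for ps
    using that
  proof (induction ps)
    case Nil then show ?case using subgroup.one_closed[OF sg] by simp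
  next
    case (Cons p ps)
    obtain a b where p: "p = (a, b)" "a \<in> carrier G" "b \<in> carrier G" using Cons by auto
    have "a \<otimes> b \<otimes> inv a \<otimes> inv b \<in> derived G (carrier G)"
      unfolding derived_def using p by (intro generate.incl) blast
    then have "a \<otimes> b \<otimes> inv a \<otimes> inv b \<otimes> commutator_prod ps \<in> derived G (carrier G)"
      using Cons by (simp add: subgroup.m_closed[OF sg])
    then show ?case using p Cons commutator_prod_closed[of ps] by (simp add: m_assoc)
  qed
  then show "commutator_prod ` lists (carrier G \<times> carrier G) \<subseteq> derived G (carrier G)" by blast
qed

end

text \<open>Satisfied by primes and by 0. The product rule keeps the exponents \<open>k\<close> in
  the definition of the radical closed under multiplication.\<close>

locale characteristic =
  fixes q :: nat
  assumes q_neq_1: "q \<noteq> 1" and not_dvd_mult: "\<not> q dvd k \<Longrightarrow> \<not> q dvd l \<Longrightarrow> \<not> q dvd k * l"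

text \<open>The intersection of the kernels of all homomorphisms to a field of characteristic \<open>q\<close> prime
  or zero, written as a set of solutions of equations so that it is analytic for loops.\<close>

definition hom_radical :: "nat \<Rightarrow> ('a, 'b) monoid_scheme \<Rightarrow> 'a set" where
  "hom_radical q G = {g \<in> carrier G. \<exists>k::nat. \<not> q dvd k \<and>
     (\<exists>c\<in>carrier G. g [^]\<^bsub>G\<^esub> k \<otimes>\<^bsub>G\<^esub> c [^]\<^bsub>G\<^esub> q \<in> derived G (carrier G))}"

locale group_characteristic = group G + characteristic q for G (structure) and q
begin

abbreviation "N \<equiv> derived G (carrier G)"
abbreviation "R \<equiv> hom_radical q G"

lemma N_normal: "N \<lhd> G" by (rule derived_is_normal[OF normal_self])

lemma N_mem_iff: "x \<in> carrier G \<Longrightarrow> x \<in> N \<longleftrightarrow> N #> x = N"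
  using coset_join1[of N x] coset_join2[of x N] normal_imp_subgroup[OF N_normal]
  by (meson subgroup.subset)

definition \<nu> where "\<nu> x = N #> x"

lemma \<nu>_hom: "\<nu> \<in> hom G (G Mod N)"
  unfolding \<nu>_def by (rule normal.r_coset_hom_Mod[OF N_normal])

lemma comm_Mod_N: "comm_group (G Mod N)" by (rule derived_quot_is_comm_group)

interpretation B: comm_group "G Mod N" by (rule comm_Mod_N)
interpretation nu: group_hom G "G Mod N" \<nu>
  by unfold_locales (rule \<nu>_hom)

text \<open>In the quotient by the commutator subgroup powers distribute over products, which makes
  the subgroup laws for \<open>R\<close> computations in an abelian group.\<close>

lemma R_iff:
  "g \<in> R \<longleftrightarrow> g \<in> carrier G \<and> (\<exists>k::nat. \<not> q dvd k \<and>
    (\<exists>c\<in>carrier G. \<nu> g [^]\<^bsub>G Mod N\<^esub> k \<otimes>\<^bsub>G Mod N\<^esub> \<nu> c [^]\<^bsub>G Mod N\<^esub> q = \<one>\<^bsub>G Mod N\<^esub>))"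
proof -
  have "g [^] k \<otimes> c [^] q \<in> N \<longleftrightarrow> \<nu> g [^]\<^bsub>G Mod N\<^esub> k \<otimes>\<^bsub>G Mod N\<^esub> \<nu> c [^]\<^bsub>G Mod N\<^esub> q = \<one>\<^bsub>G Mod N\<^esub>"
    if "g \<in> carrier G" "c \<in> carrier G" for c and k :: nat
  proof -
    have "\<nu> (g [^] k \<otimes> c [^] q) = \<nu> g [^]\<^bsub>G Mod N\<^esub> k \<otimes>\<^bsub>G Mod N\<^esub> \<nu> c [^]\<^bsub>G Mod N\<^esub> q"
      using that by (simp add: nu.hom_nat_pow)
    then show ?thesis using that N_mem_iff[of "g [^] k \<otimes> c [^] q"] by (simp add: \<nu>_def)
  qed
  then show ?thesis unfolding hom_radical_def by blast
qed

lemma R_mult: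
  assumes "g \<in> R" "h \<in> R" shows "g \<otimes> h \<in> R"
proof -
  let ?B = "G Mod N"
  obtain k c where k: "\<not> q dvd k" "c \<in> carrier G" "\<nu> g [^]\<^bsub>?B\<^esub> (k::nat) \<otimes>\<^bsub>?B\<^esub> \<nu> c [^]\<^bsub>?B\<^esub> q = \<one>\<^bsub>?B\<^esub>"
    using assms(1) R_iff by blast
  obtain l d where l: "\<not> q dvd l" "d \<in> carrier G" "\<nu> h [^]\<^bsub>?B\<^esub> (l::nat) \<otimes>\<^bsub>?B\<^esub> \<nu> d [^]\<^bsub>?B\<^esub> q = \<one>\<^bsub>?B\<^esub>"
    using assms(2) R_iff by blast
  have gh: "g \<in> carrier G" "h \<in> carrier G" using assms R_iff by blast+
  have cl: "\<nu> x \<in> carrier ?B" if "x \<in> carrier G" for x using that by simp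
  \<comment> \<open>The exponent \<open>k * l\<close> and the element
    \<open>c [^] l \<otimes> d [^] k\<close> come from raising the equation of \<open>g\<close> to
    the power \<open>l\<close>, that of \<open>h\<close> to the power \<open>k\<close>, and
    multiplying.\<close>
  have "\<nu> (g \<otimes> h) [^]\<^bsub>?B\<^esub> (k * l) \<otimes>\<^bsub>?B\<^esub> \<nu> (c [^] l \<otimes> d [^] k) [^]\<^bsub>?B\<^esub> q =
     (\<nu> g [^]\<^bsub>?B\<^esub> k \<otimes>\<^bsub>?B\<^esub> \<nu> c [^]\<^bsub>?B\<^esub> q) [^]\<^bsub>?B\<^esub> l \<otimes>\<^bsub>?B\<^esub> (\<nu> h [^]\<^bsub>?B\<^esub> l \<otimes>\<^bsub>?B\<^esub> \<nu> d [^]\<^bsub>?B\<^esub> q) [^]\<^bsub>?B\<^esub> k"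
    using gh k(2) l(2) cl
    by (simp add: nu.hom_nat_pow B.nat_pow_distrib B.nat_pow_pow B.m_ac mult.commute del: mult_FactGroup)
  also have "\<dots> = \<one>\<^bsub>?B\<^esub>" unfolding k(3) l(3) by (simp only: B.nat_pow_one B.l_one B.one_closed)
  finally show ?thesis
    using not_dvd_mult[OF k(1) l(1)] gh k(2) l(2) unfolding R_iff
    by (intro conjI exI[of _ "k * l"] bexI[of _ "c [^] l \<otimes> d [^] k"]) auto
qed

lemma R_inv:
  assumes "g \<in> R" shows "inv g \<in> R"
proof -
  let ?B = "G Mod N"
  obtain k c where k: "\<not> q dvd k" "c \<in> carrier G" "\<nu> g [^]\<^bsub>?B\<^esub> (k::nat) \<otimes>\<^bsub>?B\<^esub> \<nu> c [^]\<^bsub>?B\<^esub> q = \<one>\<^bsub>?B\<^esub>"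
    using assms(1) R_iff by blast
  have g: "g \<in> carrier G" using assms R_iff by blast
  have "\<nu> (inv g) [^]\<^bsub>?B\<^esub> k \<otimes>\<^bsub>?B\<^esub> \<nu> (inv c) [^]\<^bsub>?B\<^esub> q = inv\<^bsub>?B\<^esub> (\<nu> g [^]\<^bsub>?B\<^esub> k \<otimes>\<^bsub>?B\<^esub> \<nu> c [^]\<^bsub>?B\<^esub> q)"
    using g k(2) by (simp add: B.inv_mult B.nat_pow_inv del: mult_FactGroup)
  also have "\<dots> = \<one>\<^bsub>?B\<^esub>" unfolding k(3) by (rule B.inv_one)
  finally show ?thesis
    using k g unfolding R_iff
    by (intro conjI exI[of _ k] bexI[of _ "inv c"]) auto
qed

lemma N_subset_R: "N \<subseteq> R"
proof
  fix x assume x: "x \<in> N"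
  then have xc: "x \<in> carrier G" using derived_in_carrier by blast
  have "x [^] (1::nat) \<otimes> \<one> [^] q \<in> N" using x xc by simp
  moreover have "\<not> q dvd 1" using q_neq_1 by simp
  ultimately show "x \<in> R" unfolding hom_radical_def using xc by blast
qed

lemma R_subset: "R \<subseteq> carrier G" by (auto simp: hom_radical_def)

lemma R_subgroup: "subgroup R G"
  using R_subset R_mult R_inv N_subset_R subgroup.one_closed[OF normal_imp_subgroup[OF N_normal]]
  by (intro subgroupI) auto

lemma commutator_in_R:
  assumes "x \<in> carrier G" "y \<in> carrier G" shows "x \<otimes> y \<otimes> inv x \<otimes> inv y \<in> R"
  using assms N_subset_R unfolding derived_def by (blast intro: generate.incl)

text \<open>A conjugate of \<open>h\<close> is a commutator times \<open>h\<close>, and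
  \<open>R\<close> contains all commutators.\<close>

lemma R_normal: "R \<lhd> G"
proof (rule normal_invI[OF R_subgroup])
  fix x h assume x: "x \<in> carrier G" and h: "h \<in> R"
  then have hc: "h \<in> carrier G" using R_subset by blast
  have "(x \<otimes> h \<otimes> inv x \<otimes> inv h) \<otimes> h \<in> R"
    using commutator_in_R[OF x hc] h by (rule R_mult)
  then show "x \<otimes> h \<otimes> inv x \<in> R" using x hc by (simp add: m_assoc)
qed

abbreviation "A \<equiv> G Mod R"

lemma A_group: "group A" by (rule normal.factorgroup_is_group[OF R_normal])

lemma proj_hom: "(\<lambda>x. R #> x) \<in> hom G A" by (rule normal.r_coset_hom_Mod[OF R_normal])

lemma carrier_A: "carrier A = (\<lambda>x. R #> x) ` carrier G" by (simp add: carrier_FactGroup)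

lemma R_mem_iff: "x \<in> carrier G \<Longrightarrow> x \<in> R \<longleftrightarrow> R #> x = \<one>\<^bsub>A\<^esub>"
  using coset_join1[of R x] coset_join2[of x R] R_subgroup R_subset by auto

sublocale proj: group_hom G A "\<lambda>x. R #> x"
  by (intro group_hom.intro group_hom_axioms.intro group_axioms A_group proj_hom)

lemma A_comm: "comm_group A"
proof (rule group.group_comm_groupI[OF A_group])
  fix a b assume "a \<in> carrier A" "b \<in> carrier A"
  then obtain x y where xy: "x \<in> carrier G" "a = R #> x" "y \<in> carrier G" "b = R #> y"
    unfolding carrier_A by blast
  have "R #> ((x \<otimes> y \<otimes> inv x \<otimes> inv y) \<otimes> (y \<otimes> x)) = \<one>\<^bsub>A\<^esub> \<otimes>\<^bsub>A\<^esub> (R #> (y \<otimes> x))"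
    using commutator_in_R[OF xy(1,3)] xy R_mem_iff[of "x \<otimes> y \<otimes> inv x \<otimes> inv y"]
    by (subst proj.hom_mult) auto
  moreover have "inv y \<otimes> (y \<otimes> x) = x" using xy by (simp flip: m_assoc)
  then have "(x \<otimes> y \<otimes> inv x \<otimes> inv y) \<otimes> (y \<otimes> x) = x \<otimes> y" using xy by (simp add: m_assoc)
  ultimately have "R #> (x \<otimes> y) = R #> (y \<otimes> x)" 
    using proj.H.l_one[OF proj.hom_closed[of "y \<otimes> x"]] xy by simp
  then show "a \<otimes>\<^bsub>A\<^esub> b = b \<otimes>\<^bsub>A\<^esub> a" using xy by (simp only: proj.hom_mult)
qed

text \<open>A power \<open>x [^] q\<close> lies in \<open>R\<close> with \<open>k = 1\<close> and
  \<open>c = inv x\<close>. If \<open>x [^] k\<close> is in \<open>R\<close> with exponent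
  \<open>l\<close>, then \<open>x\<close> is in \<open>R\<close> with exponent
  \<open>k * l\<close>.\<close>

lemma A_char_group: "char_group A q"
proof (intro char_group.intro char_group_axioms.intro A_comm)
  show "q \<noteq> 1" by (rule q_neq_1)
  fix a assume "a \<in> carrier A"
  then obtain x where x: "x \<in> carrier G" "a = R #> x" unfolding carrier_A by blast
  have "(x [^] q) [^] (1::nat) \<otimes> inv x [^] q \<in> N"
    using x normal_imp_subgroup[OF N_normal] by (simp add: nat_pow_inv subgroup.one_closed)
  moreover have "\<not> q dvd 1" using q_neq_1 by simp
  ultimately have "x [^] q \<in> R" using x unfolding hom_radical_def by blast
  then show "a [^]\<^bsub>A\<^esub> q = \<one>\<^bsub>A\<^esub>" using x R_mem_iff[of "x [^] q"] by (simp only: proj.hom_nat_pow nat_pow_closed)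
  fix k :: nat assume k: "\<not> q dvd k" and "a [^]\<^bsub>A\<^esub> k = \<one>\<^bsub>A\<^esub>"
  then have "x [^] k \<in> R" using x R_mem_iff[of "x [^] k"] by (simp only: proj.hom_nat_pow nat_pow_closed)
  then obtain l c where l: "\<not> q dvd l" "c \<in> carrier G" "(x [^] k) [^] (l::nat) \<otimes> c [^] q \<in> N"
    unfolding hom_radical_def by blast
  then have "x [^] (k * l) \<otimes> c [^] q \<in> N" using x by (simp add: nat_pow_pow)
  then have "x \<in> R" unfolding hom_radical_def using not_dvd_mult[OF k l(1)] x(1) l(2) by blast
  then show "a = \<one>\<^bsub>A\<^esub>" using x R_mem_iff by simp
qed

text \<open>In the abelian group \<open>T\<close> commutators vanish and so does the image of
  \<open>c [^] q\<close>; what remains is a \<open>k\<close>-th power equal to the identity, and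
  \<open>T\<close> has no \<open>k\<close>-torsion.\<close>

lemma hom_kills_R:
  assumes T: "char_group T q" and f: "f \<in> hom G T" and x: "x \<in> R"
  shows "f x = \<one>\<^bsub>T\<^esub>"
proof -
  interpret T: char_group T q by (rule T)
  interpret f: group_hom G T f by (intro group_hom.intro group_hom_axioms.intro group_axioms T.group_axioms f)
  obtain k c where k: "\<not> q dvd k" "c \<in> carrier G" "x [^] (k::nat) \<otimes> c [^] q \<in> N" and xc: "x \<in> carrier G"
    using x unfolding hom_radical_def by blast
  obtain ps where ps: "ps \<in> lists (carrier G \<times> carrier G)" "x [^] k \<otimes> c [^] q = commutator_prod ps"
    using k(3) unfolding derived_eq_commutator_prods by blast
  have "f (commutator_prod ps) = \<one>\<^bsub>T\<^esub>"
    using ps(1)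
  proof (induction ps)
    case (Cons p ps)
    obtain a b where p: "p = (a, b)" "a \<in> carrier G" "b \<in> carrier G" using Cons by auto
    have "f (commutator_prod (p # ps)) = f a \<otimes>\<^bsub>T\<^esub> (f b \<otimes>\<^bsub>T\<^esub> (inv\<^bsub>T\<^esub> f a \<otimes>\<^bsub>T\<^esub> (inv\<^bsub>T\<^esub> f b \<otimes>\<^bsub>T\<^esub> f (commutator_prod ps))))"
      using p commutator_prod_closed[of ps] Cons by simp
    also have "\<dots> = \<one>\<^bsub>T\<^esub>"
      using p Cons T.r_inv[of "f a \<otimes>\<^bsub>T\<^esub> f b"] by (simp add: T.inv_mult T.m_assoc)
    finally show ?case .
  qed simp
  then have "f x [^]\<^bsub>T\<^esub> k \<otimes>\<^bsub>T\<^esub> f c [^]\<^bsub>T\<^esub> q = \<one>\<^bsub>T\<^esub>"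
    using xc k(2) ps(2) by (metis f.hom_mult f.hom_nat_pow nat_pow_closed)
  then have "f x [^]\<^bsub>T\<^esub> k = \<one>\<^bsub>T\<^esub>" using T.pow_char[of "f c"] xc k(2) by simp
  then show ?thesis using T.pow_eq_one[of "f x" k] k(1) xc by simp
qed

end

section \<open>Spaces with tame points only\<close>

lemma image_loop_concat: "loop_concat f g ` {0..1} \<subseteq> f ` {0..1} \<union> g ` {0..1}"
proof (rule image_subsetI)
  fix t :: real assume "t \<in> {0..1}"
  then show "loop_concat f g t \<in> f ` {0..1} \<union> g ` {0..1}"
    by (cases "t \<le> 1/2") (auto simp: loop_concat_def)
qed

lemma image_rev_path: "rev_path f ` {0..1} = f ` {0..1}"
proof -
  have "(\<lambda>t::real. 1 - t) ` {0..1} = {0..1}" by (auto simp: image_iff intro!: bexI[of _ "1 - _"])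
  then show ?thesis by (metis (no_types, lifting) image_cong image_image rev_path_def)
qed

section \<open>Subdivision of paths and tame sets\<close>

definition subpath :: "real \<Rightarrow> real \<Rightarrow> (real \<Rightarrow> 'a) \<Rightarrow> real \<Rightarrow> 'a" where
  "subpath a b g = (\<lambda>t. g (a + (b - a) * t))"

lemma segment_mem:
  fixes a b t :: real
  assumes "0 \<le> a" "a \<le> b" "b \<le> 1" "t \<in> {0..1}" shows "a + (b - a) * t \<in> {a..b}"
proof -
  have "(b - a) * t \<le> (b - a) * 1" using assms by (intro mult_left_mono) auto
  then show ?thesis using assms by auto
qed

lemma pathin_subpath:
  assumes "pathin X g" "0 \<le> a" "a \<le> b" "b \<le> 1" shows "pathin X (subpath a b g)"
  unfolding subpath_def
proof (rule pathin_reparam[OF assms(1)])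
  show "continuous_on {0..1} (\<lambda>t. a + (b - a) * t)" by (intro continuous_intros)
  show "(\<lambda>t. a + (b - a) * t) \<in> {0..1} \<rightarrow> {0..1}"
    using segment_mem[OF assms(2-4)] assms(2,4) by fastforce
qed

lemma subpath_0 [simp]: "subpath a b g 0 = g a" and subpath_1 [simp]: "subpath a b g 1 = g b"
  by (simp_all add: subpath_def)

lemma image_subpath:
  assumes "0 \<le> a" "a \<le> b" "b \<le> 1" shows "subpath a b g ` {0..1} \<subseteq> g ` {a..b}"
  using segment_mem[OF assms] by (auto simp: subpath_def)

lemma subpath_concat:
  assumes g: "pathin X g" and ab: "0 \<le> a" "a \<le> b" "b \<le> c" "c \<le> 1"
  shows "pathhom X (loop_concat (subpath a b g) (subpath b c g)) (subpath a c g)"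
proof (rule pathhom_reparam'[OF g])
  let ?\<alpha> = "\<lambda>t::real. if t \<le> 1/2 then a + (b - a) * (2 * t) else b + (c - b) * (2 * t - 1)"
  show "continuous_on {0..1} ?\<alpha>"
  proof -
    have "continuous_on ({0..1/2} \<union> {1/2..1}) ?\<alpha>"
    proof (rule continuous_on_If)
      fix t :: real assume "t \<in> {0..1/2}" "\<not> t \<le> 1/2"
      then show "a + (b - a) * (2 * t) = b + (c - b) * (2 * t - 1)" by simp
    next
      fix t :: real assume "t \<in> {1/2..1}" "t \<le> 1/2"
      then have t: "2 * t = 1" by simp
      show "a + (b - a) * (2 * t) = b + (c - b) * (2 * t - 1)" unfolding t by simp
    qed (auto intro!: continuous_intros)
    moreover have "{0..1/2} \<union> {1/2..1} = {0..1::real}" by auto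
    ultimately show ?thesis by simp
  qed
  show "?\<alpha> \<in> {0..1} \<rightarrow> {0..1}"
  proof
    fix t :: real assume t: "t \<in> {0..1}"
    show "?\<alpha> t \<in> {0..1}"
    proof (cases "t \<le> 1/2")
      case True
      then show ?thesis using segment_mem[of a b "2 * t"] ab t by auto
    next
      case False
      then show ?thesis using segment_mem[of b c "2 * t - 1"] ab t by auto
    qed
  qed
  show "continuous_on {0..1} (\<lambda>t. a + (c - a) * t)" by (intro continuous_intros)
  show "(\<lambda>t. a + (c - a) * t) \<in> {0..1} \<rightarrow> {0..1}"
    using segment_mem[of a c] ab by fastforce
qed (auto simp: subpath_def loop_concat_def)

locale peano = based_space X x0 P + Metric_space M d + characteristic q
  for X :: "'a topology" and x0 P and M :: "'a set" and d q +
  assumes X_eq: "X = mtopology" and compact: "compact_space X" and lpc: "locally_path_connected_space X"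
begin

lemma topspace_X: "topspace X = M" by (simp add: X_eq)

sublocale gc: group_characteristic \<pi> q
  by unfold_locales

text \<open>The loops may start anywhere in \<open>W\<close>; \<open>path_class\<close> joins them
  to the base point, and by normality of \<open>R\<close> the joining path does not matter.\<close>

definition tame :: "'a set \<Rightarrow> bool" where
  "tame W \<longleftrightarrow> (\<forall>l. pathin X l \<and> l 0 = l 1 \<and> l ` {0..1} \<subseteq> W \<longrightarrow> path_class l \<in> gc.R)"

definition tame_at :: "'a \<Rightarrow> 'a set \<Rightarrow> bool" where
  "tame_at y U \<longleftrightarrow> (\<forall>l. pathin X l \<and> l 0 = y \<and> l 1 = y \<and> l ` {0..1} \<subseteq> U \<longrightarrow> path_class l \<in> gc.R)"

lemma path_in_set:
  assumes "path_connectedin X W" "u \<in> W" "v \<in> W"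
  obtains e where "pathin X e" "e ` {0..1} \<subseteq> W" "e 0 = u" "e 1 = v"
  using assms unfolding path_connectedin by blast

text \<open>A loop in a path connected \<open>W\<close> becomes a loop at \<open>y\<close> in
  \<open>U\<close> when conjugated by a path inside \<open>W\<close>, and \<open>R\<close> is
  normal.\<close>

lemma tame_neighbourhood:
  assumes "openin X U" "y \<in> U" "tame_at y U"
  obtains W where "openin X W" "path_connectedin X W" "y \<in> W" "W \<subseteq> U" "tame W"
proof -
  obtain W where W: "openin X W" "path_connectedin X W" "y \<in> W" "W \<subseteq> U"
    using lpc assms(1,2) unfolding locally_path_connected_space by blast
  have "path_class l \<in> gc.R" if l: "pathin X l" "l 0 = l 1" "l ` {0..1} \<subseteq> W" for l
  proof -
    have "l 0 \<in> W" using l(3) by auto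
    then obtain e where e: "pathin X e" "e ` {0..1} \<subseteq> W" "e 0 = y" "e 1 = l 0"
      using path_in_set[OF W(2,3)] by blast
    let ?l = "loop_concat e (loop_concat l (rev_path e))"
    have "?l ` {0..1} \<subseteq> U"
      using image_loop_concat[of e "loop_concat l (rev_path e)"] image_loop_concat[of l "rev_path e"]
        image_rev_path[of e] e(2) l(3) W(4) by blast
    then have "path_class ?l \<in> gc.R"
      using assms(3) e l unfolding tame_at_def by simp
    moreover have pe: "path_class e \<in> carrier \<pi>" and pl: "path_class l \<in> carrier \<pi>"
      using e l by auto
    moreover have "path_class ?l = path_class e \<otimes>\<^bsub>\<pi>\<^esub> path_class l \<otimes>\<^bsub>\<pi>\<^esub> inv\<^bsub>\<pi>\<^esub> path_class e"
      using e l by (simp add: path_class_concat path_class_rev pi1.m_assoc)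
    ultimately have "inv\<^bsub>\<pi>\<^esub> path_class e \<otimes>\<^bsub>\<pi>\<^esub>
        (path_class e \<otimes>\<^bsub>\<pi>\<^esub> path_class l \<otimes>\<^bsub>\<pi>\<^esub> inv\<^bsub>\<pi>\<^esub> path_class e) \<otimes>\<^bsub>\<pi>\<^esub> path_class e \<in> gc.R"
      using normal.inv_op_closed1[OF gc.R_normal] by simp
    moreover have "inv\<^bsub>\<pi>\<^esub> path_class e \<otimes>\<^bsub>\<pi>\<^esub>
        (path_class e \<otimes>\<^bsub>\<pi>\<^esub> path_class l \<otimes>\<^bsub>\<pi>\<^esub> inv\<^bsub>\<pi>\<^esub> path_class e) \<otimes>\<^bsub>\<pi>\<^esub> path_class e = path_class l"
      using pe pl by (simp add: pi1.m_assoc pi1.inv_solve_left')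
    ultimately show ?thesis by simp
  qed
  then have "tame W" unfolding tame_def by blast
  then show thesis using that W by blast
qed

text \<open>Triples are needed because a path in \<open>V j\<close> will be closed up by paths in
  sets \<open>V i\<close> and \<open>V k\<close> containing its ends, and the resulting loop must
  stay in one tame set.\<close>

lemma finite_tame_cover:
  assumes "\<And>y. y \<in> topspace X \<Longrightarrow> \<exists>U. openin X U \<and> y \<in> U \<and> tame_at y U"
  obtains Y V where "finite Y" "Y \<subseteq> topspace X" "\<And>y. y \<in> Y \<Longrightarrow> openin X (V y)"
    "\<And>y. y \<in> Y \<Longrightarrow> path_connectedin X (V y)" "\<And>y. y \<in> Y \<Longrightarrow> y \<in> V y" "topspace X \<subseteq> (\<Union>y\<in>Y. V y)"
    "\<And>i j k. i \<in> Y \<Longrightarrow> j \<in> Y \<Longrightarrow> k \<in> Y \<Longrightarrow> V i \<inter> V j \<noteq> {} \<Longrightarrow> V j \<inter> V k \<noteq> {} \<Longrightarrow>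
       \<exists>W. path_connectedin X W \<and> tame W \<and> V i \<union> V j \<union> V k \<subseteq> W"
proof -
  \<comment> \<open>The fifth of the radius: if \<open>m\<close> has the largest radius among
    \<open>i\<close>, \<open>j\<close>, \<open>k\<close>, the centres lie within
    \<open>4 * r m / 5\<close> of \<open>m\<close>, since \<open>i\<close> and \<open>k\<close> are
    joined through two overlaps of at most \<open>2 * r m / 5\<close> each. The points of the three
    sets are then within \<open>r m\<close>.\<close>
  have "\<exists>W r V. path_connectedin X W \<and> tame W \<and> 0 < r \<and> mball y r \<subseteq> W \<and>
      openin X V \<and> path_connectedin X V \<and> y \<in> V \<and> V \<subseteq> mball y (r / 5)" if y: "y \<in> topspace X" for y
  proof -
    obtain U where U: "openin X U" "y \<in> U" "tame_at y U" using assms[OF y] by blast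
    obtain W where W: "openin X W" "path_connectedin X W" "y \<in> W" "tame W"
      using tame_neighbourhood[OF U] by metis
    obtain r where r: "r > 0" "mball y r \<subseteq> W" using W(1,3) unfolding X_eq openin_mtopology by blast
    have "openin X (mball y (r / 5))" "y \<in> mball y (r / 5)" using r y by (auto simp: X_eq)
    then obtain V where "openin X V" "path_connectedin X V" "y \<in> V" "V \<subseteq> mball y (r / 5)"
      using lpc unfolding locally_path_connected_space by blast
    then show ?thesis using W r by blast
  qed
  then have "\<forall>y\<in>topspace X. \<exists>t. case t of (W, r, V) \<Rightarrow> path_connectedin X W \<and> tame W \<and> 0 < r \<and> mball y r \<subseteq> W \<and>
      openin X V \<and> path_connectedin X V \<and> y \<in> V \<and> V \<subseteq> mball y (r / 5)" by (simp only: split_paired_Ex prod.case) blast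
  from bchoice[OF this] obtain t where t: "\<forall>y\<in>topspace X. case t y of (W, r, V) \<Rightarrow> path_connectedin X W \<and> tame W \<and> 0 < r \<and> mball y r \<subseteq> W \<and>
      openin X V \<and> path_connectedin X V \<and> y \<in> V \<and> V \<subseteq> mball y (r / 5)" ..
  define W r V where "W y = fst (t y)" and "r y = fst (snd (t y))" and "V y = snd (snd (t y))" for y
  have WrV: "path_connectedin X (W y)" "tame (W y)" "0 < r y" "mball y (r y) \<subseteq> W y"
      "openin X (V y)" "path_connectedin X (V y)" "y \<in> V y" "V y \<subseteq> mball y (r y / 5)" if "y \<in> topspace X" for y
    using bspec[OF t that] by (auto simp: W_def r_def V_def split: prod.splits)
  have "\<exists>\<F>. finite \<F> \<and> \<F> \<subseteq> V ` topspace X \<and> topspace X \<subseteq> \<Union>\<F>"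
  proof -
    have "\<forall>U\<in>V ` topspace X. openin X U" using WrV(5) by blast
    moreover have "topspace X \<subseteq> \<Union>(V ` topspace X)" using WrV(7) by blast
    ultimately show ?thesis
      using compact[unfolded compact_space_alt, THEN spec[of _ "V ` topspace X"]] by blast
  qed
  then obtain \<F> where \<F>: "finite \<F>" "\<F> \<subseteq> V ` topspace X" "topspace X \<subseteq> \<Union>\<F>" by blast
  obtain Y where Y: "Y \<subseteq> topspace X" "finite Y" "\<F> = V ` Y" using finite_subset_image[OF \<F>(1,2)] by blast
  show thesis
  proof (rule that[of Y V])
    show "finite Y" "Y \<subseteq> topspace X" by fact+
    show "topspace X \<subseteq> (\<Union>y\<in>Y. V y)" using \<F>(3) Y(3) by simp
    show "openin X (V y)" "path_connectedin X (V y)" "y \<in> V y" if "y \<in> Y" for y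
      using WrV that Y(1) by blast+
    fix i j k assume ijk: "i \<in> Y" "j \<in> Y" "k \<in> Y" and ne: "V i \<inter> V j \<noteq> {}" "V j \<inter> V k \<noteq> {}"
    have M: "i \<in> M" "j \<in> M" "k \<in> M" using ijk Y(1) topspace_X by auto
    have near: "y \<in> M \<and> d z y < r z / 5" if "z \<in> Y" "y \<in> V z" for y z
    proof -
      have "z \<in> topspace X" using that Y(1) by blast
      then have "y \<in> mball z (r z / 5)" using WrV(8) that by blast
      then show ?thesis by simp
    qed
    obtain a where a: "a \<in> V i" "a \<in> V j" using ne(1) by blast
    obtain b where b: "b \<in> V j" "b \<in> V k" using ne(2) by blast
    have ij: "d i j < (r i + r j) / 5"
      using triangle[of i a j] near[OF ijk(1) a(1)] near[OF ijk(2) a(2)] commute[of j a] M by auto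
    have jk: "d j k < (r j + r k) / 5"
      using triangle[of j b k] near[OF ijk(2) b(1)] near[OF ijk(3) b(2)] commute[of k b] M by auto
    have ik: "d i k \<le> d i j + d j k" using triangle M by blast
    obtain m where m: "m \<in> {i, j, k}" "r i \<le> r m" "r j \<le> r m" "r k \<le> r m"
    proof -
      have "\<exists>m\<in>{i, j, k}. r i \<le> r m \<and> r j \<le> r m \<and> r k \<le> r m"
        by (cases "r i \<le> r j"; cases "r j \<le> r k"; cases "r i \<le> r k") auto
      then show thesis using that by blast
    qed
    have rp: "0 < r i" "0 < r j" "0 < r k" using WrV(3) ijk Y(1) by auto
    have "d m z < 4 * r m / 5" if "m \<in> {i, j, k}" "z \<in> {i, j, k}" for z
      using that m(2-4) ij jk ik rp M commute[of i j] commute[of j k] commute[of i k]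
        zero[of i i] zero[of j j] zero[of k k]
      by auto
    then have dm: "d m z < 4 * r m / 5" if "z \<in> {i, j, k}" for z using m(1) that by blast
    have "V z \<subseteq> W m" if z: "z \<in> {i, j, k}" for z
    proof
      fix y assume y: "y \<in> V z"
      have zY: "z \<in> Y" "m \<in> Y" using z m(1) ijk by auto
      have "d m y \<le> d m z + d z y" using triangle[of m z y] near[OF zY(1) y] zY Y(1) topspace_X by blast
      also have "\<dots> < 4 * r m / 5 + r m / 5"
        using dm[OF z] near[OF zY(1) y] m(2-4) z by auto
      finally have "y \<in> mball m (r m)" using near[OF zY(1) y] zY Y(1) topspace_X by auto
      then show "y \<in> W m" using WrV(4)[of m] zY Y(1) by blast
    qed
    moreover have "path_connectedin X (W m)" "tame (W m)"
      using WrV(1,2)[of m] m(1) ijk Y(1) by auto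
    ultimately show "\<exists>W. path_connectedin X W \<and> tame W \<and> V i \<union> V j \<union> V k \<subseteq> W" by blast
  qed
qed

text \<open>If small loops lie in the radical, every loop is, modulo the radical, a product of finitely many
  fixed path classes between the centres of a finite cover.\<close>

lemma finite_determining_set:
  assumes tame: "\<And>y. y \<in> topspace X \<Longrightarrow> \<exists>U. openin X U \<and> y \<in> U \<and> tame_at y U"
    and T: "char_group T q"
  shows "\<exists>F. F \<subseteq> carrier \<pi> \<and> finite F \<and>
    (\<forall>f\<in>hom \<pi> T. (\<forall>a\<in>F. f a = \<one>\<^bsub>T\<^esub>) \<longrightarrow> (\<forall>a\<in>carrier \<pi>. f a = \<one>\<^bsub>T\<^esub>))"
proof -
  interpret T: char_group T q by (rule T)
  obtain Y V where Y: "finite Y" "Y \<subseteq> topspace X" and V: "\<And>y. y \<in> Y \<Longrightarrow> openin X (V y)"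
    "\<And>y. y \<in> Y \<Longrightarrow> path_connectedin X (V y)" "\<And>y. y \<in> Y \<Longrightarrow> y \<in> V y" "topspace X \<subseteq> (\<Union>y\<in>Y. V y)"
    and triple: "\<And>i j k. i \<in> Y \<Longrightarrow> j \<in> Y \<Longrightarrow> k \<in> Y \<Longrightarrow> V i \<inter> V j \<noteq> {} \<Longrightarrow> V j \<inter> V k \<noteq> {} \<Longrightarrow>
       \<exists>W. path_connectedin X W \<and> tame W \<and> V i \<union> V j \<union> V k \<subseteq> W"
    using finite_tame_cover[OF tame] by metis
  define Q where "Q i j k c W \<longleftrightarrow> path_connectedin X W \<and> tame W \<and> V i \<union> V j \<union> V k \<subseteq> W \<and>
    pathin X c \<and> c ` {0..1} \<subseteq> W \<and> c 0 = i \<and> c 1 = k" for i j k c W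
  \<comment> \<open>A path between the outer centres inside a tame set containing the triple. The
    classes of these finitely many paths form the determining set.\<close>
  define c where "c i j k = (SOME c. \<exists>W. Q i j k c W)" for i j k
  have c: "\<exists>W. Q i j k (c i j k) W"
    if ijk: "i \<in> Y" "j \<in> Y" "k \<in> Y" "V i \<inter> V j \<noteq> {}" "V j \<inter> V k \<noteq> {}" for i j k
  proof -
    obtain W where W: "path_connectedin X W" "tame W" "V i \<union> V j \<union> V k \<subseteq> W" using triple[OF ijk] by blast
    have "i \<in> W" "k \<in> W" using W(3) V(3) ijk by blast+
    then obtain c' where "pathin X c'" "c' ` {0..1} \<subseteq> W" "c' 0 = i" "c' 1 = k"
      using path_in_set[OF W(1)] by metis
    then have "\<exists>c W. Q i j k c W" unfolding Q_def using W by blast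
    then show ?thesis unfolding c_def by (rule someI_ex)
  qed
  define F where "F = (\<lambda>(i, j, k). path_class (c i j k)) `
    {(i, j, k) \<in> Y \<times> Y \<times> Y. V i \<inter> V j \<noteq> {} \<and> V j \<inter> V k \<noteq> {}}"
  have "\<forall>u\<in>topspace X. \<exists>i e. i \<in> Y \<and> u \<in> V i \<and> pathin X e \<and> e ` {0..1} \<subseteq> V i \<and> e 0 = i \<and> e 1 = u"
  proof
    fix u assume "u \<in> topspace X"
    then obtain i where i: "i \<in> Y" "u \<in> V i" using V(4) by blast
    then obtain e where "pathin X e" "e ` {0..1} \<subseteq> V i" "e 0 = i" "e 1 = u"
      using path_in_set[OF V(2)[OF i(1)] V(3)[OF i(1)]] by metis
    then show "\<exists>i e. i \<in> Y \<and> u \<in> V i \<and> pathin X e \<and> e ` {0..1} \<subseteq> V i \<and> e 0 = i \<and> e 1 = u" using i by blast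
  qed
  from bchoice[OF this] obtain ii where
    "\<forall>u\<in>topspace X. \<exists>e. ii u \<in> Y \<and> u \<in> V (ii u) \<and> pathin X e \<and> e ` {0..1} \<subseteq> V (ii u) \<and> e 0 = ii u \<and> e 1 = u" ..
  from bchoice[OF this] obtain ee where
    ie: "\<forall>u\<in>topspace X. ii u \<in> Y \<and> u \<in> V (ii u) \<and> pathin X (ee u) \<and> ee u ` {0..1} \<subseteq> V (ii u) \<and>
      ee u 0 = ii u \<and> ee u 1 = u" ..
  have "f a = \<one>\<^bsub>T\<^esub>" if f: "f \<in> hom \<pi> T" and fF: "\<And>a. a \<in> F \<Longrightarrow> f a = \<one>\<^bsub>T\<^esub>" and a: "a \<in> carrier \<pi>" for f a
  proof -
    interpret f: group_hom \<pi> T f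
      by (intro group_hom.intro group_hom_axioms.intro pi1.group_axioms T.group_axioms f)
    define D where "D c = f (path_class c)" for c
    have Dc: "D c \<in> carrier T" if "pathin X c" for c using that by (simp add: D_def)
    have D_concat: "D (loop_concat c c') = D c \<otimes>\<^bsub>T\<^esub> D c'" if "pathin X c" "pathin X c'" "c 1 = c' 0" for c c'
      using that by (simp add: D_def path_class_concat)
    have D_rev: "D (rev_path c) = inv\<^bsub>T\<^esub> D c" if "pathin X c" for c
      using that by (simp add: D_def path_class_rev)
    have D_tame: "D l = \<one>\<^bsub>T\<^esub>" if "tame W" "pathin X l" "l 0 = l 1" "l ` {0..1} \<subseteq> W" for l W
      using that gc.hom_kills_R[OF T f] unfolding tame_def D_def by blast
    define e where "e u = D (ee u)" for u
    have ec: "e u \<in> carrier T" if "u \<in> topspace X" for u using ie that Dc by (simp add: e_def)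
    \<comment> \<open>Closed up by \<open>ee u\<close>, \<open>ee v\<close> and
      \<open>c i j k\<close>, the path \<open>g\<close> becomes a loop in a tame set, on which
      \<open>f\<close> is trivial; \<open>f\<close> is trivial on \<open>c i j k\<close> as well. So
      on small paths \<open>D\<close> is the coboundary of \<open>e\<close>, and on a closed path a
      coboundary is trivial.\<close>
    have small: "D g = inv\<^bsub>T\<^esub> e (g 0) \<otimes>\<^bsub>T\<^esub> e (g 1)"
      if g: "pathin X g" and j: "j \<in> Y" and gj: "g ` {0..1} \<subseteq> V j" for g j
    proof -
      define u v where "u = g 0" and "v = g 1"
      have uv: "u \<in> topspace X" "v \<in> topspace X" "u \<in> V j" "v \<in> V j"
        using ends_in[OF g] gj by (auto simp: u_def v_def)
      define i k where "i = ii u" and "k = ii v"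
      have u: "i \<in> Y" "u \<in> V i" "pathin X (ee u)" "ee u ` {0..1} \<subseteq> V i" "ee u 0 = i" "ee u 1 = u"
        and v: "k \<in> Y" "v \<in> V k" "pathin X (ee v)" "ee v ` {0..1} \<subseteq> V k" "ee v 0 = k" "ee v 1 = v"
        using ie uv by (auto simp: i_def k_def)
      have ne: "V i \<inter> V j \<noteq> {}" "V j \<inter> V k \<noteq> {}" using u v uv by blast+
      obtain W where W: "Q i j k (c i j k) W" using c[OF u(1) j v(1) ne] by blast
      have cc: "tame W" "V i \<union> V j \<union> V k \<subseteq> W" "pathin X (c i j k)" "c i j k ` {0..1} \<subseteq> W"
        "c i j k 0 = i" "c i j k 1 = k" using W unfolding Q_def by auto
      let ?r = "loop_concat (rev_path (ee v)) (rev_path (c i j k))"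
      let ?l = "loop_concat (ee u) (loop_concat g ?r)"
      have r: "pathin X ?r" "?r 0 = v" "?r 1 = i" using v cc by auto
      have gr: "pathin X (loop_concat g ?r)" "loop_concat g ?r 0 = u" "loop_concat g ?r 1 = i"
        using r g by (auto simp: u_def v_def)
      have l: "pathin X ?l" "?l 0 = ?l 1" using gr u by auto
      have "?l ` {0..1} \<subseteq> W"
      proof -
        have "?r ` {0..1} \<subseteq> W"
          using image_loop_concat[of "rev_path (ee v)" "rev_path (c i j k)"] v(4) cc(2,4)
          unfolding image_rev_path by (meson Un_least le_sup_iff subset_trans)
        moreover have "g ` {0..1} \<subseteq> W" "ee u ` {0..1} \<subseteq> W" using gj u(4) cc(2) by blast+
        ultimately show ?thesis
          using image_loop_concat[of "ee u" "loop_concat g ?r"] image_loop_concat[of g ?r]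
          by (meson Un_least subset_trans)
      qed
      then have "D ?l = \<one>\<^bsub>T\<^esub>" using D_tame[OF cc(1) l] by blast
      moreover have "D ?l = e u \<otimes>\<^bsub>T\<^esub> (D g \<otimes>\<^bsub>T\<^esub> (inv\<^bsub>T\<^esub> e v \<otimes>\<^bsub>T\<^esub> inv\<^bsub>T\<^esub> D (c i j k)))"
        using u v cc g r gr by (simp add: D_concat D_rev e_def u_def v_def)
      moreover have "path_class (c i j k) \<in> F" unfolding F_def using u v j ne by blast
      then have "D (c i j k) = \<one>\<^bsub>T\<^esub>" using fF by (simp add: D_def)
      ultimately have eq: "e u \<otimes>\<^bsub>T\<^esub> (D g \<otimes>\<^bsub>T\<^esub> inv\<^bsub>T\<^esub> e v) = \<one>\<^bsub>T\<^esub>" using ec uv by simp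
      have cl: "e u \<in> carrier T" "e v \<in> carrier T" "D g \<in> carrier T" using ec uv Dc g by auto
      have "D g = inv\<^bsub>T\<^esub> e u \<otimes>\<^bsub>T\<^esub> (e u \<otimes>\<^bsub>T\<^esub> (D g \<otimes>\<^bsub>T\<^esub> inv\<^bsub>T\<^esub> e v)) \<otimes>\<^bsub>T\<^esub> e v"
        using cl by (simp add: T.m_assoc, simp flip: T.m_assoc)
      then show ?thesis using eq cl by (simp add: u_def v_def)
    qed
    obtain g where g: "g \<in> loops_at X x0" "a = loop_class X x0 g" using a by (rule carrier_fundamental_groupE)
    have gp: "pathin X g" "g 0 = x0" "g 1 = x0" using g(1) by (auto simp: loops_at_def)
    have gt: "g t \<in> topspace X" if "0 \<le> t" "t \<le> 1" for t using pathin_mem[OF gp(1) that] .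
    \<comment> \<open>The intervals in the local case of \<open>Bolzano\<close> may leave the unit
      interval; the implication makes \<open>Z\<close> hold for those.\<close>
    define Z where "Z a b \<longleftrightarrow> (0 \<le> a \<and> a \<le> b \<and> b \<le> 1 \<longrightarrow> D (subpath a b g) = inv\<^bsub>T\<^esub> e (g a) \<otimes>\<^bsub>T\<^esub> e (g b))" for a b
    have "(0::real) \<le> 1" by simp
    then have "Z 0 1"
    proof (induction rule: Bolzano)
      case (trans a b c)
      show ?case
        unfolding Z_def
      proof
        assume "0 \<le> a \<and> a \<le> c \<and> c \<le> 1"
        then have ab: "0 \<le> a" "a \<le> b" "b \<le> c" "c \<le> 1" using trans by auto
        have p: "pathin X (subpath a b g)" "pathin X (subpath b c g)" using ab by (auto intro!: pathin_subpath gp)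
        have cl: "e (g a) \<in> carrier T" "e (g b) \<in> carrier T" "e (g c) \<in> carrier T" using ab by (auto intro!: ec gt)
        have "D (subpath a c g) = D (loop_concat (subpath a b g) (subpath b c g))"
          unfolding D_def using path_class_cong[OF subpath_concat[OF gp(1) ab]] by simp
        also have "\<dots> = D (subpath a b g) \<otimes>\<^bsub>T\<^esub> D (subpath b c g)" using p by (simp add: D_concat)
        also have "\<dots> = (inv\<^bsub>T\<^esub> e (g a) \<otimes>\<^bsub>T\<^esub> e (g b)) \<otimes>\<^bsub>T\<^esub> (inv\<^bsub>T\<^esub> e (g b) \<otimes>\<^bsub>T\<^esub> e (g c))"
          using trans ab unfolding Z_def by auto
        also have "\<dots> = inv\<^bsub>T\<^esub> e (g a) \<otimes>\<^bsub>T\<^esub> ((e (g b) \<otimes>\<^bsub>T\<^esub> inv\<^bsub>T\<^esub> e (g b)) \<otimes>\<^bsub>T\<^esub> e (g c))"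
          using cl by (simp only: T.m_assoc T.inv_closed T.m_closed)
        also have "\<dots> = inv\<^bsub>T\<^esub> e (g a) \<otimes>\<^bsub>T\<^esub> e (g c)" using cl by simp
        finally show "D (subpath a c g) = inv\<^bsub>T\<^esub> e (g a) \<otimes>\<^bsub>T\<^esub> e (g c)" .
      qed
    next
      case (local x)
      obtain j where j: "j \<in> Y" "g x \<in> V j" using gt[OF local] V(4) by blast
      have "openin (top_of_set {0..1}) {t \<in> {0..1}. g t \<in> V j}"
        using openin_continuous_map_preimage[OF gp(1)[unfolded pathin_def] V(1)[OF j(1)]] by simp
      moreover have "x \<in> {t \<in> {0..1}. g t \<in> V j}" using local j by simp
      ultimately obtain r where r: "r > 0" "ball x r \<inter> {0..1} \<subseteq> {t \<in> {0..1}. g t \<in> V j}"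
        unfolding openin_contains_ball by blast
      have "Z a b" if ab: "a \<le> x \<and> x \<le> b \<and> b - a < r" for a b
        unfolding Z_def
      proof
        assume ab': "0 \<le> a \<and> a \<le> b \<and> b \<le> 1"
        have "{a..b} \<subseteq> ball x r \<inter> {0..1}" using ab ab' by (auto simp: dist_real_def)
        then have "g ` {a..b} \<subseteq> V j" using r(2) by blast
        then have "subpath a b g ` {0..1} \<subseteq> V j" using image_subpath[of a b g] ab' by (meson subset_trans)
        then show "D (subpath a b g) = inv\<^bsub>T\<^esub> e (g a) \<otimes>\<^bsub>T\<^esub> e (g b)"
          using small[OF pathin_subpath[OF gp(1)] j(1)] ab' by simp
      qed
      then show ?case using r(1) by blast
    qed
    then have "D (subpath 0 1 g) = \<one>\<^bsub>T\<^esub>" using ec x0 by (simp add: Z_def gp)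
    moreover have "subpath 0 1 g = g" by (simp add: subpath_def)
    ultimately show "f a = \<one>\<^bsub>T\<^esub>" using path_class_loop[OF g(1)] g(2) by (simp add: D_def)
  qed
  moreover have "finite F" unfolding F_def using Y(1) by (intro finite_imageI) (auto intro: finite_subset[of _ "Y \<times> Y \<times> Y"])
  moreover have "F \<subseteq> carrier \<pi>"
  proof
    fix a assume "a \<in> F"
    then obtain i j k where ijk: "i \<in> Y" "j \<in> Y" "k \<in> Y" "V i \<inter> V j \<noteq> {}" "V j \<inter> V k \<noteq> {}" "a = path_class (c i j k)"
      unfolding F_def by blast
    then show "a \<in> carrier \<pi>" using c[OF ijk(1-5)] unfolding Q_def by auto
  qed
  ultimately show ?thesis by (intro exI[of _ F]) simp
qed

end

section \<open>Infinite concatenation of loops\<close>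

text \<open>Finite approximations of the infinite concatenation of the loops \<open>u 0, u 1, \<dots>\<close>, the \<open>n\<close>-th of
  which is traversed on \<open>[1 - 1/2^n, 1 - 1/2^(n+1)]\<close>.\<close>

fun fin_concat :: "'a \<Rightarrow> nat \<Rightarrow> (nat \<Rightarrow> real \<Rightarrow> 'a) \<Rightarrow> real \<Rightarrow> 'a" where
  "fin_concat y 0 u = (\<lambda>_. y)"
| "fin_concat y (Suc n) u = loop_concat (u 0) (fin_concat y n (\<lambda>i. u (Suc i)))"

definition inf_concat :: "'a \<Rightarrow> (nat \<Rightarrow> real \<Rightarrow> 'a) \<Rightarrow> real \<Rightarrow> 'a" where
  "inf_concat y u t = (if t < 1 then fin_concat y (LEAST n. t \<le> 1 - 1 / 2 ^ n) u t else y)"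

lemma fin_concat_local:
  "(\<And>i. i < n \<Longrightarrow> u i = u' i) \<Longrightarrow> fin_concat y n u = fin_concat y n u'"
proof (induction n arbitrary: u u')
  case (Suc n)
  have "fin_concat y n (\<lambda>i. u (Suc i)) = fin_concat y n (\<lambda>i. u' (Suc i))"
    using Suc.prems by (intro Suc.IH) simp
  moreover have "u 0 = u' 0" using Suc.prems by simp
  ultimately show ?case by simp
qed simp

lemma fin_concat_stable:
  assumes "n \<le> m" "0 \<le> t" "t \<le> 1 - 1 / 2 ^ n" "\<And>i. u i 0 = y"
  shows "fin_concat y m u t = fin_concat y n u t"
  using assms
proof (induction n arbitrary: m t u)
  case 0
  then have "t = 0" by simp
  then show ?case using 0(4) by (cases m) simp_all
next
  case (Suc n)
  then obtain m' where m: "m = Suc m'" "n \<le> m'" by (cases m) auto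
  show ?case
  proof (cases "t \<le> 1/2")
    case True then show ?thesis by (simp add: m loop_concat_def)
  next
    case False
    have "2 * t - 1 \<le> 1 - 1 / 2 ^ n" using Suc.prems(3) by (simp add: field_simps)
    then show ?thesis
      using False Suc.IH[OF m(2), of "2 * t - 1" "\<lambda>i. u (Suc i)"] Suc.prems(4) by (simp add: m loop_concat_def)
  qed
qed

lemma fin_concat_past:
  assumes "1 - 1 / 2 ^ n < t" shows "fin_concat y n u t = y"
  using assms
proof (induction n arbitrary: t u)
  case (Suc n)
  have "\<not> t \<le> 1/2"
  proof
    assume "t \<le> 1/2"
    moreover have "(1::real) / 2 ^ Suc n \<le> 1 / 2" by (simp add: field_simps)
    ultimately show False using Suc.prems by linarith
  qed
  moreover have "1 - 1 / 2 ^ n < 2 * t - 1" using Suc.prems by (simp add: field_simps)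
  ultimately show ?case using Suc.IH by (simp add: loop_concat_def)
qed simp

lemma exists_dyadic: assumes "t < (1::real)" shows "\<exists>n. t \<le> 1 - 1 / 2 ^ n"
proof -
  obtain n where "(1/2) ^ n < 1 - t" using real_arch_pow_inv[of "1 - t" "1/2"] assms by auto
  then have "t \<le> 1 - 1 / 2 ^ n" by (simp add: power_one_over)
  then show ?thesis ..
qed

lemma inf_concat_eq:
  assumes "0 \<le> t" "t < 1" "t \<le> 1 - 1 / 2 ^ m" "\<And>i. u i 0 = y"
  shows "inf_concat y u t = fin_concat y m u t"
proof -
  let ?n = "LEAST n. t \<le> 1 - 1 / 2 ^ n"
  have "t \<le> 1 - 1 / 2 ^ ?n" using exists_dyadic[OF assms(2)] by (rule LeastI_ex)
  moreover have "?n \<le> m" using assms(3) by (rule Least_le)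
  ultimately show ?thesis
    using fin_concat_stable[of ?n m t u y] assms by (simp add: inf_concat_def)
qed

lemma inf_concat_1 [simp]: "inf_concat y u 1 = y"
  by (simp add: inf_concat_def)

lemma inf_concat_0: "(\<And>i. u i 0 = y) \<Longrightarrow> inf_concat y u 0 = y"
  using inf_concat_eq[of 0 0 u y] by simp

lemma inf_concat_unfold:
  assumes "t \<in> {0..1}" "\<And>i. u i 0 = y"
  shows "inf_concat y u t = loop_concat (u 0) (inf_concat y (\<lambda>i. u (Suc i))) t"
proof (cases "t = 1")
  case False
  then have t: "0 \<le> t" "t < 1" using assms(1) by auto
  obtain n where n: "t \<le> 1 - 1 / 2 ^ n" using exists_dyadic[OF t(2)] by blast
  have "(1::real) / 2 ^ Suc n \<le> 1 / 2 ^ n" by (simp add: field_simps)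
  then have n': "t \<le> 1 - 1 / 2 ^ Suc n" using n by linarith
  have eq: "inf_concat y u t = fin_concat y (Suc n) u t" using inf_concat_eq[of t "Suc n" u y] t n' assms(2) by blast
  show ?thesis
  proof (cases "t \<le> 1/2")
    case True then show ?thesis by (simp add: eq loop_concat_def)
  next
    case False
    have "inf_concat y (\<lambda>i. u (Suc i)) (2 * t - 1) = fin_concat y n (\<lambda>i. u (Suc i)) (2 * t - 1)"
      using False t n' by (intro inf_concat_eq assms(2)) (auto simp: field_simps)
    then show ?thesis using False by (simp add: eq loop_concat_def)
  qed
qed simp

text \<open>For \<open>t < 1\<close> the value is that of one finite stage, and from 1 on it is
  \<open>y\<close>; no limit is involved. This makes the test loops eventually constant at each time
  when their codes converge.\<close>

lemma inf_concat_local: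
  "\<exists>N. \<forall>u u'. (\<forall>i<N. u i = u' i) \<longrightarrow> inf_concat y u t = inf_concat y u' t"
proof (intro exI allI impI)
  fix u u' :: "nat \<Rightarrow> real \<Rightarrow> 'a"
  assume "\<forall>i<(LEAST n. t \<le> 1 - 1 / 2 ^ n). u i = u' i"
  then have "fin_concat y (LEAST n. t \<le> 1 - 1 / 2 ^ n) u = fin_concat y (LEAST n. t \<le> 1 - 1 / 2 ^ n) u'"
    by (intro fin_concat_local) simp
  then show "inf_concat y u t = inf_concat y u' t" by (simp add: inf_concat_def)
qed

text \<open>After time \<open>1 - 1 / 2 ^ n\<close> only the loops from the \<open>n\<close>-th on
  are visible, which gives continuity at 1 once the loops shrink.\<close>

lemma inf_concat_tail:
  assumes "t \<in> {0..1}" "1 - 1 / 2 ^ n < t" "\<And>i. u i 0 = y"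
  shows "inf_concat y u t \<in> {y} \<union> (\<Union>i\<in>{n..}. u i ` {0..1})"
  using assms
proof (induction n arbitrary: t u)
  case 0
  show ?case
  proof (cases "t = 1")
    case False
    then have t: "0 \<le> t" "t < 1" using 0 by auto
    obtain n where n: "t \<le> 1 - 1 / 2 ^ n" using exists_dyadic[OF t(2)] by blast
    have "fin_concat y n u t \<in> {y} \<union> (\<Union>i. u i ` {0..1})"
      using t(1) t(2)[THEN less_imp_le]
    proof (induction n arbitrary: t u)
      case (Suc n)
      show ?case
      proof (cases "t \<le> 1/2")
        case True
        then have "fin_concat y (Suc n) u t \<in> u 0 ` {0..1}" using Suc.prems by (auto simp: loop_concat_def)
        then show ?thesis by blast
      next
        case False
        then have "fin_concat y (Suc n) u t \<in> {y} \<union> (\<Union>i. u (Suc i) ` {0..1})"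
          using Suc.IH[of "2 * t - 1" "\<lambda>i. u (Suc i)"] Suc.prems by (simp add: loop_concat_def)
        then show ?thesis by blast
      qed
    qed simp
    then show ?thesis using inf_concat_eq[of t n u y] t n 0(3) by simp
  qed simp
next
  case (Suc n)
  have t2: "\<not> t \<le> 1/2"
  proof
    assume "t \<le> 1/2"
    moreover have "(1::real) / 2 ^ Suc n \<le> 1 / 2" by (simp add: field_simps)
    ultimately show False using Suc.prems(2) by linarith
  qed
  have "1 - 1 / 2 ^ n < 2 * t - 1" using Suc.prems by (simp add: field_simps)
  then have "inf_concat y (\<lambda>i. u (Suc i)) (2 * t - 1) \<in> {y} \<union> (\<Union>i\<in>{n..}. u (Suc i) ` {0..1})"
    using Suc.prems t2 by (intro Suc.IH) auto
  moreover have "inf_concat y u t = inf_concat y (\<lambda>i. u (Suc i)) (2 * t - 1)"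
    using inf_concat_unfold[of t u y] Suc.prems(1,3) t2 by (simp add: loop_concat_def)
  moreover have "(\<Union>i\<in>{n..}. u (Suc i) ` {0..1}) \<subseteq> (\<Union>i\<in>{Suc n..}. u i ` {0..1})"
  proof (rule UN_least)
    fix i assume "i \<in> {n..}"
    then have "Suc i \<in> {Suc n..}" by simp
    then show "u (Suc i) ` {0..1} \<subseteq> (\<Union>i\<in>{Suc n..}. u i ` {0..1})" by (rule UN_upper)
  qed
  ultimately show ?case by auto
qed

context peano
begin

section \<open>Null sequences of loops\<close>

definition null_loops :: "'a \<Rightarrow> (nat \<Rightarrow> real \<Rightarrow> 'a) \<Rightarrow> bool" where
  "null_loops y u \<longleftrightarrow> y \<in> M \<and> (\<forall>i. pathin X (u i) \<and> u i 0 = y \<and> u i 1 = y) \<and>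
     (\<forall>\<epsilon>>0. \<exists>n. \<forall>i\<ge>n. u i ` {0..1} \<subseteq> mball y \<epsilon>)"

lemma null_loops_Suc: assumes "null_loops y u" shows "null_loops y (\<lambda>i. u (Suc i))"
  unfolding null_loops_def
proof (intro conjI allI impI)
  fix \<epsilon> :: real assume "\<epsilon> > 0"
  then obtain n where "\<forall>i\<ge>n. u i ` {0..1} \<subseteq> mball y \<epsilon>" using assms unfolding null_loops_def by blast
  then have "\<forall>i\<ge>n. u (Suc i) ` {0..1} \<subseteq> mball y \<epsilon>" by simp
  then show "\<exists>n. \<forall>i\<ge>n. u (Suc i) ` {0..1} \<subseteq> mball y \<epsilon>" ..
qed (use assms in \<open>auto simp: null_loops_def\<close>)

lemma fin_concat_loop:
  assumes "null_loops y u"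
  shows "pathin X (fin_concat y n u) \<and> fin_concat y n u 0 = y \<and> fin_concat y n u 1 = y"
  using assms
proof (induction n arbitrary: u)
  case 0 then show ?case by (simp add: null_loops_def topspace_X)
next
  case (Suc n)
  then show ?case using Suc.IH[OF null_loops_Suc[OF Suc.prems]] by (auto simp: null_loops_def)
qed

text \<open>The finite stages converge uniformly. Stage \<open>n\<close> agrees with the limit up to
  \<open>1 - 1 / 2 ^ n\<close>; afterwards it rests at \<open>y\<close> while the limit only runs
  through loops close to \<open>y\<close>.\<close>

lemma pathin_inf_concat:
  assumes u: "null_loops y u" shows "pathin X (inf_concat y u)"
proof -
  have u0: "u i 0 = y" for i using u by (simp add: null_loops_def)
  have y: "y \<in> M" using u by (simp add: null_loops_def)
  have "continuous_map (top_of_set {0..1}) mtopology (inf_concat y u)"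
  proof (rule continuous_map_uniform_limit[where F = sequentially])
    show "\<forall>\<^sub>F n in sequentially. continuous_map (top_of_set {0..1}) mtopology (fin_concat y n u)"
      using fin_concat_loop[OF u] by (simp add: pathin_def X_eq)
    fix \<epsilon> :: real assume \<epsilon>: "0 < \<epsilon>"
    obtain N where N: "\<And>i. i \<ge> N \<Longrightarrow> u i ` {0..1} \<subseteq> mball y \<epsilon>"
      using u \<epsilon> unfolding null_loops_def by meson
    have "inf_concat y u t \<in> M \<and> d (fin_concat y n u t) (inf_concat y u t) < \<epsilon>"
      if n: "n \<ge> N" and t: "t \<in> {0..1}" for n t
    proof (cases "t \<le> 1 - 1 / 2 ^ n")
      case True
      then have "t < 1" by (smt (verit) divide_pos_pos zero_less_power)
      then have "inf_concat y u t = fin_concat y n u t" using True t by (intro inf_concat_eq u0) auto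
      moreover have "fin_concat y n u t \<in> M"
        using fin_concat_loop[OF u] pathin_mem[of X _ t] t topspace_X by auto
      ultimately show ?thesis using \<epsilon> by simp
    next
      case False
      then have "inf_concat y u t \<in> {y} \<union> (\<Union>i\<in>{n..}. u i ` {0..1})"
        using inf_concat_tail[of t n u y] t u0 by simp
      moreover have "(\<Union>i\<in>{n..}. u i ` {0..1}) \<subseteq> mball y \<epsilon>"
      proof (rule UN_least)
        fix i assume "i \<in> {n..}"
        then show "u i ` {0..1} \<subseteq> mball y \<epsilon>" using N[of i] n by simp
      qed
      moreover have "{y} \<subseteq> mball y \<epsilon>" using y \<epsilon> by simp
      ultimately have "inf_concat y u t \<in> mball y \<epsilon>" by (meson Un_least subsetD)
      then show ?thesis using fin_concat_past[of n t y u] False by simp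
    qed
    then show "\<forall>\<^sub>F n in sequentially. \<forall>t\<in>topspace (top_of_set {0..1}).
        inf_concat y u t \<in> M \<and> d (fin_concat y n u t) (inf_concat y u t) < \<epsilon>"
      unfolding eventually_sequentially by (intro exI[of _ N]) simp
  qed simp
  then show ?thesis by (simp add: pathin_def X_eq)
qed

lemma path_class_inf_concat:
  assumes u: "null_loops y u"
  shows "path_class (inf_concat y u) =
    path_class (u 0) \<otimes>\<^bsub>\<pi>\<^esub> path_class (inf_concat y (\<lambda>i. u (Suc i)))"
proof -
  have u0: "u i 0 = y" "u i 1 = y" "pathin X (u i)" for i using u by (auto simp: null_loops_def)
  have "path_class (inf_concat y u) = path_class (loop_concat (u 0) (inf_concat y (\<lambda>i. u (Suc i))))"
    by (rule path_class_cong[OF pathhom_eq[OF pathin_inf_concat[OF u]]], rule inf_concat_unfold) (assumption, rule u0)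
  then show ?thesis
    using pathin_inf_concat[OF null_loops_Suc[OF u]] u0 by (simp add: path_class_concat inf_concat_0)
qed

section \<open>Path classes modulo the radical\<close>

definition theta :: "(real \<Rightarrow> 'a) \<Rightarrow> (real \<Rightarrow> 'a) set set" where
  "theta c = gc.R #>\<^bsub>\<pi>\<^esub> path_class c"

sublocale quot: char_group gc.A q by (rule gc.A_char_group)

lemma theta_closed: "pathin X c \<Longrightarrow> theta c \<in> carrier gc.A"
  by (simp add: theta_def gc.proj.hom_closed)

lemma theta_inf_concat:
  assumes u: "null_loops y u"
  shows "theta (inf_concat y u) = theta (u 0) \<otimes>\<^bsub>gc.A\<^esub> theta (inf_concat y (\<lambda>i. u (Suc i)))"
proof -
  have "pathin X (u 0)" using u by (simp add: null_loops_def)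
  then show ?thesis
    using pathin_inf_concat[OF null_loops_Suc[OF u]]
    by (simp only: theta_def path_class_inf_concat[OF u] gc.proj.hom_mult path_class_closed)
qed

text \<open>The first \<open>m\<close> loops split off as common factors, and after the
  \<open>m\<close>-th the two concatenations coincide. The quotient is abelian, so the comparison
  can be stated by cross multiplication. No infinite product in the group is needed.\<close>

lemma theta_inf_concat_update:
  assumes "null_loops y u" "null_loops y u'" "\<And>i. i \<noteq> m \<Longrightarrow> u i = u' i"
  shows "theta (inf_concat y u) \<otimes>\<^bsub>gc.A\<^esub> theta (u' m) = theta (inf_concat y u') \<otimes>\<^bsub>gc.A\<^esub> theta (u m)"
  using assms
proof (induction m arbitrary: u u')
  case 0
  have cl: "theta (u 0) \<in> carrier gc.A" "theta (u' 0) \<in> carrier gc.A"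
    using 0 by (auto simp: null_loops_def intro: theta_closed)
  have "theta (inf_concat y (\<lambda>i. u (Suc i))) \<in> carrier gc.A"
    using 0 by (intro theta_closed pathin_inf_concat null_loops_Suc)
  moreover have "(\<lambda>i. u (Suc i)) = (\<lambda>i. u' (Suc i))" using 0(3) by auto
  ultimately show ?case
    using cl by (simp add: theta_inf_concat[OF 0(1)] theta_inf_concat[OF 0(2)] quot.m_ac del: mult_FactGroup)
next
  case (Suc m)
  have cl: "theta (u i) \<in> carrier gc.A" "theta (u' i) \<in> carrier gc.A" for i
    using Suc.prems by (auto simp: null_loops_def intro: theta_closed)
  have cl': "theta (inf_concat y (\<lambda>i. u (Suc i))) \<in> carrier gc.A"
    "theta (inf_concat y (\<lambda>i. u' (Suc i))) \<in> carrier gc.A"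
    using theta_closed[OF pathin_inf_concat[OF null_loops_Suc]] Suc.prems(1,2) by blast+
  have IH: "theta (inf_concat y (\<lambda>i. u (Suc i))) \<otimes>\<^bsub>gc.A\<^esub> theta (u' (Suc m)) =
      theta (inf_concat y (\<lambda>i. u' (Suc i))) \<otimes>\<^bsub>gc.A\<^esub> theta (u (Suc m))"
    using Suc.IH[OF null_loops_Suc[OF Suc.prems(1)] null_loops_Suc[OF Suc.prems(2)]] Suc.prems(3) by simp
  have "u 0 = u' 0" using Suc.prems(3) by simp
  then show ?case
    using cl cl' IH
    by (simp add: theta_inf_concat[OF Suc.prems(1)] theta_inf_concat[OF Suc.prems(2)] gc.proj.H.m_assoc del: mult_FactGroup)
qed

lemma theta_eq_one_iff: "pathin X c \<Longrightarrow> theta c = \<one>\<^bsub>gc.A\<^esub> \<longleftrightarrow> path_class c \<in> gc.R"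
  using gc.R_mem_iff[of "path_class c"] by (simp add: theta_def)

lemma theta_const: "y \<in> M \<Longrightarrow> theta (\<lambda>_. y) = \<one>\<^bsub>gc.A\<^esub>"
  using gc.proj.hom_one by (simp add: theta_def path_class_const topspace_X)

text \<open>Omitted loops are replaced by constant ones and keep their time slot, so the value at a
  given time depends on finitely many members of \<open>s\<close>.\<close>

definition sub_concat :: "'a \<Rightarrow> (nat \<Rightarrow> real \<Rightarrow> 'a) \<Rightarrow> (nat \<Rightarrow> bool) \<Rightarrow> real \<Rightarrow> 'a" where
  "sub_concat y l s = inf_concat y (\<lambda>n. if s n then l n else (\<lambda>_. y))"

lemma null_loops_sub:
  assumes "null_loops y l" shows "null_loops y (\<lambda>n. if s n then l n else (\<lambda>_. y))"
  unfolding null_loops_def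
proof (intro conjI allI impI)
  fix \<epsilon> :: real assume \<epsilon>: "\<epsilon> > 0"
  then obtain n where n: "\<forall>i\<ge>n. l i ` {0..1} \<subseteq> mball y \<epsilon>" using assms unfolding null_loops_def by blast
  have "\<forall>i\<ge>n. (if s i then l i else (\<lambda>_. y)) ` {0..1} \<subseteq> mball y \<epsilon>"
    using n assms \<epsilon> by (auto simp: null_loops_def)
  then show "\<exists>n. \<forall>i\<ge>n. (if s i then l i else (\<lambda>_. y)) ` {0..1} \<subseteq> mball y \<epsilon>" ..
qed (use assms in \<open>auto simp: null_loops_def topspace_X\<close>)

text \<open>The two concatenations differ in one factor, \<open>l m\<close> against a constant loop;
  after cancellation an equality would put \<open>l m\<close> into the radical.\<close>

lemma theta_sub_concat_flip:
  assumes l: "null_loops y l" and "path_class (l m) \<notin> gc.R"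
  shows "theta (sub_concat y l s) \<noteq> theta (sub_concat y l (s(m := \<not> s m)))"
proof
  let ?u = "\<lambda>s n. if s n then l n else (\<lambda>_. y)" and ?s' = "s(m := \<not> s m)"
  assume eq: "theta (sub_concat y l s) = theta (sub_concat y l ?s')"
  have "theta (sub_concat y l s) \<otimes>\<^bsub>gc.A\<^esub> theta (?u ?s' m) = theta (sub_concat y l ?s') \<otimes>\<^bsub>gc.A\<^esub> theta (?u s m)"
    unfolding sub_concat_def by (rule theta_inf_concat_update[OF null_loops_sub[OF l] null_loops_sub[OF l]]) simp
  moreover have lm: "pathin X (l m)" and y: "y \<in> M" using l by (auto simp: null_loops_def)
  moreover have "theta (sub_concat y l ?s') \<in> carrier gc.A"
    unfolding sub_concat_def by (intro theta_closed pathin_inf_concat null_loops_sub l)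
  moreover have "theta (?u ?s' m) \<in> carrier gc.A" "theta (?u s m) \<in> carrier gc.A"
    using lm y by (auto simp: topspace_X intro!: theta_closed)
  ultimately have "theta (?u ?s' m) = theta (?u s m)"
    unfolding eq using gc.proj.H.Units_l_cancel[of "theta (sub_concat y l ?s')"] gc.proj.H.Units_eq by metis
  then have "theta (l m) = \<one>\<^bsub>gc.A\<^esub>" using theta_const[OF y] by (auto split: if_splits)
  then show False using theta_eq_one_iff[OF lm] assms(2) by blast
qed

end

section \<open>Words in loops\<close>

definition first_half :: "(real \<Rightarrow> 'a) \<Rightarrow> real \<Rightarrow> 'a" where "first_half h = (\<lambda>t. h (t / 2))"
definition second_half :: "(real \<Rightarrow> 'a) \<Rightarrow> real \<Rightarrow> 'a" where "second_half h = (\<lambda>t. h ((1 + t) / 2))"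

lemma loop_concat_halves: "loop_concat (first_half h) (second_half h) = h"
  by (auto simp: loop_concat_def first_half_def second_half_def fun_eq_iff)

lemma pathin_first_half: "pathin X h \<Longrightarrow> pathin X (first_half h)"
  unfolding first_half_def by (rule pathin_reparam) (auto intro!: continuous_intros)

lemma pathin_second_half: "pathin X h \<Longrightarrow> pathin X (second_half h)"
  unfolding second_half_def by (rule pathin_reparam) (auto intro!: continuous_intros)

lemma half_ends [simp]: "first_half h 0 = h 0" "first_half h 1 = h (1/2)" "second_half h 0 = h (1/2)" "second_half h 1 = h 1"
  by (simp_all add: first_half_def second_half_def)

text \<open>Halving undoes concatenation only up to values outside the unit interval, as paths are
  total functions on the reals.\<close>

definition eq01 :: "(real \<Rightarrow> 'a) \<Rightarrow> (real \<Rightarrow> 'a) \<Rightarrow> bool" where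
  "eq01 f g \<longleftrightarrow> (\<forall>t\<in>{0..1}. f t = g t)"

lemma eq01D: "eq01 f g \<Longrightarrow> 0 \<le> t \<Longrightarrow> t \<le> 1 \<Longrightarrow> f t = g t"
  by (simp add: eq01_def)

lemma eq01_refl: "eq01 f f" by (simp add: eq01_def)

lemma first_half_concat: "eq01 (first_half (loop_concat f g)) f"
  by (auto simp: eq01_def first_half_def loop_concat_def)

lemma second_half_concat: "f 1 = g 0 \<Longrightarrow> eq01 (second_half (loop_concat f g)) g"
  by (auto simp: eq01_def second_half_def loop_concat_def add_divide_distrib)

lemma eq01_first_half: "eq01 f g \<Longrightarrow> eq01 (first_half f) (first_half g)" by (auto simp: eq01_def first_half_def)
lemma eq01_second_half: "eq01 f g \<Longrightarrow> eq01 (second_half f) (second_half g)" by (auto simp: eq01_def second_half_def)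
lemma eq01_rev: "eq01 f g \<Longrightarrow> eq01 (rev_path f) (rev_path g)" by (auto simp: eq01_def rev_path_def)
lemma eq01_sym: "eq01 f g \<Longrightarrow> eq01 g f" by (auto simp: eq01_def)
lemma eq01_trans: "eq01 f g \<Longrightarrow> eq01 g h \<Longrightarrow> eq01 f h" by (auto simp: eq01_def)

text \<open>These words are described by pointwise equations on the path \<open>h\<close> alone, so that they pass to
  pointwise limits.\<close>

fun commutator_word :: "'a \<Rightarrow> nat \<Rightarrow> (real \<Rightarrow> 'a) \<Rightarrow> bool" where
  "commutator_word x 0 h \<longleftrightarrow> eq01 h (\<lambda>_. x)"
| "commutator_word x (Suc n) h \<longleftrightarrow>
     h 0 = x \<and> h (1/2) = x \<and> second_half h (1/2) = x \<and> second_half (second_half h) (1/2) = x \<and> second_half (second_half (second_half h)) (1/2) = x \<and>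
     eq01 (first_half (second_half (second_half h))) (rev_path (first_half h)) \<and>
     eq01 (first_half (second_half (second_half (second_half h)))) (rev_path (first_half (second_half h))) \<and>
     commutator_word x n (second_half (second_half (second_half (second_half h))))"

text \<open>The condition \<open>Q\<close> takes over the rest of the path after \<open>k\<close>
  copies of \<open>g\<close>, so that words can be chained.\<close>

fun power_word :: "'a \<Rightarrow> (real \<Rightarrow> 'a) \<Rightarrow> ((real \<Rightarrow> 'a) \<Rightarrow> bool) \<Rightarrow> nat \<Rightarrow> (real \<Rightarrow> 'a) \<Rightarrow> bool" where
  "power_word x g Q 0 h \<longleftrightarrow> Q h"
| "power_word x g Q (Suc k) h \<longleftrightarrow>
     h 0 = x \<and> h (1/2) = x \<and> eq01 (first_half h) g \<and> power_word x g Q k (second_half h)"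

text \<open>The shape is \<open>g^k c^q\<close> followed by \<open>n\<close> commutators. The
  unknown \<open>c\<close> is not a parameter: it is read off as the first half of the remaining
  path, so a limit of paths also supplies the limit of \<open>c\<close>. For \<open>q = 0\<close>
  the middle factor is absent.\<close>

definition radical_word :: "'a \<Rightarrow> nat \<Rightarrow> nat \<Rightarrow> nat \<Rightarrow> (real \<Rightarrow> 'a) \<Rightarrow> (real \<Rightarrow> 'a) \<Rightarrow> bool" where
  "radical_word x q k n g h \<longleftrightarrow>
     power_word x g (\<lambda>h. power_word x (first_half h) (commutator_word x n) q h) k h"

lemma commutator_word_cong: "eq01 h h' \<Longrightarrow> commutator_word x n h \<Longrightarrow> commutator_word x n h'"
proof (induction n arbitrary: h h')
  case 0 then show ?case using eq01_trans eq01_sym by (metis commutator_word.simps(1))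
next
  case (Suc n)
  note e = Suc.prems(1)
  have b: "eq01 (second_half h) (second_half h')" "eq01 (second_half (second_half h)) (second_half (second_half h'))"
    "eq01 (second_half (second_half (second_half h))) (second_half (second_half (second_half h')))"
    "eq01 (second_half (second_half (second_half (second_half h)))) (second_half (second_half (second_half (second_half h'))))"
    by (intro eq01_second_half e)+
  have w: "h 0 = x" "h (1/2) = x" "second_half h (1/2) = x" "second_half (second_half h) (1/2) = x"
    "second_half (second_half (second_half h)) (1/2) = x"
    "eq01 (first_half (second_half (second_half h))) (rev_path (first_half h))"
    "eq01 (first_half (second_half (second_half (second_half h)))) (rev_path (first_half (second_half h)))"
    "commutator_word x n (second_half (second_half (second_half (second_half h))))"
    using Suc.prems(2) by simp_all
  show ?case
    unfolding commutator_word.simps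
  proof (intro conjI)
    show "eq01 (first_half (second_half (second_half h'))) (rev_path (first_half h'))"
      by (rule eq01_trans[OF eq01_trans[OF eq01_sym[OF eq01_first_half[OF b(2)]] w(6)] eq01_rev[OF eq01_first_half[OF e]]])
    show "eq01 (first_half (second_half (second_half (second_half h')))) (rev_path (first_half (second_half h')))"
      by (rule eq01_trans[OF eq01_trans[OF eq01_sym[OF eq01_first_half[OF b(3)]] w(7)] eq01_rev[OF eq01_first_half[OF b(1)]]])
    show "commutator_word x n (second_half (second_half (second_half (second_half h'))))"
      by (rule Suc.IH[OF b(4) w(8)])
    show "h' 0 = x" "h' (1/2) = x" using eq01D[OF e, of 0] eq01D[OF e, of "1/2"] w(1,2) by simp_all
    show "second_half h' (1/2) = x" using eq01D[OF b(1), of "1/2"] w(3) by simp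
    show "second_half (second_half h') (1/2) = x" using eq01D[OF b(2), of "1/2"] w(4) by simp
    show "second_half (second_half (second_half h')) (1/2) = x" using eq01D[OF b(3), of "1/2"] w(5) by simp
  qed
qed

lemma power_word_cong:
  assumes "eq01 h h'" "power_word x g Q k h" "\<And>h h'. eq01 h h' \<Longrightarrow> Q h \<Longrightarrow> Q' h'" "eq01 g g'"
  shows "power_word x g' Q' k h'"
  using assms(1,2)
proof (induction k arbitrary: h h')
  case 0 then show ?case using assms(3) by simp
next
  case (Suc k)
  have w: "h 0 = x" "h (1/2) = x" "eq01 (first_half h) g" "power_word x g Q k (second_half h)"
    using Suc.prems(2) by simp_all
  have "eq01 (first_half h') g'"
    by (rule eq01_trans[OF eq01_trans[OF eq01_sym[OF eq01_first_half[OF Suc.prems(1)]] w(3)] assms(4)])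
  moreover have "power_word x g' Q' k (second_half h')"
    by (rule Suc.IH[OF eq01_second_half[OF Suc.prems(1)] w(4)])
  moreover have "h' 0 = x" "h' (1/2) = x"
    using eq01D[OF Suc.prems(1), of 0] eq01D[OF Suc.prems(1), of "1/2"] w(1,2) by simp_all
  ultimately show ?case by simp
qed

context based_space
begin

section \<open>Words of loops and elements of the radical\<close>

lemma loops_at_ends: "l \<in> loops_at X x0 \<longleftrightarrow> pathin X l \<and> l 0 = x0 \<and> l 1 = x0"
  by (auto simp: loops_at_def)

abbreviation "cls \<equiv> loop_class X x0"

lemma cls_eq01: "l \<in> loops_at X x0 \<Longrightarrow> eq01 l l' \<Longrightarrow> cls l = cls l' \<and> l' \<in> loops_at X x0"
proof -
  assume l: "l \<in> loops_at X x0" and e: "eq01 l l'"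
  have l': "l' \<in> loops_at X x0"
    using l e pathin_cong[of X l l'] eq01D[OF e, of 0] eq01D[OF e, of 1]
    by (auto simp: loops_at_ends eq01_def)
  have "pathhom X l l'" using l eq01D[OF e] by (intro pathhom_eq) (auto simp: loops_at_ends)
  then show ?thesis using l l' by (simp add: loop_class_eq_iff)
qed

lemma cls_split:
  assumes "pathin X h" "h 0 = x0" "h (1/2) = x0" "second_half h \<in> loops_at X x0"
  shows "h \<in> loops_at X x0" "first_half h \<in> loops_at X x0"
    "cls h = cls (first_half h) \<otimes>\<^bsub>\<pi>\<^esub> cls (second_half h)"
proof -
  show f: "first_half h \<in> loops_at X x0" using assms by (simp add: loops_at_ends pathin_first_half)
  show "h \<in> loops_at X x0" using assms by (simp add: loops_at_ends)
  show "cls h = cls (first_half h) \<otimes>\<^bsub>\<pi>\<^esub> cls (second_half h)"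
    using loop_class_concat[OF f assms(4)] by (simp add: loop_concat_halves)
qed

text \<open>Only continuity of \<open>h\<close> is assumed; that its pieces are loops is recovered
  from the end of the path backwards.\<close>

lemma commutator_word_sound:
  assumes "pathin X h" "commutator_word x0 n h"
  shows "h \<in> loops_at X x0 \<and> (\<exists>ps\<in>lists (carrier \<pi> \<times> carrier \<pi>). cls h = pi1.commutator_prod ps)"
  using assms
proof (induction n arbitrary: h)
  case 0
  then have "h \<in> loops_at X x0 \<and> cls h = cls (\<lambda>_. x0)"
    using cls_eq01[OF loops_at_const[OF x0]] eq01_sym by (metis commutator_word.simps(1))
  then show ?case using one_fundamental_group[of X x0] by (intro conjI bexI[of _ "[]"]) auto
next
  case (Suc n)
  define h1 h2 h3 h4 where "h1 = second_half h" and "h2 = second_half h1" and "h3 = second_half h2" and "h4 = second_half h3"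
  note defs = h1_def h2_def h3_def h4_def
  have p: "pathin X h1" "pathin X h2" "pathin X h3" "pathin X h4"
    using Suc.prems(1) by (auto simp: defs intro!: pathin_second_half)
  have w: "h 0 = x0" "h (1/2) = x0" "h1 (1/2) = x0" "h2 (1/2) = x0" "h3 (1/2) = x0"
    "eq01 (first_half h2) (rev_path (first_half h))" "eq01 (first_half h3) (rev_path (first_half h1))" "commutator_word x0 n h4"
    using Suc.prems(2) by (simp_all add: defs)
  obtain ps where h4: "h4 \<in> loops_at X x0" and ps: "ps \<in> lists (carrier \<pi> \<times> carrier \<pi>)" "cls h4 = pi1.commutator_prod ps"
    using Suc.IH[OF p(4) w(8)] by blast
  have b: "h3 0 = x0" "h2 0 = x0" "h1 0 = x0" using w by (simp_all add: defs)
  note s3 = cls_split[OF p(3) b(1) w(5) h4[unfolded h4_def]]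
  note s2 = cls_split[OF p(2) b(2) w(4) s3(1)[unfolded h3_def]]
  note s1 = cls_split[OF p(1) b(3) w(3) s2(1)[unfolded h2_def]]
  note s0 = cls_split[OF Suc.prems(1) w(1,2) s1(1)[unfolded h1_def]]
  have a: "cls (first_half h2) = inv\<^bsub>\<pi>\<^esub> cls (first_half h)"
    using cls_eq01[OF s2(2) w(6)] inv_loop_class[OF s0(2) x0] by simp
  have b: "cls (first_half h3) = inv\<^bsub>\<pi>\<^esub> cls (first_half h1)"
    using cls_eq01[OF s3(2) w(7)] inv_loop_class[OF s1(2) x0] by simp
  have "cls h = pi1.commutator_prod ((cls (first_half h), cls (first_half h1)) # ps)"
    using s0(3) s1(3) s2(3) s3(3) a b ps(2) by (simp flip: defs)
  moreover have "cls (first_half h) \<in> carrier \<pi>" "cls (first_half h1) \<in> carrier \<pi>"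
    using loop_class_in_carrier[OF s0(2)] loop_class_in_carrier[OF s1(2)] .
  ultimately show ?case using s0(1) ps(1) by (intro conjI bexI[of _ "(cls (first_half h), cls (first_half h1)) # ps"]) auto
qed

text \<open>With \<open>k = 0\<close> the word says nothing about \<open>g\<close>, which need not
  be a loop; \<open>a\<close> then stands for any element. This case occurs for
  \<open>q = 0\<close>, where \<open>g\<close> is the first half of an arbitrary path.\<close>

lemma power_word_sound:
  assumes "pathin X h" "power_word x0 g Q k h"
    and Q: "\<And>h. pathin X h \<Longrightarrow> Q h \<Longrightarrow> h \<in> loops_at X x0 \<and> cls h \<in> S"
    and S: "S \<subseteq> carrier \<pi>"
  shows "h \<in> loops_at X x0 \<and> (k > 0 \<longrightarrow> g \<in> loops_at X x0) \<and>
    (\<exists>a\<in>carrier \<pi>. (k > 0 \<longrightarrow> a = cls g) \<and> (\<exists>z\<in>S. cls h = a [^]\<^bsub>\<pi>\<^esub> k \<otimes>\<^bsub>\<pi>\<^esub> z))"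
  using assms(1,2)
proof (induction k arbitrary: h)
  case 0
  then have "h \<in> loops_at X x0" "cls h \<in> S" using Q by auto
  then show ?case using S by (intro conjI bexI[of _ "\<one>\<^bsub>\<pi>\<^esub>"] bexI[of _ "cls h"]) auto
next
  case (Suc k)
  have w: "h 0 = x0" "h (1/2) = x0" "eq01 (first_half h) g" "power_word x0 g Q k (second_half h)" using Suc.prems(2) by simp_all
  obtain a z where second_half: "second_half h \<in> loops_at X x0" and a: "a \<in> carrier \<pi>" "k > 0 \<longrightarrow> a = cls g" "z \<in> S"
      "cls (second_half h) = a [^]\<^bsub>\<pi>\<^esub> k \<otimes>\<^bsub>\<pi>\<^esub> z"
    using Suc.IH[OF pathin_second_half[OF Suc.prems(1)] w(4)] by blast
  note s = cls_split[OF Suc.prems(1) w(1,2) second_half]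
  have g: "g \<in> loops_at X x0" "cls (first_half h) = cls g" using cls_eq01[OF s(2) w(3)] by auto
  have gc: "cls g \<in> carrier \<pi>" by (rule loop_class_in_carrier[OF g(1)])
  have ak: "a [^]\<^bsub>\<pi>\<^esub> k = cls g [^]\<^bsub>\<pi>\<^esub> k" using a(2) by (cases k) auto
  have "cls h = cls g \<otimes>\<^bsub>\<pi>\<^esub> (cls g [^]\<^bsub>\<pi>\<^esub> k \<otimes>\<^bsub>\<pi>\<^esub> z)" using s(3) g(2) a(4) ak by simp
  also have "\<dots> = cls g [^]\<^bsub>\<pi>\<^esub> Suc k \<otimes>\<^bsub>\<pi>\<^esub> z"
    using gc a(3) S pi1.nat_pow_Suc2[OF gc, of k] by (simp add: pi1.m_assoc subset_iff del: pi1.nat_pow_Suc nat_pow_Suc)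
  finally show ?case using s(1) g(1) gc a(3) by blast
qed

lemma commutator_word_complete:
  assumes "ps \<in> lists (carrier \<pi> \<times> carrier \<pi>)"
  shows "\<exists>h\<in>loops_at X x0. commutator_word x0 (length ps) h \<and> cls h = pi1.commutator_prod ps"
  using assms
proof (induction ps)
  case Nil
  then show ?case using loops_at_const[OF x0] one_fundamental_group[of X x0] by (intro bexI[of _ "\<lambda>_. x0"]) (auto simp: eq01_refl)
next
  case (Cons p ps)
  obtain a b where p: "p = (a, b)" "a \<in> carrier \<pi>" "b \<in> carrier \<pi>" using Cons by auto
  obtain f where f: "f \<in> loops_at X x0" "a = cls f" using p(2) by (rule carrier_fundamental_groupE)
  obtain g where g: "g \<in> loops_at X x0" "b = cls g" using p(3) by (rule carrier_fundamental_groupE)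
  obtain h4 where h4: "h4 \<in> loops_at X x0" "commutator_word x0 (length ps) h4" "cls h4 = pi1.commutator_prod ps"
    using Cons by auto
  define h3 where "h3 = loop_concat (rev_path g) h4"
  define h2 where "h2 = loop_concat (rev_path f) h3"
  define h1 where "h1 = loop_concat g h2"
  define h where "h = loop_concat f h1"
  have l: "h3 \<in> loops_at X x0" "h2 \<in> loops_at X x0" "h1 \<in> loops_at X x0" "h \<in> loops_at X x0"
    using f(1) g(1) h4(1) by (auto simp: h3_def h2_def h1_def h_def intro!: loops_at_concat loops_at_rev)
  have ends: "f 0 = x0" "f 1 = x0" "g 0 = x0" "g 1 = x0" "h4 0 = x0" "h3 0 = x0" "h2 0 = x0" "h1 0 = x0" "h 0 = x0"
    using f(1) g(1) h4(1) l by (auto simp: loops_at_ends)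
  have b: "eq01 (second_half h) h1" "eq01 (second_half h1) h2" "eq01 (second_half h2) h3" "eq01 (second_half h3) h4"
    unfolding h_def h1_def h2_def h3_def by (rule second_half_concat; simp add: ends flip: h1_def h2_def h3_def)+
  have b1: "eq01 (second_half h) h1" by (rule b(1))
  have b2: "eq01 (second_half (second_half h)) h2" by (rule eq01_trans[OF eq01_second_half[OF b1] b(2)])
  have b3: "eq01 (second_half (second_half (second_half h))) h3" by (rule eq01_trans[OF eq01_second_half[OF b2] b(3)])
  have b4: "eq01 (second_half (second_half (second_half (second_half h)))) h4" by (rule eq01_trans[OF eq01_second_half[OF b3] b(4)])
  have f0: "eq01 (first_half h) f" and f1: "eq01 (first_half h1) g" and f2: "eq01 (first_half h2) (rev_path f)"
    and f3: "eq01 (first_half h3) (rev_path g)"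
    unfolding h_def h1_def h2_def h3_def by (rule first_half_concat)+
  have f1': "eq01 (first_half (second_half h)) g" by (rule eq01_trans[OF eq01_first_half[OF b1] f1])
  have f2': "eq01 (first_half (second_half (second_half h))) (rev_path f)" by (rule eq01_trans[OF eq01_first_half[OF b2] f2])
  have f3': "eq01 (first_half (second_half (second_half (second_half h)))) (rev_path g)" by (rule eq01_trans[OF eq01_first_half[OF b3] f3])
  have half: "h (1/2) = x0" "h1 (1/2) = x0" "h2 (1/2) = x0" "h3 (1/2) = x0"
    by (simp_all add: h_def h1_def h2_def h3_def loop_concat_def ends)
  have "commutator_word x0 (length (p # ps)) h"
    unfolding list.size add_Suc_right add_0_right commutator_word.simps
  proof (intro conjI)
    show "h 0 = x0" "h (1/2) = x0" by (rule ends half)+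
    show "second_half h (1/2) = x0" "second_half (second_half h) (1/2) = x0" "second_half (second_half (second_half h)) (1/2) = x0"
      using eq01D[OF b1, of "1/2"] eq01D[OF b2, of "1/2"] eq01D[OF b3, of "1/2"] half by simp_all
    show "eq01 (first_half (second_half (second_half h))) (rev_path (first_half h))"
      by (rule eq01_trans[OF f2' eq01_sym[OF eq01_rev[OF f0]]])
    show "eq01 (first_half (second_half (second_half (second_half h)))) (rev_path (first_half (second_half h)))"
      by (rule eq01_trans[OF f3' eq01_sym[OF eq01_rev[OF f1']]])
    show "commutator_word x0 (length ps) (second_half (second_half (second_half (second_half h))))"
      by (rule commutator_word_cong[OF eq01_sym[OF b4] h4(2)])
  qed
  moreover have "cls h = pi1.commutator_prod (p # ps)"
    using f g h4 l loops_at_rev[OF f(1)] loops_at_rev[OF g(1)] inv_loop_class[OF f(1) x0] inv_loop_class[OF g(1) x0]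
    unfolding p(1) pi1.commutator_prod_Cons
    by (simp add: loop_class_concat[symmetric] h_def h1_def h2_def h3_def loops_at_concat)
  ultimately show ?case using l(4) by blast
qed

text \<open>The clause on \<open>first_half\<close> allows the base of the power to be replaced by
  the first half of the constructed path, as \<open>radical_word\<close> requires.\<close>

lemma power_word_complete:
  assumes g: "g \<in> loops_at X x0" and h: "h \<in> loops_at X x0" "Q h" and Q: "\<And>h h'. eq01 h h' \<Longrightarrow> Q h \<Longrightarrow> Q h'"
  shows "\<exists>h'\<in>loops_at X x0. power_word x0 g Q k h' \<and> (k > 0 \<longrightarrow> eq01 (first_half h') g) \<and>
    cls h' = cls g [^]\<^bsub>\<pi>\<^esub> k \<otimes>\<^bsub>\<pi>\<^esub> cls h"
proof (induction k)
  case 0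
  then show ?case using h loop_class_in_carrier[OF h(1)] by auto
next
  case (Suc k)
  then obtain h' where h': "h' \<in> loops_at X x0" "power_word x0 g Q k h'"
    "cls h' = cls g [^]\<^bsub>\<pi>\<^esub> k \<otimes>\<^bsub>\<pi>\<^esub> cls h" by blast
  have gc: "cls g \<in> carrier \<pi>" "cls h \<in> carrier \<pi>"
    using loop_class_in_carrier[OF g] loop_class_in_carrier[OF h(1)] .
  let ?h = "loop_concat g h'"
  have ends: "g 0 = x0" "g 1 = x0" "h' 0 = x0" using g h' by (auto simp: loops_at_ends)
  have fr: "eq01 (first_half ?h) g" by (rule first_half_concat)
  have bk: "eq01 (second_half ?h) h'" by (rule second_half_concat) (simp add: ends)
  have "power_word x0 g Q (Suc k) ?h"
    unfolding power_word.simps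
  proof (intro conjI)
    show "?h 0 = x0" "?h (1/2) = x0" by (simp_all add: ends loop_concat_def)
    show "eq01 (first_half ?h) g" by (rule fr)
    show "power_word x0 g Q k (second_half ?h)"
      by (rule power_word_cong[OF eq01_sym[OF bk] h'(2)]) (blast intro: Q eq01_refl)+
  qed
  moreover have "cls ?h = cls g [^]\<^bsub>\<pi>\<^esub> Suc k \<otimes>\<^bsub>\<pi>\<^esub> cls h"
    using gc pi1.nat_pow_Suc2[OF gc(1), of k]
    by (simp add: loop_class_concat[OF g h'(1), symmetric] h'(3) pi1.m_assoc del: pi1.nat_pow_Suc nat_pow_Suc)
  moreover have "?h \<in> loops_at X x0" using g h' by (simp add: loops_at_concat)
  ultimately show ?case using fr by blast
qed

text \<open>An element \<open>z\<close> lies in the commutator subgroup exactly if \<open>z\<close>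
  times some product of commutators is trivial. Existence of \<open>c\<close>, of the commutators
  and of the relation thus becomes existence of one null homotopic path.\<close>

lemma radical_word_iff:
  assumes g: "g \<in> loops_at X x0"
  shows "(\<exists>c\<in>carrier \<pi>. cls g [^]\<^bsub>\<pi>\<^esub> k \<otimes>\<^bsub>\<pi>\<^esub> c [^]\<^bsub>\<pi>\<^esub> q \<in> derived \<pi> (carrier \<pi>)) \<longleftrightarrow>
    (\<exists>n h. radical_word x0 q k n g h \<and> pathhom X h (\<lambda>_. x0))" (is "?L \<longleftrightarrow> ?R")
proof
  let ?N = "derived \<pi> (carrier \<pi>)"
  have N: "subgroup ?N \<pi>" by (rule pi1.derived_is_subgroup) simp
  have Nc: "?N \<subseteq> carrier \<pi>" using subgroup.subset[OF N] .
  have gc: "cls g \<in> carrier \<pi>" by (rule loop_class_in_carrier[OF g])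
  {
    assume ?L
    then obtain c where c: "c \<in> carrier \<pi>" "cls g [^]\<^bsub>\<pi>\<^esub> k \<otimes>\<^bsub>\<pi>\<^esub> c [^]\<^bsub>\<pi>\<^esub> q \<in> ?N" by blast
    let ?z = "cls g [^]\<^bsub>\<pi>\<^esub> k \<otimes>\<^bsub>\<pi>\<^esub> c [^]\<^bsub>\<pi>\<^esub> q"
    \<comment> \<open>The commutators appended to the word represent the inverse of
      \<open>?z\<close>, so the whole word is null homotopic.\<close>
    have "inv\<^bsub>\<pi>\<^esub> ?z \<in> ?N" using subgroup.m_inv_closed[OF N c(2)] .
    then obtain ps where ps: "ps \<in> lists (carrier \<pi> \<times> carrier \<pi>)" "inv\<^bsub>\<pi>\<^esub> ?z = pi1.commutator_prod ps"
      unfolding pi1.derived_eq_commutator_prods by blast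
    obtain h where h: "h \<in> loops_at X x0" "commutator_word x0 (length ps) h" "cls h = inv\<^bsub>\<pi>\<^esub> ?z"
      using commutator_word_complete[OF ps(1)] ps(2) by auto
    obtain f where f: "f \<in> loops_at X x0" "c = cls f" using c(1) by (rule carrier_fundamental_groupE)
    obtain h' where h': "h' \<in> loops_at X x0" "power_word x0 f (commutator_word x0 (length ps)) q h'"
      "q > 0 \<longrightarrow> eq01 (first_half h') f" "cls h' = c [^]\<^bsub>\<pi>\<^esub> q \<otimes>\<^bsub>\<pi>\<^esub> inv\<^bsub>\<pi>\<^esub> ?z"
      using power_word_complete[of f h "commutator_word x0 (length ps)" q] commutator_word_cong f h by metis
    let ?Q = "\<lambda>h. power_word x0 (first_half h) (commutator_word x0 (length ps)) q h"
    have "?Q h'"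
    proof (cases "q = 0")
      case True then show ?thesis using h'(2) by simp
    next
      case False
      then have e: "eq01 f (first_half h')" using h'(3) eq01_sym by blast
      show ?thesis by (rule power_word_cong[OF eq01_refl h'(2) commutator_word_cong e])
    qed
    moreover have "?Q h2" if "eq01 h1 h2" "?Q h1" for h1 h2
      by (rule power_word_cong[OF that commutator_word_cong eq01_first_half[OF that(1)]])
    ultimately obtain h'' where h'': "h'' \<in> loops_at X x0" "power_word x0 g ?Q k h''"
      "cls h'' = cls g [^]\<^bsub>\<pi>\<^esub> k \<otimes>\<^bsub>\<pi>\<^esub> cls h'"
      using power_word_complete[OF g h'(1), of ?Q k] by blast
    have "cls h'' = ?z \<otimes>\<^bsub>\<pi>\<^esub> inv\<^bsub>\<pi>\<^esub> ?z"
      unfolding h''(3) h'(4) using gc c(1) by (intro pi1.m_assoc[symmetric]) auto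
    also have "\<dots> = cls (\<lambda>_. x0)" using gc c(1) one_fundamental_group[of X x0] by simp
    finally have "pathhom X h'' (\<lambda>_. x0)" using h''(1) loops_at_const[OF x0] by (simp add: loop_class_eq_iff)
    then show ?R using h''(2) unfolding radical_word_def by blast
  }
  assume ?R
  then obtain n h where h: "radical_word x0 q k n g h" "pathhom X h (\<lambda>_. x0)" by blast
  have hp: "pathin X h" using pathhom_pathin[OF h(2)] by blast
  have cw: "h \<in> loops_at X x0 \<and> cls h \<in> ?N" if "pathin X h" "commutator_word x0 n h" for h
    using commutator_word_sound[OF that] unfolding pi1.derived_eq_commutator_prods by blast
  let ?S = "{c [^]\<^bsub>\<pi>\<^esub> q \<otimes>\<^bsub>\<pi>\<^esub> z | c z. c \<in> carrier \<pi> \<and> z \<in> ?N}"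
  have Q: "h \<in> loops_at X x0 \<and> cls h \<in> ?S"
    if "pathin X h" "power_word x0 (first_half h) (commutator_word x0 n) q h" for h
    using power_word_sound[OF that cw Nc] by blast
  have S: "?S \<subseteq> carrier \<pi>" using Nc by auto
  obtain a z where hl: "h \<in> loops_at X x0" and az: "a \<in> carrier \<pi>" "k > 0 \<longrightarrow> a = cls g" "z \<in> ?S"
      "cls h = a [^]\<^bsub>\<pi>\<^esub> k \<otimes>\<^bsub>\<pi>\<^esub> z"
    using power_word_sound[OF hp h(1)[unfolded radical_word_def] Q S] by blast
  obtain c w where c: "c \<in> carrier \<pi>" "w \<in> ?N" "z = c [^]\<^bsub>\<pi>\<^esub> q \<otimes>\<^bsub>\<pi>\<^esub> w" using az(3) by blast
  have wc: "w \<in> carrier \<pi>" using c(2) Nc by blast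
  have ak: "a [^]\<^bsub>\<pi>\<^esub> k = cls g [^]\<^bsub>\<pi>\<^esub> k" using az(2) by (cases k) auto
  have "cls h = \<one>\<^bsub>\<pi>\<^esub>"
    using hl h(2) loops_at_const[OF x0] one_fundamental_group[of X x0] by (simp add: loop_class_eq_iff)
  then have "(cls g [^]\<^bsub>\<pi>\<^esub> k \<otimes>\<^bsub>\<pi>\<^esub> c [^]\<^bsub>\<pi>\<^esub> q) \<otimes>\<^bsub>\<pi>\<^esub> w = \<one>\<^bsub>\<pi>\<^esub>"
    using az(4) c wc gc ak by (simp add: pi1.m_assoc)
  then have "cls g [^]\<^bsub>\<pi>\<^esub> k \<otimes>\<^bsub>\<pi>\<^esub> c [^]\<^bsub>\<pi>\<^esub> q = inv\<^bsub>\<pi>\<^esub> w"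
    using gc c(1) wc by (simp add: pi1.inv_equality)
  then have "cls g [^]\<^bsub>\<pi>\<^esub> k \<otimes>\<^bsub>\<pi>\<^esub> c [^]\<^bsub>\<pi>\<^esub> q \<in> ?N"
    using subgroup.m_inv_closed[OF N c(2)] by (simp only:)
  then show ?L using c(1) by (rule bexI)
qed

end

section \<open>Words under pointwise limits\<close>

text \<open>The one consequence of convergence that words need: equations that eventually hold
  between values hold in the limit. Stated so, it also applies to cluster points, where no
  convergence is available.\<close>

definition limit_eq ::
  "(nat \<Rightarrow> real \<Rightarrow> 'a) \<Rightarrow> (real \<Rightarrow> 'a) \<Rightarrow> (nat \<Rightarrow> real \<Rightarrow> 'a) \<Rightarrow> (real \<Rightarrow> 'a) \<Rightarrow> bool" where
  "limit_eq gs g hs h \<longleftrightarrow> (\<forall>s\<in>{0..1}. \<forall>t\<in>{0..1}. (\<forall>\<^sub>F k in sequentially. gs k s = hs k t) \<longrightarrow> g s = h t)"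

lemma limit_eqD:
  "limit_eq gs g hs h \<Longrightarrow> s \<in> {0..1} \<Longrightarrow> t \<in> {0..1} \<Longrightarrow> \<forall>\<^sub>F k in sequentially. gs k s = hs k t \<Longrightarrow> g s = h t"
  by (simp add: limit_eq_def)

lemma limit_eq_reparam:
  assumes "limit_eq gs g hs h" "\<And>t. t \<in> {0..1} \<Longrightarrow> \<alpha> t \<in> {0..1}" "\<And>t. t \<in> {0..1} \<Longrightarrow> \<beta> t \<in> {0..1}"
  shows "limit_eq (\<lambda>k t. gs k (\<alpha> t)) (\<lambda>t. g (\<alpha> t)) (\<lambda>k t. hs k (\<beta> t)) (\<lambda>t. h (\<beta> t))"
  using assms unfolding limit_eq_def by blast

lemma limit_eq_right_halves:
  assumes "limit_eq gs g hs h"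
  shows "limit_eq gs g (\<lambda>k. first_half (hs k)) (first_half h)"
    "limit_eq gs g (\<lambda>k. second_half (hs k)) (second_half h)"
  using limit_eq_reparam[OF assms, of "\<lambda>t. t" "\<lambda>t. t / 2"] limit_eq_reparam[OF assms, of "\<lambda>t. t" "\<lambda>t. (1 + t) / 2"]
  by (auto simp: first_half_def second_half_def)

lemma limit_eq_left_halves:
  assumes "limit_eq gs g hs h"
  shows "limit_eq (\<lambda>k. first_half (gs k)) (first_half g) hs h"
    "limit_eq (\<lambda>k. second_half (gs k)) (second_half g) hs h"
    "limit_eq (\<lambda>k. rev_path (gs k)) (rev_path g) hs h"
  using limit_eq_reparam[OF assms, of "\<lambda>t. t / 2" "\<lambda>t. t"] limit_eq_reparam[OF assms, of "\<lambda>t. (1 + t) / 2" "\<lambda>t. t"]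
    limit_eq_reparam[OF assms, of "\<lambda>t. 1 - t" "\<lambda>t. t"]
  by (auto simp: first_half_def second_half_def rev_path_def)

lemma limit_eq01:
  assumes "limit_eq gs g hs h" "\<forall>\<^sub>F k in sequentially. eq01 (gs k) (hs k)"
  shows "eq01 g h"
  unfolding eq01_def
proof
  fix t :: real assume t: "t \<in> {0..1}"
  show "g t = h t"
    by (rule limit_eqD[OF assms(1) t t]) (use assms(2) t in \<open>auto elim!: eventually_mono simp: eq01_def\<close>)
qed

lemma limit_const:
  assumes "limit_eq (\<lambda>_ _. x) (\<lambda>_. x) hs h" "\<forall>\<^sub>F k in sequentially. hs k t = x" "t \<in> {0..1}"
  shows "h t = x"
  using limit_eqD[OF assms(1,3,3)] assms(2) by (simp add: eq_commute)

text \<open>Each clause compares two values of the path with each other or one value with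
  \<open>x\<close>. The two hypotheses cover these cases, and both are inherited by halves and
  reversals.\<close>

lemma commutator_word_limit:
  assumes "limit_eq hs h hs h" "limit_eq (\<lambda>_ _. x) (\<lambda>_. x) hs h"
    "\<forall>\<^sub>F k in sequentially. commutator_word x n (hs k)"
  shows "commutator_word x n h"
  using assms
proof (induction n arbitrary: hs h)
  case 0
  have "eq01 (\<lambda>_. x) h"
    by (rule limit_eq01[OF 0(2)]) (use 0(3) in \<open>auto elim!: eventually_mono intro: eq01_sym\<close>)
  then show ?case by (simp add: eq01_sym)
next
  case (Suc n)
  note l = limit_eq_left_halves and r = limit_eq_right_halves
  note c1 = r(2)[OF Suc.prems(2)]
  note c2 = r(2)[OF c1]
  note c3 = r(2)[OF c2]
  note c4 = r(2)[OF c3]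
  note h1 = r(2)[OF Suc.prems(1)]
  note h2 = r(2)[OF h1]
  note h3 = r(2)[OF h2]
  note h4 = r(2)[OF h3]
  have ev: "\<forall>\<^sub>F k in sequentially. hs k 0 = x" "\<forall>\<^sub>F k in sequentially. hs k (1/2) = x"
    "\<forall>\<^sub>F k in sequentially. second_half (hs k) (1/2) = x"
    "\<forall>\<^sub>F k in sequentially. second_half (second_half (hs k)) (1/2) = x"
    "\<forall>\<^sub>F k in sequentially. second_half (second_half (second_half (hs k))) (1/2) = x"
    "\<forall>\<^sub>F k in sequentially. eq01 (rev_path (first_half (hs k))) (first_half (second_half (second_half (hs k))))"
    "\<forall>\<^sub>F k in sequentially. eq01 (rev_path (first_half (second_half (hs k)))) (first_half (second_half (second_half (second_half (hs k)))))"
    "\<forall>\<^sub>F k in sequentially. commutator_word x n (second_half (second_half (second_half (second_half (hs k)))))"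
    by (rule eventually_mono[OF Suc.prems(3)]; simp add: eq01_sym)+
  show ?case
    unfolding commutator_word.simps
  proof (intro conjI)
    show "h 0 = x" "h (1/2) = x" using limit_const[OF Suc.prems(2)] ev(1,2) by simp_all
    show "second_half h (1/2) = x" by (rule limit_const[OF c1 ev(3)]) simp
    show "second_half (second_half h) (1/2) = x" by (rule limit_const[OF c2 ev(4)]) simp
    show "second_half (second_half (second_half h)) (1/2) = x" by (rule limit_const[OF c3 ev(5)]) simp
    show "eq01 (first_half (second_half (second_half h))) (rev_path (first_half h))"
      by (rule eq01_sym[OF limit_eq01[OF l(3)[OF l(1)[OF r(1)[OF h2]]] ev(6)]])
    show "eq01 (first_half (second_half (second_half (second_half h)))) (rev_path (first_half (second_half h)))"
      by (rule eq01_sym[OF limit_eq01[OF l(3)[OF l(1)[OF l(2)[OF r(1)[OF h3]]]] ev(7)]])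
    show "commutator_word x n (second_half (second_half (second_half (second_half h))))"
      by (rule Suc.IH[OF l(2)[OF l(2)[OF l(2)[OF l(2)[OF h4]]]] c4 ev(8)])
  qed
qed

lemma power_word_limit:
  assumes "limit_eq hs h hs h" "limit_eq (\<lambda>_ _. x) (\<lambda>_. x) hs h" "limit_eq gs g hs h"
    "\<forall>\<^sub>F k in sequentially. power_word x (gs k) (Qs k) m (hs k)"
    and Q: "\<And>hs h. limit_eq hs h hs h \<Longrightarrow> limit_eq (\<lambda>_ _. x) (\<lambda>_. x) hs h \<Longrightarrow>
      \<forall>\<^sub>F k in sequentially. Qs k (hs k) \<Longrightarrow> Q h"
  shows "power_word x g Q m h"
  using assms(1-4)
proof (induction m arbitrary: hs h)
  case 0 then show ?case using Q[of hs h] by simp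
next
  case (Suc m)
  note l = limit_eq_left_halves and r = limit_eq_right_halves
  have ev: "\<forall>\<^sub>F k in sequentially. hs k 0 = x" "\<forall>\<^sub>F k in sequentially. hs k (1/2) = x"
    "\<forall>\<^sub>F k in sequentially. eq01 (gs k) (first_half (hs k))"
    "\<forall>\<^sub>F k in sequentially. power_word x (gs k) (Qs k) m (second_half (hs k))"
    by (rule eventually_mono[OF Suc.prems(4)]; simp add: eq01_sym)+
  have "h 0 = x" "h (1/2) = x" using limit_const[OF Suc.prems(2)] ev(1,2) by simp_all
  moreover have "eq01 (first_half h) g"
    by (rule eq01_sym[OF limit_eq01[OF r(1)[OF Suc.prems(3)] ev(3)]])
  moreover have "power_word x g Q m (second_half h)"
    by (rule Suc.IH[OF l(2)[OF r(2)[OF Suc.prems(1)]] r(2)[OF Suc.prems(2)] r(2)[OF Suc.prems(3)] ev(4)])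
  ultimately show ?case by simp
qed

lemma radical_word_limit:
  assumes "limit_eq hs h hs h" "limit_eq (\<lambda>_ _. x) (\<lambda>_. x) hs h" "limit_eq gs g hs h"
    "\<forall>\<^sub>F i in sequentially. radical_word x q k n (gs i) (hs i)"
  shows "radical_word x q k n g h"
  unfolding radical_word_def
proof (rule power_word_limit[OF assms(1-3) assms(4)[unfolded radical_word_def]])
  fix hs h
  assume h: "limit_eq hs h hs h" "limit_eq (\<lambda>_ _. x) (\<lambda>_. x) hs h"
    and ev: "\<forall>\<^sub>F i in sequentially. power_word x (first_half (hs i)) (commutator_word x n) q (hs i)"
  show "power_word x (first_half h) (commutator_word x n) q h"
    by (rule power_word_limit[OF h limit_eq_left_halves(1)[OF h(1)] ev]) (rule commutator_word_limit)
qed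

context Metric_space
begin

section \<open>Moduli of continuity and pointwise cluster points\<close>

lemma uniformly_continuous_square:
  assumes H: "continuous_map (top_of_set ({0..1} \<times> {0..1})) mtopology (H :: real \<times> real \<Rightarrow> 'a)" and "\<epsilon> > 0"
  shows "\<exists>\<delta>>0. \<forall>a\<in>{0..1} \<times> {0..1}. \<forall>b\<in>{0..1} \<times> {0..1}. dist a b < \<delta> \<longrightarrow> d (H a) (H b) < \<epsilon>"
proof -
  let ?S = "{0..1} \<times> {0..1} :: (real \<times> real) set"
  let ?m1 = "submetric euclidean_metric ?S" and ?m2 = "metric (M, d)"
  have m1: "mtopology_of ?m1 = top_of_set ?S" by (simp add: mtopology_of_submetric)
  have "compact ?S" by (intro compact_Times compact_Icc)
  then have "compact_space (mtopology_of ?m1)" unfolding m1 by (simp add: compact_space_subtopology)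
  then have "uniformly_continuous_map ?m1 ?m2 H"
    by (intro continuous_imp_uniformly_continuous_map) (simp add: m1 H)
  then show ?thesis using assms(2) unfolding uniformly_continuous_map_def by (auto simp: dist_commute commute)
qed

text \<open>The bound on the values is not strict, so that it passes to cluster points.\<close>

definition has_modulus :: "(real \<times> real \<Rightarrow> 'a) \<Rightarrow> nat \<Rightarrow> nat \<Rightarrow> bool" where
  "has_modulus H j m \<longleftrightarrow> (\<forall>a\<in>{0..1} \<times> {0..1}. \<forall>b\<in>{0..1} \<times> {0..1}.
     dist a b < 1 / (m + 1) \<longrightarrow> d (H a) (H b) \<le> 1 / (j + 1))"

lemma exists_modulus:
  assumes "continuous_map (top_of_set ({0..1} \<times> {0..1})) mtopology (H :: real \<times> real \<Rightarrow> 'a)"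
  shows "\<exists>m. has_modulus H j m"
proof -
  obtain \<delta> where \<delta>: "\<delta> > 0" "\<forall>a\<in>{0..1} \<times> {0..1}. \<forall>b\<in>{0..1} \<times> {0..1}. dist a b < \<delta> \<longrightarrow> d (H a) (H b) < 1 / (real j + 1)"
    using uniformly_continuous_square[OF assms, of "1 / (real j + 1)"] by auto
  obtain m where "1 / (real m + 1) < \<delta>" using \<delta>(1) nat_approx_posE by (metis add.commute of_nat_Suc)
  then have "has_modulus H j m" unfolding has_modulus_def using \<delta>(2) by (force simp: less_imp_le)
  then show ?thesis ..
qed

lemma continuous_from_moduli:
  assumes "\<And>j. has_modulus H j (b j)" "H \<in> {0..1} \<times> {0..1} \<rightarrow> M"
  shows "continuous_map (top_of_set ({0..1} \<times> {0..1})) mtopology H"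
  unfolding continuous_map_to_metric
proof (intro ballI allI impI)
  fix a :: "real \<times> real" and \<epsilon> :: real assume "a \<in> topspace (top_of_set ({0..1} \<times> {0..1}))" and \<epsilon>: "0 < \<epsilon>"
  then have a: "a \<in> {0..1} \<times> {0..1}" by simp
  obtain j where j: "1 / (real j + 1) < \<epsilon>" using \<epsilon> nat_approx_posE by (metis add.commute of_nat_Suc)
  let ?U = "({0..1} \<times> {0..1}) \<inter> ball a (1 / (real (b j) + 1))"
  have "openin (top_of_set ({0..1} \<times> {0..1})) ?U" by (auto simp: openin_open)
  moreover have "a \<in> ?U" using a by simp
  moreover have "H c \<in> mball (H a) \<epsilon>" if c: "c \<in> ?U" for c
  proof -
    have "d (H a) (H c) \<le> 1 / (real j + 1)" using assms(1)[of j] c a by (auto simp: has_modulus_def)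
    then show ?thesis using j assms(2) a c by auto
  qed
  ultimately show "\<exists>U. openin (top_of_set ({0..1} \<times> {0..1})) U \<and> a \<in> U \<and> (\<forall>c\<in>U. H c \<in> mball (H a) \<epsilon>)" by blast
qed

text \<open>By Tychonoff, so that no equicontinuity is needed at this stage.\<close>

lemma pointwise_cluster_point:
  fixes Hs :: "nat \<Rightarrow> 'i \<Rightarrow> 'a"
  assumes "compact_space mtopology" and Hs: "\<And>k i. i \<in> I \<Longrightarrow> Hs k i \<in> M"
  shows "\<exists>H. (\<forall>i\<in>I. H i \<in> M) \<and>
    (\<forall>i\<in>I. \<forall>j\<in>I. \<forall>\<epsilon>>0. \<forall>K. \<exists>k\<ge>K. d (Hs k i) (H i) < \<epsilon> \<and> d (Hs k j) (H j) < \<epsilon>)"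
proof -
  let ?P = "product_topology (\<lambda>_. mtopology) I"
  define f where "f k = restrict (Hs k) I" for k
  have f: "f k \<in> topspace ?P" for k using Hs by (simp add: f_def PiE_iff)
  have "compact_space ?P" using assms(1) by (simp add: compact_space_product_topology)
  then have "(\<Inter>K. ?P closure_of (f ` {K..})) \<noteq> {}"
  proof (rule compact_space_imp_nest)
    show "?P closure_of (f ` {K..}) \<noteq> {}" for K
      using closure_of_subset[of "f ` {K..}" ?P] f by (auto simp: image_subset_iff)
    show "decseq (\<lambda>K. ?P closure_of (f ` {K..}))"
      by (auto simp: decseq_def intro!: closure_of_mono image_mono)
  qed simp
  then obtain H where H: "\<And>K. H \<in> ?P closure_of (f ` {K..})" by blast
  have HP: "H \<in> topspace ?P" using H[of 0] closure_of_subset_topspace[of ?P] by (rule subsetD[rotated])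
  have HM: "H i \<in> M" if "i \<in> I" for i using HP that by (auto simp: PiE_iff)
  have "\<exists>k\<ge>K. d (Hs k i) (H i) < \<epsilon> \<and> d (Hs k j) (H j) < \<epsilon>" if ij: "i \<in> I" "j \<in> I" "\<epsilon> > 0" for i j \<epsilon> K
  proof -
    \<comment> \<open>Both coordinates are constrained at once: comparing two values of the cluster
      point requires one index \<open>k\<close> that approximates both.\<close>
    define U where "U = {h \<in> topspace ?P. h i \<in> mball (H i) \<epsilon>} \<inter> {h \<in> topspace ?P. h j \<in> mball (H j) \<epsilon>}"
    have U: "openin ?P U"
      unfolding U_def using ij by (intro openin_Int openin_continuous_map_preimage[OF continuous_map_product_projection]) auto
    have "H \<in> U" unfolding U_def using HP HM ij by simp
    then have "\<exists>h. h \<in> f ` {K..} \<and> h \<in> U"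
      using conjunct2[OF H[of K, unfolded in_closure_of]] U by blast
    then obtain k where "k \<ge> K" "f k \<in> U" by auto
    then show ?thesis using ij by (intro exI[of _ k]) (auto simp: U_def f_def commute)
  qed
  with HM show ?thesis by (intro exI[of _ H]) simp
qed

end

section \<open>Wild points\<close>

context peano
begin

definition test_loop :: "'a \<Rightarrow> (nat \<Rightarrow> real \<Rightarrow> 'a) \<Rightarrow> (nat \<Rightarrow> bool \<times> bool) \<Rightarrow> real \<Rightarrow> 'a" where
  "test_loop y l z = lasso (loop_concat (sub_concat y l (fst \<circ> z)) (rev_path (sub_concat y l (snd \<circ> z))))"

lemma sub_concat_loop:
  assumes "null_loops y l"
  shows "pathin X (sub_concat y l s)" "sub_concat y l s 0 = y" "sub_concat y l s 1 = y"
proof -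
  show "pathin X (sub_concat y l s)" unfolding sub_concat_def by (intro pathin_inf_concat null_loops_sub assms)
  have "(if s i then l i else (\<lambda>_. y)) 0 = y" for i using assms by (simp add: null_loops_def)
  then show "sub_concat y l s 0 = y" unfolding sub_concat_def by (rule inf_concat_0)
  show "sub_concat y l s 1 = y" by (simp add: sub_concat_def)
qed

lemma test_loop_in: "null_loops y l \<Longrightarrow> test_loop y l z \<in> loops_at X x0"
  unfolding test_loop_def by (intro lasso_in) (simp add: sub_concat_loop)

lemma test_loop_iff:
  assumes l: "null_loops y l"
  shows "cls (test_loop y l z) \<in> gc.R \<longleftrightarrow> theta (sub_concat y l (fst \<circ> z)) = theta (sub_concat y l (snd \<circ> z))"
proof -
  let ?a = "sub_concat y l (fst \<circ> z)" and ?b = "sub_concat y l (snd \<circ> z)"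
  note s = sub_concat_loop[OF l]
  have p: "pathin X (loop_concat ?a (rev_path ?b))" using s by simp
  have "cls (test_loop y l z) = path_class (loop_concat ?a (rev_path ?b))"
    by (simp add: test_loop_def path_class_def)
  then have "cls (test_loop y l z) \<in> gc.R \<longleftrightarrow> theta (loop_concat ?a (rev_path ?b)) = \<one>\<^bsub>gc.A\<^esub>"
    using theta_eq_one_iff[OF p] by simp
  also have "theta (loop_concat ?a (rev_path ?b)) = theta ?a \<otimes>\<^bsub>gc.A\<^esub> inv\<^bsub>gc.A\<^esub> theta ?b"
    using s by (simp only: theta_def path_class_concat pathin_rev rev_path_0 path_class_rev gc.proj.hom_mult
        gc.proj.hom_inv path_class_closed pi1.inv_closed)
  also have "\<dots> = \<one>\<^bsub>gc.A\<^esub> \<longleftrightarrow> theta ?a = theta ?b"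
    using theta_closed s gc.proj.H.inv_equality gc.proj.H.r_inv gc.proj.H.inv_inv gc.proj.H.inv_closed by metis
  finally show ?thesis .
qed

text \<open>The two outer paths depend only on the ends of \<open>c z\<close>, which are the same
  for all \<open>z\<close>.\<close>

lemma lasso_local:
  assumes "\<And>t. t \<in> {0..1} \<Longrightarrow> \<exists>N. \<forall>z z'. (\<forall>i<N. z i = z' i) \<longrightarrow> c z t = c z' t"
    and "\<And>z. c z 0 = u" "\<And>z. c z 1 = v" and t: "t \<in> {0..1}"
  shows "\<exists>N. \<forall>z z'. (\<forall>i<N. (z :: nat \<Rightarrow> 'z) i = z' i) \<longrightarrow> lasso (c z) t = lasso (c z') t"
proof -
  consider "t \<le> 1/2" | "1/2 < t" "2 * t - 1 \<le> 1/2" | "1/2 < 2 * t - 1" by linarith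
  then show ?thesis
  proof cases
    case 1 then show ?thesis by (simp add: lasso_def loop_concat_def assms(2))
  next
    case 2
    then have "2 * (2 * t - 1) \<in> {0..1}" using t by auto
    from assms(1)[OF this] show ?thesis using 2 by (simp add: lasso_def loop_concat_def)
  next
    case 3 then show ?thesis by (simp add: lasso_def loop_concat_def assms(3))
  qed
qed

lemma sub_concat_local:
  "\<exists>N. \<forall>s s'. (\<forall>i<N. s i = s' i) \<longrightarrow> sub_concat y l s t = sub_concat y l s' t"
proof -
  obtain N where N: "\<And>u u'. \<forall>i<N. u i = u' i \<Longrightarrow> inf_concat y u t = inf_concat y u' t"
    using inf_concat_local[of y t] by blast
  have "\<forall>s s'. (\<forall>i<N. s i = s' i) \<longrightarrow> sub_concat y l s t = sub_concat y l s' t"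
    unfolding sub_concat_def by (intro allI impI N) simp
  then show ?thesis ..
qed

lemma test_loop_local:
  assumes l: "null_loops y l" and t: "t \<in> {0..1}"
  shows "\<exists>N. \<forall>z z'. (\<forall>i<N. z i = z' i) \<longrightarrow> test_loop y l z t = test_loop y l z' t"
  unfolding test_loop_def
proof (rule lasso_local[OF _ _ _ t])
  fix t :: real assume "t \<in> {0..1}"
  obtain N where N: "\<And>s s'. \<forall>i<N. s i = s' i \<Longrightarrow> sub_concat y l s (2 * t) = sub_concat y l s' (2 * t)"
    using sub_concat_local[of y l "2 * t"] by blast
  obtain N' where N': "\<And>s s'. \<forall>i<N'. s i = s' i \<Longrightarrow>
      sub_concat y l s (1 - (2 * t - 1)) = sub_concat y l s' (1 - (2 * t - 1))"
    using sub_concat_local[of y l "1 - (2 * t - 1)"] by blast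
  show "\<exists>N. \<forall>z z'. (\<forall>i<N. z i = z' i) \<longrightarrow>
      loop_concat (sub_concat y l (fst \<circ> z)) (rev_path (sub_concat y l (snd \<circ> z))) t =
      loop_concat (sub_concat y l (fst \<circ> z')) (rev_path (sub_concat y l (snd \<circ> z'))) t"
  proof (intro exI allI impI)
    fix z z' :: "nat \<Rightarrow> bool \<times> bool" assume "\<forall>i<max N N'. z i = z' i"
    then have "sub_concat y l (fst \<circ> z) (2 * t) = sub_concat y l (fst \<circ> z') (2 * t)"
      "sub_concat y l (snd \<circ> z) (1 - (2 * t - 1)) = sub_concat y l (snd \<circ> z') (1 - (2 * t - 1))"
      by (intro N N'; simp)+
    then show "loop_concat (sub_concat y l (fst \<circ> z)) (rev_path (sub_concat y l (snd \<circ> z))) t =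
      loop_concat (sub_concat y l (fst \<circ> z')) (rev_path (sub_concat y l (snd \<circ> z'))) t"
      by (simp only: loop_concat_def rev_path_def)
  qed
qed (simp_all add: sub_concat_loop[OF l])

text \<open>The word is the edge \<open>H (0, t)\<close> of its own null homotopy, so a witness is
  two numbers and one map on the square.\<close>

definition witness :: "nat \<Rightarrow> nat \<Rightarrow> (real \<Rightarrow> 'a) \<Rightarrow> (real \<times> real \<Rightarrow> 'a) \<Rightarrow> bool" where
  "witness k n g H \<longleftrightarrow> \<not> q dvd k \<and> continuous_map (top_of_set ({0..1} \<times> {0..1})) X H \<and>
     (\<forall>s\<in>{0..1}. H (s, 0) = x0 \<and> H (s, 1) = x0) \<and> (\<forall>t\<in>{0..1}. H (1, t) = x0) \<and>
     radical_word x0 q k n g (\<lambda>t. H (0, t))"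

lemma mem_R_iff_witness:
  assumes g: "g \<in> loops_at X x0"
  shows "cls g \<in> gc.R \<longleftrightarrow> (\<exists>k n H. witness k n g H)"
proof -
  have "cls g \<in> gc.R \<longleftrightarrow> (\<exists>k. \<not> q dvd k \<and> (\<exists>n h. radical_word x0 q k n g h \<and> pathhom X h (\<lambda>_. x0)))"
    unfolding hom_radical_def using loop_class_in_carrier[OF g] by (simp only: mem_Collect_eq radical_word_iff[OF g] simp_thms)
  also have "\<dots> \<longleftrightarrow> (\<exists>k n H. witness k n g H)"
  proof safe
    fix k n h assume k: "\<not> q dvd k" and h: "radical_word x0 q k n g h" "pathhom X h (\<lambda>_. x0)"
    obtain H :: "real \<times> real \<Rightarrow> 'a" where H: "continuous_map (top_of_set ({0..1} \<times> {0..1})) X H"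
      "\<And>t. H (0, t) = h t" "\<And>t. H (1, t) = x0"
      "\<And>s. s \<in> {0..1} \<Longrightarrow> H (s, 0) = h 0" "\<And>s. s \<in> {0..1} \<Longrightarrow> H (s, 1) = h 1"
      by (rule pathhomE[OF h(2)]) (rule that)
    have "h 0 = x0" "h 1 = x0" using pathhom_ends[OF h(2)] by auto
    then have "witness k n g H" unfolding witness_def using k H h(1) by simp
    then show "\<exists>k n H. witness k n g H" by blast
  next
    fix k n H assume w: "witness k n g H"
    have "pathhom X (\<lambda>t. H (0, t)) (\<lambda>_. x0)"
      by (rule pathhomI[of X H]) (use w in \<open>auto simp: witness_def\<close>)
    then show "\<exists>k. \<not> q dvd k \<and> (\<exists>n h. radical_word x0 q k n g h \<and> pathhom X h (\<lambda>_. x0))"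
      using w unfolding witness_def by blast
  qed
  finally show ?thesis .
qed

text \<open>The first entry of a code fixes the shape of the word, the others a modulus of continuity of the
  null homotopy, which confines the witnesses to a compact set.\<close>

definition scheme :: "'a \<Rightarrow> (nat \<Rightarrow> real \<Rightarrow> 'a) \<Rightarrow> nat list \<Rightarrow> (nat \<Rightarrow> bool \<times> bool) set" where
  "scheme y l \<sigma> = {z. \<exists>k n H. witness k n (test_loop y l z) H \<and>
     (\<sigma> \<noteq> [] \<longrightarrow> hd \<sigma> = prod_encode (k, n)) \<and> (\<forall>j<length (tl \<sigma>). has_modulus H j (tl \<sigma> ! j))}"

lemma scheme_Nil:
  assumes l: "null_loops y l"
  shows "z \<in> scheme y l [] \<longleftrightarrow> theta (sub_concat y l (fst \<circ> z)) = theta (sub_concat y l (snd \<circ> z))"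
  unfolding test_loop_iff[OF l, symmetric] mem_R_iff_witness[OF test_loop_in[OF l]] by (simp add: scheme_def)

text \<open>At the root the next entry records the shape of the word; later it is a modulus for the
  next tolerance, which exists by uniform continuity.\<close>

lemma scheme_split: "scheme y l \<sigma> \<subseteq> (\<Union>n. scheme y l (\<sigma> @ [n]))"
proof
  fix z assume "z \<in> scheme y l \<sigma>"
  then obtain k n H where H: "witness k n (test_loop y l z) H" "\<sigma> \<noteq> [] \<longrightarrow> hd \<sigma> = prod_encode (k, n)"
    "\<forall>j<length (tl \<sigma>). has_modulus H j (tl \<sigma> ! j)" unfolding scheme_def by blast
  show "z \<in> (\<Union>n. scheme y l (\<sigma> @ [n]))"
  proof (cases "\<sigma> = []")
    case True
    then have "z \<in> scheme y l (\<sigma> @ [prod_encode (k, n)])" using H unfolding scheme_def by auto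
    then show ?thesis by blast
  next
    case False
    obtain m where m: "has_modulus H (length (tl \<sigma>)) m"
    proof -
      have "continuous_map (top_of_set ({0..1} \<times> {0..1})) X H" using H(1) by (simp add: witness_def)
      then show thesis using exists_modulus[of H] that by (auto simp: X_eq)
    qed
    obtain c \<rho> where \<sigma>: "\<sigma> = c # \<rho>" using False by (cases \<sigma>) auto
    have "has_modulus H j (tl (\<sigma> @ [m]) ! j)" if "j < length (tl (\<sigma> @ [m]))" for j
    proof (cases "j < length \<rho>")
      case True then show ?thesis using H(3) by (simp add: \<sigma> nth_append)
    next
      case False
      then have "j = length \<rho>" using that by (simp add: \<sigma>)
      then show ?thesis using m by (simp add: \<sigma>)
    qed
    then have "z \<in> scheme y l (\<sigma> @ [m])" using H False unfolding scheme_def by auto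
    then show ?thesis by blast
  qed
qed

text \<open>Witnesses for points close to \<open>z\<close> share the shape and more and more moduli
  coded by \<open>b\<close>. A pointwise cluster point of their homotopies inherits all the moduli,
  hence is continuous, and inherits boundary values and word equations. At each time the test loops
  eventually equal the one of \<open>z\<close>, so it witnesses \<open>z\<close>.\<close>

lemma scheme_limit:
  assumes l: "null_loops y l" and z: "\<And>k n. cyl (init z n) \<inter> scheme y l (init b k) \<noteq> {}"
  shows "z \<in> scheme y l []"
proof -
  let ?I = "{0..1::real}" and ?S = "{0..1} \<times> {0..1} :: (real \<times> real) set"
  obtain k n where kn: "b 0 = prod_encode (k, n)" by (metis prod_decode_inverse surj_pair)
  have "\<exists>z' H. z' \<in> cyl (init z i) \<and> witness k n (test_loop y l z') H \<and> (\<forall>j<i. has_modulus H j (b (Suc j)))" for i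
  proof -
    \<comment> \<open>The code is read to length \<open>Suc i\<close>: one entry for the shape and
      \<open>i\<close> moduli.\<close>
    obtain z' where z': "z' \<in> cyl (init z i)" "z' \<in> scheme y l (init b (Suc i))" using z[of i "Suc i"] by blast
    have b: "init b (Suc i) = b 0 # map (\<lambda>j. b (Suc j)) [0..<i]"
      by (simp add: init_def upt_conv_Cons map_Suc_upt[symmetric] del: upt_Suc)
    obtain k' n' H where H: "witness k' n' (test_loop y l z') H" "b 0 = prod_encode (k', n')"
      "\<forall>j<i. has_modulus H j (b (Suc j))"
      using z'(2) unfolding scheme_def b by auto
    have "k' = k" "n' = n" using H(2) kn by (metis prod_encode_inverse prod.inject)+
    then show ?thesis using z'(1) H by blast
  qed
  then have "\<forall>i. \<exists>z'. \<exists>H. z' \<in> cyl (init z i) \<and> witness k n (test_loop y l z') H \<and>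
      (\<forall>j<i. has_modulus H j (b (Suc j)))" ..
  from choice[OF this] obtain zs where "\<forall>i. \<exists>H. zs i \<in> cyl (init z i) \<and> witness k n (test_loop y l (zs i)) H \<and>
      (\<forall>j<i. has_modulus H j (b (Suc j)))" ..
  from choice[OF this] obtain Hs where p: "\<forall>i. zs i \<in> cyl (init z i) \<and> witness k n (test_loop y l (zs i)) (Hs i) \<and>
      (\<forall>j<i. has_modulus (Hs i) j (b (Suc j)))" ..
  have zs: "zs i j = z j" if "j < i" for i j
    using spec[OF p, of i] that by (simp add: cyl_def)
  have w: "witness k n (test_loop y l (zs i)) (Hs i)" for i using p by blast
  have md: "has_modulus (Hs i) j (b (Suc j))" if "j < i" for i j using p that by blast
  have HsM: "Hs i a \<in> M" if "a \<in> ?S" for i a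
  proof -
    have "Hs i \<in> topspace (top_of_set ?S) \<rightarrow> topspace X"
      using w[of i] continuous_map_funspace unfolding witness_def by blast
    then show ?thesis using that topspace_X by auto
  qed
  have "\<exists>H. (\<forall>a\<in>?S. H a \<in> M) \<and>
    (\<forall>a\<in>?S. \<forall>c\<in>?S. \<forall>\<epsilon>>0. \<forall>K. \<exists>i\<ge>K. d (Hs i a) (H a) < \<epsilon> \<and> d (Hs i c) (H c) < \<epsilon>)"
    by (rule pointwise_cluster_point[OF compact[unfolded X_eq]]) (rule HsM)
  then obtain H where H0: "(\<forall>a\<in>?S. H a \<in> M) \<and>
    (\<forall>a\<in>?S. \<forall>c\<in>?S. \<forall>\<epsilon>>0. \<forall>K. \<exists>i\<ge>K. d (Hs i a) (H a) < \<epsilon> \<and> d (Hs i c) (H c) < \<epsilon>)" ..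
  note H = conjunct1[OF H0] conjunct2[OF H0]
  have HM: "H a \<in> M" if "a \<in> ?S" for a using H(1) that by (rule bspec)
  have cl: "\<exists>i\<ge>K. d (Hs i a) (H a) < \<epsilon> \<and> d (Hs i c) (H c) < \<epsilon>"
    if "a \<in> ?S" "c \<in> ?S" "\<epsilon> > 0" for a c \<epsilon> K
    using bspec[OF bspec[OF H(2) that(1)] that(2)] that(3) by blast
  \<comment> \<open>Approximating indices occur arbitrarily late, so they meet any condition that
    holds eventually.\<close>
  have dist_le: "d (H a) (H c) \<le> r"
    if ac: "a \<in> ?S" "c \<in> ?S" "\<forall>\<^sub>F i in sequentially. d (Hs i a) (Hs i c) \<le> r" for a c r
  proof (rule field_le_epsilon)
    fix \<epsilon> :: real assume \<epsilon>: "\<epsilon> > 0"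
    obtain K where K: "\<And>i. i \<ge> K \<Longrightarrow> d (Hs i a) (Hs i c) \<le> r" using ac(3) by (auto simp: eventually_sequentially)
    obtain i where i: "i \<ge> K" "d (Hs i a) (H a) < \<epsilon> / 2" "d (Hs i c) (H c) < \<epsilon> / 2"
      using cl[OF ac(1,2), of "\<epsilon> / 2" K] \<epsilon> by auto
    have "d (H a) (H c) \<le> d (H a) (Hs i a) + d (Hs i a) (H c)"
      by (intro triangle HM HsM ac)
    also have "d (Hs i a) (H c) \<le> d (Hs i a) (Hs i c) + d (Hs i c) (H c)"
      by (intro triangle HM HsM ac)
    finally show "d (H a) (H c) \<le> r + \<epsilon>" using i K[OF i(1)] commute[of "H a" "Hs i a"] by linarith
  qed
  have eq: "H a = H c" if ac: "a \<in> ?S" "c \<in> ?S" "\<forall>\<^sub>F i in sequentially. Hs i a = Hs i c" for a c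
  proof -
    have "d (H a) (H c) \<le> 0"
      by (rule dist_le[OF ac(1,2)]) (use ac HsM in \<open>auto elim!: eventually_mono\<close>)
    then show ?thesis using HM ac zero nonneg by (metis order_antisym)
  qed
  have eqx: "H a = x" if a: "a \<in> ?S" "x \<in> M" "\<forall>\<^sub>F i in sequentially. Hs i a = x" for a x
  proof -
    have "d (H a) x \<le> 0"
    proof (rule field_le_epsilon)
      fix \<epsilon> :: real assume \<epsilon>: "\<epsilon> > 0"
      obtain K where K: "\<And>i. i \<ge> K \<Longrightarrow> Hs i a = x" using a(3) by (auto simp: eventually_sequentially)
      obtain i where "i \<ge> K" "d (Hs i a) (H a) < \<epsilon>" using cl[OF a(1) a(1) \<epsilon>, of K] by auto
      then show "d (H a) x \<le> 0 + \<epsilon>" using K[of i] commute[of x] by simp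
    qed
    then show ?thesis using HM a zero nonneg by (metis order_antisym)
  qed
  have x0M: "x0 \<in> M" using x0 topspace_X by simp
  have "continuous_map (top_of_set ?S) X H"
    unfolding X_eq
  proof (rule continuous_from_moduli)
    fix j
    show "has_modulus H j (b (Suc j))"
      unfolding has_modulus_def
    proof (intro ballI impI)
      fix a c assume ac: "a \<in> ?S" "c \<in> ?S" "dist a c < 1 / (real (b (Suc j)) + 1)"
      have "\<forall>i\<ge>Suc j. d (Hs i a) (Hs i c) \<le> 1 / (real j + 1)"
      proof (intro allI impI)
        fix i assume "Suc j \<le> i"
        then have "has_modulus (Hs i) j (b (Suc j))" by (intro md) simp
        then show "d (Hs i a) (Hs i c) \<le> 1 / (real j + 1)" using ac unfolding has_modulus_def by blast
      qed
      then show "d (H a) (H c) \<le> 1 / (real j + 1)"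
        by (intro dist_le[OF ac(1,2)]) (auto simp: eventually_sequentially)
    qed
  qed (use HM in auto)
  moreover have "\<forall>s\<in>?I. H (s, 0) = x0 \<and> H (s, 1) = x0" "\<forall>t\<in>?I. H (1, t) = x0"
    using w x0M unfolding witness_def by (auto intro!: eqx)
  moreover have "radical_word x0 q k n (test_loop y l z) (\<lambda>t. H (0, t))"
  proof (rule radical_word_limit[where hs = "\<lambda>i t. Hs i (0, t)" and gs = "\<lambda>i. test_loop y l (zs i)"])
    show "limit_eq (\<lambda>i t. Hs i (0, t)) (\<lambda>t. H (0, t)) (\<lambda>i t. Hs i (0, t)) (\<lambda>t. H (0, t))"
      unfolding limit_eq_def by (auto intro!: eq)
    show "limit_eq (\<lambda>_ _. x0) (\<lambda>_. x0) (\<lambda>i t. Hs i (0, t)) (\<lambda>t. H (0, t))"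
      unfolding limit_eq_def
    proof (intro ballI impI)
      fix s t :: real assume t: "t \<in> ?I" "\<forall>\<^sub>F i in sequentially. x0 = Hs i (0, t)"
      have "\<forall>\<^sub>F i in sequentially. Hs i (0, t) = x0" using t(2) by (rule eventually_mono) simp
      then have "H (0, t) = x0" using t(1) by (intro eqx x0M) simp_all
      then show "x0 = H (0, t)" by simp
    qed
    show "limit_eq (\<lambda>i. test_loop y l (zs i)) (test_loop y l z) (\<lambda>i t. Hs i (0, t)) (\<lambda>t. H (0, t))"
      unfolding limit_eq_def
    proof (intro ballI impI)
      fix s t :: real assume s: "s \<in> ?I" and t: "t \<in> ?I"
        and ev: "\<forall>\<^sub>F i in sequentially. test_loop y l (zs i) s = Hs i (0, t)"
      obtain N where N: "\<And>z z'. \<forall>i<N. z i = z' i \<Longrightarrow> test_loop y l z s = test_loop y l z' s"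
        using test_loop_local[OF l s] by blast
      have "\<forall>i\<ge>N. test_loop y l (zs i) s = test_loop y l z s"
        by (intro allI impI N) (simp add: zs)
      then have "\<forall>\<^sub>F i in sequentially. test_loop y l (zs i) s = test_loop y l z s"
        by (auto simp: eventually_sequentially)
      then have "\<forall>\<^sub>F i in sequentially. Hs i (0, t) = test_loop y l z s"
        using ev by eventually_elim simp
      moreover have "test_loop y l z s \<in> M"
        using test_loop_in[OF l, of z] pathin_mem[of X "test_loop y l z" s] s
        by (simp add: loops_at_ends flip: topspace_X)
      ultimately have "H (0, t) = test_loop y l z s" using t by (intro eqx) auto
      then show "test_loop y l z s = H (0, t)" by simp
    qed
    show "\<forall>\<^sub>F i in sequentially. radical_word x0 q k n (test_loop y l (zs i)) (\<lambda>t. Hs i (0, t))"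
      using w unfolding witness_def by simp
  qed
  ultimately have "witness k n (test_loop y l z) H" using w[of 0] unfolding witness_def by blast
  then show ?thesis unfolding scheme_def by auto
qed

text \<open>Flipping one bit in the first component changes the left side of the relation and leaves
  the right side fixed, so no flip stays in the relation.\<close>

lemma continuum_lepoll_quotient:
  assumes l: "null_loops y l" and "\<And>m. path_class (l m) \<notin> gc.R"
  shows "(UNIV :: nat set set) \<lesssim> carrier gc.A"
proof -
  have "s(m := (\<not> fst (s m), snd (s m))) \<notin> scheme y l []" if s: "s \<in> scheme y l []" for s m
  proof
    let ?s = "s(m := (\<not> fst (s m), snd (s m)))"
    assume "?s \<in> scheme y l []"
    then have "theta (sub_concat y l (fst \<circ> ?s)) = theta (sub_concat y l (snd \<circ> ?s))"
      by (simp add: scheme_Nil[OF l])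
    moreover have "snd \<circ> ?s = snd \<circ> s" "fst \<circ> ?s = (fst \<circ> s)(m := \<not> (fst \<circ> s) m)" by (auto simp: fun_eq_iff)
    ultimately show False
      using s theta_sub_concat_flip[OF l assms(2)[of m], of "fst \<circ> s"] by (simp add: scheme_Nil[OF l])
  qed
  from souslin_flip_family[of "scheme y l", OF scheme_split scheme_limit[OF l] this]
  obtain \<phi> :: "nat set \<Rightarrow> nat \<Rightarrow> bool"
    where \<phi>0: "\<forall>x x'. x \<noteq> x' \<longrightarrow> (\<lambda>i. (\<phi> x i, \<phi> x' i)) \<notin> scheme y l []" ..
  have \<phi>: "(\<lambda>i. (\<phi> x i, \<phi> x' i)) \<notin> scheme y l []" if "x \<noteq> x'" for x x'
    using \<phi>0 that by simp
  have "theta (sub_concat y l (\<phi> x)) \<noteq> theta (sub_concat y l (\<phi> x'))" if "x \<noteq> x'" for x x'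
    using \<phi>[OF that] by (simp add: scheme_Nil[OF l] o_def)
  then have "inj (\<lambda>x. theta (sub_concat y l (\<phi> x)))" unfolding inj_def by metis
  moreover have "range (\<lambda>x. theta (sub_concat y l (\<phi> x))) \<subseteq> carrier gc.A"
    using theta_closed sub_concat_loop(1)[OF l] by blast
  ultimately show ?thesis unfolding lepoll_def by blast
qed

lemma wild_point:
  assumes y: "y \<in> topspace X" and "\<And>U. openin X U \<Longrightarrow> y \<in> U \<Longrightarrow> \<not> tame_at y U"
  shows "(UNIV :: nat set set) \<lesssim> carrier gc.A"
proof -
  have "\<exists>l. pathin X l \<and> l 0 = y \<and> l 1 = y \<and> l ` {0..1} \<subseteq> mball y (1 / (real n + 1)) \<and> path_class l \<notin> gc.R" for n
  proof -
    have "openin X (mball y (1 / (real n + 1)))" by (simp add: X_eq)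
    moreover have "y \<in> mball y (1 / (real n + 1))" using y topspace_X by simp
    ultimately show ?thesis using assms(2) unfolding tame_at_def by blast
  qed
  then have "\<forall>n. \<exists>l. pathin X l \<and> l 0 = y \<and> l 1 = y \<and> l ` {0..1} \<subseteq> mball y (1 / (real n + 1)) \<and> path_class l \<notin> gc.R" ..
  from choice[OF this] obtain l where l: "\<And>n. pathin X (l n)" "\<And>n. l n 0 = y" "\<And>n. l n 1 = y"
    "\<And>n. l n ` {0..1} \<subseteq> mball y (1 / (real n + 1))" "\<And>n. path_class (l n) \<notin> gc.R" by blast
  have "\<exists>n. \<forall>i\<ge>n. l i ` {0..1} \<subseteq> mball y \<epsilon>" if \<epsilon>: "\<epsilon> > 0" for \<epsilon>
  proof -
    obtain n where n: "1 / (real n + 1) < \<epsilon>" using \<epsilon> nat_approx_posE by (metis add.commute of_nat_Suc)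
    have "l i ` {0..1} \<subseteq> mball y \<epsilon>" if "i \<ge> n" for i
    proof -
      have "1 / (real i + 1) \<le> 1 / (real n + 1)" using that by (simp add: frac_le)
      then have "mball y (1 / (real i + 1)) \<subseteq> mball y \<epsilon>" using n by (intro mball_subset_concentric) linarith
      then show ?thesis using l(4)[of i] by (rule subset_trans[rotated])
    qed
    then show ?thesis by blast
  qed
  then have "null_loops y l" using l y topspace_X unfolding null_loops_def by simp
  then show ?thesis using continuum_lepoll_quotient l(5) by blast
qed

end

section \<open>Counting homomorphisms\<close>

text \<open>A homomorphism is determined by its graph, coded as a set of sets of naturals by
  pairing.\<close>

lemma Hom_set_lepoll:
  fixes T :: "('b, 'n) monoid_scheme"
  assumes G: "carrier G \<lesssim> (UNIV :: nat set set)" and T: "countable (carrier T)"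
  shows "Hom_set G T \<lesssim> (UNIV :: nat set set set)"
proof -
  obtain e :: "_ \<Rightarrow> nat set" where e: "inj_on e (carrier G)" using G unfolding lepoll_def by blast
  obtain c :: "'b \<Rightarrow> nat" where c: "inj_on c (carrier T)" using T unfolding countable_def by blast
  have "infinite (UNIV :: nat set set)" by (simp add: Finite_Set.finite_set)
  from infinite_times_lepoll[OF this] obtain k :: "nat set \<times> nat set \<Rightarrow> nat set" where k: "inj k"
    unfolding lepoll_def by auto
  define \<Gamma> where "\<Gamma> f = (\<lambda>a. k (e a, {c (f a)})) ` carrier G" for f
  have "inj_on \<Gamma> (Hom_set G T)"
  proof (rule inj_onI)
    fix f f' assume f: "f \<in> Hom_set G T" "f' \<in> Hom_set G T" and eq: "\<Gamma> f = \<Gamma> f'"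
    have "f a = f' a" if a: "a \<in> carrier G" for a
    proof -
      have "k (e a, {c (f a)}) \<in> \<Gamma> f'" using a unfolding eq[symmetric] by (simp add: \<Gamma>_def)
      then obtain b where b: "b \<in> carrier G" "k (e a, {c (f a)}) = k (e b, {c (f' b)})" by (auto simp: \<Gamma>_def)
      then have "e a = e b" "c (f a) = c (f' b)" using injD[OF k b(2)] by auto
      then have "a = b" "c (f a) = c (f' a)" using inj_onD[OF e _ a b(1)] by auto
      moreover have "f a \<in> carrier T" "f' a \<in> carrier T" using f a unfolding Hom_set_def hom_def by auto
      ultimately show ?thesis using inj_onD[OF c] by blast
    qed
    then show "f = f'" using f unfolding Hom_set_def by (intro extensionalityI[of f "carrier G"]) auto
  qed
  then show ?thesis unfolding lepoll_def by blast
qed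

text \<open>Finite nets for the radii \<open>1 / (n + 1)\<close>: a ball of radius below half the
  distance of \<open>x\<close> and \<open>y\<close> that contains \<open>x\<close> misses
  \<open>y\<close>.\<close>

lemma (in Metric_space) countable_separating_family:
  assumes "compact_space mtopology"
  obtains D where "countable D"
    "\<And>x y. x \<in> M \<Longrightarrow> y \<in> M \<Longrightarrow> x \<noteq> y \<Longrightarrow> \<exists>c\<in>D. \<exists>n::nat. d c x < 1 / (n + 1) \<and> \<not> d c y < 1 / (n + 1)"
proof -
  have "mtotally_bounded M" using assms compact_space_eq_mcomplete_mtotally_bounded by blast
  then have "\<forall>n. \<exists>K. finite K \<and> K \<subseteq> M \<and> M \<subseteq> (\<Union>x\<in>K. mball x (1 / (real n + 1)))"
    unfolding mtotally_bounded_def by simp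
  from choice[OF this] obtain K where
    K: "\<forall>n. finite (K n) \<and> K n \<subseteq> M \<and> M \<subseteq> (\<Union>x\<in>K n. mball x (1 / (real n + 1)))" ..
  have "countable (\<Union>n. K n)" using K by (intro countable_UN) (auto intro: countable_finite)
  moreover have "\<exists>c\<in>(\<Union>n. K n). \<exists>n::nat. d c x < 1 / (n + 1) \<and> \<not> d c y < 1 / (n + 1)"
    if xy: "x \<in> M" "y \<in> M" "x \<noteq> y" for x y
  proof -
    have "d x y / 2 > 0" using xy by simp
    then obtain n where n: "1 / (real n + 1) < d x y / 2" using nat_approx_posE by (metis add.commute of_nat_Suc)
    obtain c where c: "c \<in> K n" "x \<in> mball c (1 / (real n + 1))" using K xy(1) by blast
    have "d x y \<le> d c x + d c y" using triangle[of x c y] c(2) xy commute[of x c] by auto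
    then have "d c x < 1 / (real n + 1) \<and> \<not> d c y < 1 / (real n + 1)" using n c(2) by auto
    then show ?thesis using c(1) by blast
  qed
  ultimately show thesis using that by blast
qed

context peano
begin

lemma pathin_eq_on_rationals:
  assumes f: "pathin X f" and g: "pathin X g"
    and eq: "\<And>r::rat. 0 \<le> r \<Longrightarrow> r \<le> 1 \<Longrightarrow> f (of_rat r) = g (of_rat r)" and t: "t \<in> {0..1}"
  shows "f t = g t"
proof (rule ccontr)
  assume ne: "f t \<noteq> g t"
  have M: "f s \<in> M" "g s \<in> M" if "s \<in> {0..1}" for s
    using pathin_mem[OF f] pathin_mem[OF g] that topspace_X by auto
  define \<epsilon> where "\<epsilon> = d (f t) (g t) / 2"
  have \<epsilon>: "\<epsilon> > 0" using ne M[OF t] by (simp add: \<epsilon>_def)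
  let ?U = "{s \<in> {0..1}. f s \<in> mball (f t) \<epsilon>} \<inter> {s \<in> {0..1}. g s \<in> mball (g t) \<epsilon>}"
  have "openin (top_of_set {0..1}) ?U"
    using openin_continuous_map_preimage[OF f[unfolded pathin_def], of "mball (f t) \<epsilon>"]
      openin_continuous_map_preimage[OF g[unfolded pathin_def], of "mball (g t) \<epsilon>"]
    by (intro openin_Int) (simp_all add: X_eq)
  moreover have "t \<in> ?U" using t \<epsilon> M[OF t] by simp
  ultimately obtain r where r: "r > 0" "ball t r \<inter> {0..1} \<subseteq> ?U"
    unfolding openin_contains_ball by blast
  obtain s :: rat where s: "of_rat s \<in> ball t r \<inter> {0..1::real}"
  \<comment> \<open>The rational is sought to the left of \<open>t\<close>, which is impossible at
    0.\<close>
  proof (cases "t = 0")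
    case True
    then have "of_rat 0 \<in> ball t r \<inter> {0..1::real}" using r(1) by simp
    then show thesis using that by blast
  next
    case False
    then have "max 0 (t - r) < t" using t r(1) by auto
    then obtain s where s: "max 0 (t - r) < of_rat s" "of_rat s < t" using of_rat_dense by blast
    moreover have "(of_rat s :: real) \<le> 1" using s(2) t unfolding atLeastAtMost_iff by linarith
    ultimately have "of_rat s \<in> ball t r \<inter> {0..1::real}"
      unfolding Int_iff mem_ball dist_real_def atLeastAtMost_iff by linarith
    then show thesis using that by blast
  qed
  have s01: "of_rat s \<in> {0..1::real}" using s by blast
  then have "f (of_rat s) = g (of_rat s)" by (intro eq) auto
  moreover have "d (f t) (f (of_rat s)) < \<epsilon>" "d (g t) (g (of_rat s)) < \<epsilon>" using r(2) s by auto
  ultimately show False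
    using triangle[of "f t" "f (of_rat s)" "g t"] M[OF t] M[OF s01] commute[of "g t"] by (simp add: \<epsilon>_def)
qed

text \<open>A path is determined by its values at rational times, and these by the balls of a
  countable family that contain them. This is a subset of a countable set, chosen for one
  representative of each class.\<close>

lemma carrier_pi1_lepoll: "carrier \<pi> \<lesssim> (UNIV :: nat set set)"
proof -
  obtain D where D: "countable D"
    "\<And>x y. x \<in> M \<Longrightarrow> y \<in> M \<Longrightarrow> x \<noteq> y \<Longrightarrow> \<exists>c\<in>D. \<exists>n::nat. d c x < 1 / (n + 1) \<and> \<not> d c y < 1 / (n + 1)"
    using countable_separating_family[OF compact[unfolded X_eq]] by metis
  obtain e :: "'a \<Rightarrow> nat" where e: "inj_on e D" using D(1) unfolding countable_def by blast
  define \<tau> where "\<tau> f = {to_nat (e c, n, r) | c n r. c \<in> D \<and> 0 \<le> r \<and> r \<le> 1 \<and> d c (f (of_rat r)) < 1 / (real n + 1)}"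
    for f :: "real \<Rightarrow> 'a"
  have \<tau>_iff: "to_nat (e c, n, r) \<in> \<tau> f \<longleftrightarrow> d c (f (of_rat r)) < 1 / (real n + 1)"
    if "c \<in> D" "0 \<le> r" "r \<le> 1" for c n r f
    using that inj_onD[OF e] unfolding \<tau>_def by auto
  have "\<forall>a\<in>carrier \<pi>. \<exists>f. f \<in> loops_at X x0 \<and> a = cls f" by (blast elim: carrier_fundamental_groupE)
  from bchoice[OF this] obtain rep where rep: "\<forall>a\<in>carrier \<pi>. rep a \<in> loops_at X x0 \<and> a = cls (rep a)" ..
  have "inj_on (\<lambda>a. \<tau> (rep a)) (carrier \<pi>)"
  proof (rule inj_onI)
    fix a b assume a: "a \<in> carrier \<pi>" and b: "b \<in> carrier \<pi>" and eq: "\<tau> (rep a) = \<tau> (rep b)"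
    have f: "pathin X (rep a)" and g: "pathin X (rep b)" using rep a b by (auto simp: loops_at_ends)
    have "rep a (of_rat r) = rep b (of_rat r)" if r: "0 \<le> r" "r \<le> 1" for r :: rat
    proof (rule ccontr)
      assume ne: "rep a (of_rat r) \<noteq> rep b (of_rat r)"
      have "0 \<le> (of_rat r :: real)" "(of_rat r :: real) \<le> 1" using r by auto
      then have "rep a (of_rat r) \<in> M" "rep b (of_rat r) \<in> M"
        using pathin_mem[OF f] pathin_mem[OF g] topspace_X by auto
      then obtain c n where "c \<in> D" "d c (rep a (of_rat r)) < 1 / (real n + 1)" "\<not> d c (rep b (of_rat r)) < 1 / (real n + 1)"
        using D(2) ne by blast
      then show False using \<tau>_iff r eq by metis
    qed
    then have "eq01 (rep a) (rep b)" unfolding eq01_def using pathin_eq_on_rationals[OF f g] by blast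
    then show "a = b" using cls_eq01[of "rep a" "rep b"] rep a b by auto
  qed
  then show ?thesis unfolding lepoll_def by blast
qed

text \<open>The pointwise quotient of two homomorphisms into an abelian group is a homomorphism, to
  which \<open>det\<close> applies.\<close>

lemma Hom_set_determined:
  assumes T: "char_group T q" and F: "F \<subseteq> carrier \<pi>"
    and det: "\<forall>f\<in>hom \<pi> T. (\<forall>a\<in>F. f a = \<one>\<^bsub>T\<^esub>) \<longrightarrow> (\<forall>a\<in>carrier \<pi>. f a = \<one>\<^bsub>T\<^esub>)"
  shows "Hom_set \<pi> T \<lesssim> (F \<rightarrow>\<^sub>E carrier T)"
proof -
  interpret T: char_group T q by (rule T)
  have "inj_on (\<lambda>f. restrict f F) (Hom_set \<pi> T)"
  proof (rule inj_onI)
    fix f f' assume f: "f \<in> Hom_set \<pi> T" and f': "f' \<in> Hom_set \<pi> T" and eq: "restrict f F = restrict f' F"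
    have h: "f \<in> hom \<pi> T" "f' \<in> hom \<pi> T" using f f' by (auto simp: Hom_set_def)
    have cl: "f a \<in> carrier T" "f' a \<in> carrier T" if "a \<in> carrier \<pi>" for a
      using h that by (auto simp: hom_def)
    have "(\<lambda>a. f a \<otimes>\<^bsub>T\<^esub> inv\<^bsub>T\<^esub> f' a) \<in> hom \<pi> T"
    proof (rule homI)
      fix a b assume ab: "a \<in> carrier \<pi>" "b \<in> carrier \<pi>"
      show "f (a \<otimes>\<^bsub>\<pi>\<^esub> b) \<otimes>\<^bsub>T\<^esub> inv\<^bsub>T\<^esub> f' (a \<otimes>\<^bsub>\<pi>\<^esub> b) =
        (f a \<otimes>\<^bsub>T\<^esub> inv\<^bsub>T\<^esub> f' a) \<otimes>\<^bsub>T\<^esub> (f b \<otimes>\<^bsub>T\<^esub> inv\<^bsub>T\<^esub> f' b)"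
        using ab cl by (simp add: hom_mult[OF h(1)] hom_mult[OF h(2)] T.inv_mult T.m_ac)
    qed (use cl in auto)
    moreover have "f a \<otimes>\<^bsub>T\<^esub> inv\<^bsub>T\<^esub> f' a = \<one>\<^bsub>T\<^esub>" if "a \<in> F" for a
    proof -
      have "f a = f' a" using eq that by (metis restrict_apply')
      then show ?thesis using cl that F by auto
    qed
    ultimately have one: "\<forall>a\<in>carrier \<pi>. f a \<otimes>\<^bsub>T\<^esub> inv\<^bsub>T\<^esub> f' a = \<one>\<^bsub>T\<^esub>"
      by (intro det[rule_format, THEN ballI]) simp_all
    have "f a = f' a" if "a \<in> carrier \<pi>" for a
      using T.inv_equality[OF bspec[OF one that]] cl[OF that] by simp
    then show "f = f'" using f f' unfolding Hom_set_def by (intro extensionalityI[of f "carrier \<pi>"]) auto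
  qed
  moreover have "(\<lambda>f. restrict f F) ` Hom_set \<pi> T \<subseteq> (F \<rightarrow>\<^sub>E carrier T)"
    using F by (auto simp: Hom_set_def hom_def PiE_iff)
  ultimately show ?thesis unfolding lepoll_def by blast
qed

text \<open>The first alternative is bounded by the functions from a finite set to \<open>T\<close>,
  so that it yields finiteness for finite \<open>T\<close> and countability for countable
  \<open>T\<close>.\<close>

lemma Hom_set_dichotomy:
  fixes T :: "('t, 'n) monoid_scheme"
  assumes T: "char_group T q"
    and root: "\<And>t k. t \<in> carrier T \<Longrightarrow> \<not> q dvd k \<Longrightarrow> \<exists>u\<in>carrier T. u [^]\<^bsub>T\<^esub> (k::nat) = t"
    and countable: "countable (carrier T)" and nontrivial: "\<exists>t\<in>carrier T. t \<noteq> \<one>\<^bsub>T\<^esub>"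
  shows "(\<exists>F :: (real \<Rightarrow> 'a) set set. finite F \<and> Hom_set \<pi> T \<lesssim> (F \<rightarrow>\<^sub>E carrier T)) \<or> Hom_set \<pi> T \<approx> Pow (Pow (UNIV :: nat set))"
proof (cases "\<forall>y\<in>topspace X. \<exists>U. openin X U \<and> y \<in> U \<and> tame_at y U")
  case True
  have "\<exists>F. F \<subseteq> carrier \<pi> \<and> finite F \<and>
    (\<forall>f\<in>hom \<pi> T. (\<forall>a\<in>F. f a = \<one>\<^bsub>T\<^esub>) \<longrightarrow> (\<forall>a\<in>carrier \<pi>. f a = \<one>\<^bsub>T\<^esub>))"
    by (rule finite_determining_set[OF _ T]) (rule True[rule_format])
  then obtain F where F0: "F \<subseteq> carrier \<pi> \<and> finite F \<and>
    (\<forall>f\<in>hom \<pi> T. (\<forall>a\<in>F. f a = \<one>\<^bsub>T\<^esub>) \<longrightarrow> (\<forall>a\<in>carrier \<pi>. f a = \<one>\<^bsub>T\<^esub>))" ..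
  note F = conjunct1[OF F0] conjunct1[OF conjunct2[OF F0]] conjunct2[OF conjunct2[OF F0]]
  from F(2) Hom_set_determined[OF T F(1,3)] show ?thesis by (intro disjI1 exI conjI)
next
  case False
  then obtain y where y: "y \<in> topspace X" "\<not> (\<exists>U. openin X U \<and> y \<in> U \<and> tame_at y U)" by blast
  have big: "(UNIV :: nat set set) \<lesssim> carrier gc.A" by (rule wild_point[OF y(1)]) (use y(2) in blast)
  interpret cg: char_groups gc.A T q
    by (intro char_groups.intro char_groups_axioms.intro gc.A_char_group T root)
  from cg.many_homs[OF big nontrivial] obtain F :: "nat set set \<Rightarrow> _ \<Rightarrow> 't"
    where F0: "(\<forall>Y. F Y \<in> hom gc.A T) \<and> (\<forall>Y Y'. Y \<noteq> Y' \<longrightarrow> (\<exists>a\<in>carrier gc.A. F Y a \<noteq> F Y' a))" ..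
  have F: "F Y \<in> hom gc.A T" "Y \<noteq> Y' \<Longrightarrow> \<exists>a\<in>carrier gc.A. F Y a \<noteq> F Y' a" for Y Y'
    using F0 by simp_all
  define \<Phi> where "\<Phi> Y = restrict (\<lambda>g. F Y (gc.R #>\<^bsub>\<pi>\<^esub> g)) (carrier \<pi>)" for Y
  have "\<Phi> Y \<in> Hom_set \<pi> T" for Y
  proof -
    have "(\<lambda>g. F Y (gc.R #>\<^bsub>\<pi>\<^esub> g)) \<in> hom \<pi> T"
      using hom_compose[OF gc.proj_hom F(1)[of Y]] by (simp add: o_def)
    then have "\<Phi> Y \<in> hom \<pi> T" unfolding \<Phi>_def by (auto simp: hom_def)
    then show ?thesis by (simp add: Hom_set_def \<Phi>_def)
  qed
  moreover have "inj \<Phi>"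
  proof (rule injI)
    fix Y Y' assume eq: "\<Phi> Y = \<Phi> Y'"
    show "Y = Y'"
    proof (rule ccontr)
      assume "Y \<noteq> Y'"
      then obtain a where a: "a \<in> carrier gc.A" "F Y a \<noteq> F Y' a" using F(2) by blast
      then obtain g where "g \<in> carrier \<pi>" "a = gc.R #>\<^bsub>\<pi>\<^esub> g" using gc.carrier_A by blast
      then show False using a(2) fun_cong[OF eq, of g] by (simp add: \<Phi>_def)
    qed
  qed
  ultimately have "(UNIV :: nat set set set) \<lesssim> Hom_set \<pi> T" unfolding lepoll_def by blast
  then have "Hom_set \<pi> T \<approx> (UNIV :: nat set set set)"
    using Hom_set_lepoll[OF carrier_pi1_lepoll countable] by (rule lepoll_antisym[rotated])
  then show ?thesis by simp
qed

end

lemma peano_exists: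
  assumes "peano_continuum X" "x0 \<in> topspace X" "characteristic q"
  shows "\<exists>P M d. peano X x0 P M d q"
proof -
  obtain M d where Md: "Metric_space M d" "X = Metric_space.mtopology M d"
    using assms(1) unfolding peano_continuum_def metrizable_space_def by blast
  have "path_connected_space X" using assms(1) by (simp add: peano_continuum_def)
  from path_class_exists[OF this assms(2)] obtain P where
    P: "\<forall>u\<in>topspace X. pathin X (P u) \<and> P u 0 = x0 \<and> P u 1 = u" "P x0 = (\<lambda>_. x0)" by blast
  have "peano X x0 P M d q"
    unfolding peano_def peano_axioms_def based_space_def
    using assms Md P by (simp add: peano_continuum_def)
  then show ?thesis by blast
qed

section \<open>The coefficient groups\<close>

lemma characteristic_prime: "prime p \<Longrightarrow> characteristic p"
  by unfold_locales (auto simp: prime_dvd_mult_iff)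

lemma characteristic_0: "characteristic 0"
  by unfold_locales auto

lemma char_group_integer_mod:
  assumes p: "prime p" shows "char_group (integer_mod_group p) p"
proof (intro char_group.intro char_group_axioms.intro abelian_integer_mod_group)
  show "p \<noteq> 1" using p by auto
  fix a assume a: "a \<in> carrier (integer_mod_group p)"
  then have a': "0 \<le> a" "a < int p" using p by (auto simp: carrier_integer_mod_group split: if_splits)
  show "a [^]\<^bsub>integer_mod_group p\<^esub> p = \<one>\<^bsub>integer_mod_group p\<^esub>" by simp
  fix k :: nat assume k: "\<not> p dvd k" "a [^]\<^bsub>integer_mod_group p\<^esub> k = \<one>\<^bsub>integer_mod_group p\<^esub>"
  then have "int p dvd int k * a" by (simp add: mod_eq_0_iff_dvd)
  then have "int p dvd a" using p k(1) prime_dvd_mult_iff[of "int p" "int k" a] by simp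
  then show "a = \<one>\<^bsub>integer_mod_group p\<^esub>" using a' zdvd_not_zless[of a "int p"] by fastforce
qed

lemma integer_mod_group_root:
  assumes p: "prime p" and t: "t \<in> carrier (integer_mod_group p)" and k: "\<not> p dvd k"
  shows "\<exists>u\<in>carrier (integer_mod_group p). u [^]\<^bsub>integer_mod_group p\<^esub> (k::nat) = t"
proof -
  have t': "0 \<le> t" "t < int p" and p0: "p > 0"
    using t p by (auto simp: carrier_integer_mod_group prime_gt_0_nat split: if_splits)
  have "coprime (int k) (int p)" using p k prime_imp_coprime[of p k] by (simp add: coprime_commute)
  \<comment> \<open>By Bezout, \<open>u\<close> inverts \<open>k\<close> modulo \<open>p\<close>,
    and \<open>u * t\<close> is the root.\<close>
  then obtain u v where uv: "u * int k + v * int p = 1" using bezout_int[of "int k" "int p"] by auto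
  have "(int k * ((u * t) mod int p)) mod int p = (u * int k * t) mod int p"
    by (simp add: mod_mult_right_eq ac_simps)
  also have "u * int k * t = t + int p * (- v * t)"
  proof -
    have "t * (u * int k + v * int p) = t" using uv by simp
    then show ?thesis by (simp add: algebra_simps)
  qed
  also have "(t + int p * (- v * t)) mod int p = t" using t' by (simp only: mod_mult_self2) simp
  finally have "((u * t) mod int p) [^]\<^bsub>integer_mod_group p\<^esub> k = t" by simp
  moreover have "(u * t) mod int p \<in> carrier (integer_mod_group p)" using p0 by (simp add: carrier_integer_mod_group)
  ultimately show ?thesis by blast
qed

lemma comm_group_rat_add: "comm_group rat_add_group"
proof (rule comm_groupI)
  fix x :: rat assume "x \<in> carrier rat_add_group"
  have "- x \<otimes>\<^bsub>rat_add_group\<^esub> x = \<one>\<^bsub>rat_add_group\<^esub>" by (simp add: rat_add_group_def)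
  then show "\<exists>y\<in>carrier rat_add_group. y \<otimes>\<^bsub>rat_add_group\<^esub> x = \<one>\<^bsub>rat_add_group\<^esub>"
    by (intro bexI[of _ "- x"]) (simp_all add: rat_add_group_def)
qed (simp_all add: rat_add_group_def)

lemma rat_add_group_pow: "x [^]\<^bsub>rat_add_group\<^esub> (k::nat) = of_nat k * x"
  by (induction k) (simp_all add: rat_add_group_def nat_pow_def algebra_simps)

lemma char_group_rat_add: "char_group rat_add_group 0"
proof (intro char_group.intro char_group_axioms.intro comm_group_rat_add)
  fix a :: rat and k :: nat
  assume "\<not> 0 dvd k" "a [^]\<^bsub>rat_add_group\<^esub> k = \<one>\<^bsub>rat_add_group\<^esub>"
  then show "a = \<one>\<^bsub>rat_add_group\<^esub>" by (simp add: rat_add_group_pow) (simp add: rat_add_group_def)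
qed simp_all

theorem theorem3p7:
  fixes X :: "'a topology" and x0 :: 'a and p :: nat
  assumes "peano_continuum X" and "x0 \<in> topspace X" and "prime p"
  shows "(finite (Hom_set (fundamental_group X x0) (integer_mod_group p)) \<or>
          Hom_set (fundamental_group X x0) (integer_mod_group p) \<approx> Pow (Pow (UNIV :: nat set)))
       \<and> (countable (Hom_set (fundamental_group X x0) rat_add_group) \<or>
          Hom_set (fundamental_group X x0) rat_add_group \<approx> Pow (Pow (UNIV :: nat set)))"
proof
  let ?G = "fundamental_group X x0"
  have p: "p > 0" "p \<noteq> 1" using assms(3) prime_gt_0_nat by auto
  have fin: "finite (carrier (integer_mod_group p))" using p(1) by (simp add: carrier_integer_mod_group)
  obtain P M d where "peano X x0 P M d p"
    using peano_exists[OF assms(1,2) characteristic_prime[OF assms(3)]] by blast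
  then have "(\<exists>F :: (real \<Rightarrow> 'a) set set. finite F \<and> Hom_set ?G (integer_mod_group p) \<lesssim> (F \<rightarrow>\<^sub>E carrier (integer_mod_group p))) \<or>
      Hom_set ?G (integer_mod_group p) \<approx> Pow (Pow (UNIV :: nat set))"
  proof (rule peano.Hom_set_dichotomy[OF _ char_group_integer_mod[OF assms(3)] integer_mod_group_root[OF assms(3)]])
    show "countable (carrier (integer_mod_group p))" using fin by (rule countable_finite)
    show "\<exists>t\<in>carrier (integer_mod_group p). t \<noteq> \<one>\<^bsub>integer_mod_group p\<^esub>" using p by (intro bexI[of _ 1]) auto
  qed
  then show "finite (Hom_set ?G (integer_mod_group p)) \<or> Hom_set ?G (integer_mod_group p) \<approx> Pow (Pow (UNIV :: nat set))"
  proof (elim disjE exE conjE)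
    fix F :: "(real \<Rightarrow> 'a) set set"
    assume "finite F" and le: "Hom_set ?G (integer_mod_group p) \<lesssim> (F \<rightarrow>\<^sub>E carrier (integer_mod_group p))"
    then have "finite (F \<rightarrow>\<^sub>E carrier (integer_mod_group p))" using fin by (intro finite_PiE)
    then have "finite (Hom_set ?G (integer_mod_group p))"
      using le inj_on_finite unfolding lepoll_def by blast
    then show ?thesis ..
  qed (rule disjI2)
next
  let ?G = "fundamental_group X x0"
  obtain P M d where "peano X x0 P M d 0" using peano_exists[OF assms(1,2) characteristic_0] by blast
  then have "(\<exists>F :: (real \<Rightarrow> 'a) set set. finite F \<and> Hom_set ?G rat_add_group \<lesssim> (F \<rightarrow>\<^sub>E carrier rat_add_group)) \<or>
      Hom_set ?G rat_add_group \<approx> Pow (Pow (UNIV :: nat set))"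
  proof (rule peano.Hom_set_dichotomy[OF _ char_group_rat_add])
    fix t :: rat and k :: nat assume "\<not> 0 dvd k"
    then show "\<exists>u\<in>carrier rat_add_group. u [^]\<^bsub>rat_add_group\<^esub> k = t"
      by (intro bexI[of _ "t / of_nat k"]) (auto simp: rat_add_group_pow, simp add: rat_add_group_def)
  next
    show "countable (carrier rat_add_group)" by simp
    show "\<exists>t\<in>carrier rat_add_group. t \<noteq> \<one>\<^bsub>rat_add_group\<^esub>"
      by (intro bexI[of _ 1]) (simp_all add: rat_add_group_def)
  qed
  then show "countable (Hom_set ?G rat_add_group) \<or> Hom_set ?G rat_add_group \<approx> Pow (Pow (UNIV :: nat set))"
  proof (elim disjE exE conjE)
    fix F :: "(real \<Rightarrow> 'a) set set"
    assume "finite F" and le: "Hom_set ?G rat_add_group \<lesssim> (F \<rightarrow>\<^sub>E carrier rat_add_group)"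
    then have "countable (F \<rightarrow>\<^sub>E carrier rat_add_group)" by (intro countable_PiE) auto
    then show ?thesis using le by (intro disjI1) (rule countable_lepoll)
  qed (rule disjI2)
qed

end
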